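(* Let $\mathbb{S}^3$ be the round sphere equipped with the metric of curvature $1$, and let $\eta$ be the Reeb vector field that defines the Hopf fibration. Then, for any $t\in\mathbb{R}$, the spectrum of the magnetic Dirac operator $D^{t\eta}$ is given (as a set) by the numbers $$\frac32\pm t+k\quad(k\in\mathbb{N},\ k\ge 0),\qquad \frac12\pm\sqrt{(1+t+2p-k)^2+4(k-p)(p+1)}\quad(p,k\in\mathbb{N},\ 0\leq p<k).$$
   Context: On $\mathbb{S}^3\subset\mathbb{C}^2$ with coordinates $z_j=x_j+iy_j$, $\eta=\sum_{j=1}^2(-y_j\partial_{x_j}+x_j\partial_{y_j})$ (identified with its dual one-form). It is completed to a global orthonormal frame $(Y_2,Y_3,Y_4)$ by $Y_2=\eta$, $Y_3=-y_2\partial_{x_1}-x_2\partial_{y_1}+y_1\partial_{x_2}+x_1\partial_{y_2}$, $Y_4=x_2\partial_{x_1}-y_2\partial_{y_1}-x_1\partial_{x_2}+y_1\partial_{y_2}$. $\Sigma\mathbb{S}^3$ is the complex spinor bundle (rank $2$) for the unique spin structure, with Levi-Civita spinorial connection $\nabla$, Clifford multiplication with $X\cdot Y\cdot\varphi+Y\cdot X\cdot\varphi=-2g(X,Y)\varphi$, and with the convention that $-Y_2\cdot Y_3\cdot Y_4\cdot$ acts as the identity on $\Sigma\mathbb{S}^3$. $D=\sum_k e_k\cdot\nabla_{e_k}$ is the Dirac operator and $D^{t\eta}=D+it\eta\cdot$. *)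

theory Defs
  imports "HOL-Analysis.Analysis"
begin

section \<open>The round sphere and its Riemannian measure\<close>

type_synonym C2 = "complex \<times> complex"
type_synonym spinor = "complex ^ 2"

text \<open>The product type carries the Euclidean inner product of
  \<open>\<real>\<^sup>4\<close>, so the unit sphere with the induced metric has curvature 1.\<close>

abbreviation S3 :: "C2 set" where
  "S3 \<equiv> sphere 0 1"

text \<open>Riemannian volume by the cone formula: the measure of \<open>A\<close> is \<open>4\<close> times the
  Lebesgue measure of the cone \<open>{r x | 0 < r < 1, x \<in> A}\<close>.\<close>

definition S3_measure :: "C2 measure" where
  "S3_measure = scale_measure 4
     (distr (restrict_space lborel (ball 0 1 - {0})) (restrict_space borel S3)
            (\<lambda>x. x /\<^sub>R norm x))"

section \<open>Calculus on the sphere\<close>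

text \<open>Sections of trivial bundles over the sphere are represented by functions on the
  ambient space; their values off the sphere never matter.  To differentiate
  such a function, it is first extended to the punctured space as a function that is
  constant on rays.\<close>

definition radial :: "(C2 \<Rightarrow> 'b) \<Rightarrow> C2 \<Rightarrow> 'b" where
  "radial f x = f (x /\<^sub>R norm x)"

definition dir_deriv :: "(C2 \<Rightarrow> 'b::real_normed_vector) \<Rightarrow> C2 \<Rightarrow> C2 \<Rightarrow> 'b" where
  "dir_deriv f z X = frechet_derivative (radial f) (at z) X"

primrec Ck_on :: "nat \<Rightarrow> 'a::real_normed_vector set \<Rightarrow> ('a \<Rightarrow> 'b::real_normed_vector) \<Rightarrow> bool" where
  "Ck_on 0 U f \<longleftrightarrow> continuous_on U f"
| "Ck_on (Suc n) U f \<longleftrightarrow> (\<forall>x\<in>U. f differentiable (at x)) \<and>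
     (\<forall>v. Ck_on n U (\<lambda>x. frechet_derivative f (at x) v))"

text \<open>The map \<open>x \<mapsto> x / |x|\<close> is a smooth retraction of the punctured space onto the sphere,
  so a map on the sphere is smooth iff its radial extension is.\<close>

definition smooth_on_S3 :: "(C2 \<Rightarrow> 'b::real_normed_vector) \<Rightarrow> bool" where
  "smooth_on_S3 f \<longleftrightarrow> (\<forall>n. Ck_on n (- {0}) (radial f))"

text \<open>Levi-Civita connection of a submanifold of Euclidean space: tangential part of the
  flat derivative of the tangent vector field \<open>V\<close> in the direction \<open>X\<close> tangent at \<open>z\<close>.\<close>

definition levi_civita :: "C2 \<Rightarrow> C2 \<Rightarrow> (C2 \<Rightarrow> C2) \<Rightarrow> C2" where
  "levi_civita z X V = dir_deriv V z X - (dir_deriv V z X \<bullet> z) *\<^sub>R z"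

section \<open>The global frame\<close>

definition reeb :: "C2 \<Rightarrow> C2" where
  "reeb = (\<lambda>(z1, z2). (Complex (- Im z1) (Re z1), Complex (- Im z2) (Re z2)))"

definition Y3 :: "C2 \<Rightarrow> C2" where
  "Y3 = (\<lambda>(z1, z2). (Complex (- Im z2) (- Re z2), Complex (Im z1) (Re z1)))"

definition Y4 :: "C2 \<Rightarrow> C2" where
  "Y4 = (\<lambda>(z1, z2). (Complex (Re z2) (- Im z2), Complex (- Re z1) (Im z1)))"

abbreviation frame_idx :: "nat set" where "frame_idx \<equiv> {2, 3, 4}"

definition Y :: "nat \<Rightarrow> C2 \<Rightarrow> C2" where
  "Y k = (if k = 2 then reeb else if k = 3 then Y3 else Y4)"

lemma Y_orthonormal_tangent:
  assumes "z \<in> S3" "j \<in> frame_idx" "k \<in> frame_idx"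
  shows "Y k z \<bullet> z = 0" and "Y j z \<bullet> Y k z = (if j = k then 1 else 0)"
proof -
  have "z \<bullet> z = 1" using assms(1) by (simp add: dot_square_norm)
  then have n: "Re (fst z) * Re (fst z) + Im (fst z) * Im (fst z)
      + (Re (snd z) * Re (snd z) + Im (snd z) * Im (snd z)) = 1"
    by (cases z) (simp add: inner_complex_def)
  show "Y k z \<bullet> z = 0" using assms
    by (cases z) (auto simp: Y_def reeb_def Y3_def Y4_def inner_complex_def algebra_simps)
  show "Y j z \<bullet> Y k z = (if j = k then 1 else 0)" using assms n
    by (cases z) (auto simp: Y_def reeb_def Y3_def Y4_def inner_complex_def algebra_simps)
qed

section \<open>Spinors\<close>

text \<open>The frame \<open>(Y 2, Y 3, Y 4)\<close> trivializes the frame bundle; its lift trivializes the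
  (unique) spin structure, hence also the spinor bundle.  In this trivialization spinor
  fields are functions with values in the spinor module, and Clifford multiplication by
  \<open>Y k\<close> is a constant matrix \<open>c k\<close>.  The following says that the matrices \<open>c 2, c 3, c 4\<close> make
  the spinor space a Hermitian Clifford module on which minus the volume element is the identity.\<close>

definition herm :: "spinor \<Rightarrow> spinor \<Rightarrow> complex" where
  "herm \<phi> \<psi> = (\<Sum>i\<in>UNIV. \<phi> $ i * cnj (\<psi> $ i))"

definition spinor_module :: "(nat \<Rightarrow> complex ^ 2 ^ 2) \<Rightarrow> bool" where
  "spinor_module c \<longleftrightarrow>
     (\<forall>j\<in>frame_idx. \<forall>k\<in>frame_idx. c j ** c k + c k ** c j = mat (if j = k then - 2 else 0)) \<and>
     (\<forall>k\<in>frame_idx. \<forall>\<phi> \<psi>. herm (c k *v \<phi>) \<psi> = - herm \<phi> (c k *v \<psi>)) \<and>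
     - (c 2 ** c 3 ** c 4) = mat 1"

lemma spinor_module_exists: "\<exists>c. spinor_module c"
proof -
  define c :: "nat \<Rightarrow> complex ^ 2 ^ 2" where "c k =
    (if k = 2 then vector [vector [- \<i>, 0], vector [0, \<i>]]
     else if k = 3 then vector [vector [0, 1], vector [- 1, 0]]
     else vector [vector [0, - \<i>], vector [- \<i>, 0]])" for k
  have "spinor_module c"
    unfolding spinor_module_def c_def herm_def
    by (auto simp: vec_eq_iff matrix_matrix_mult_def matrix_vector_mult_def mat_def
        sum_2 forall_2 algebra_simps)
  then show ?thesis by blast
qed

definition clifford :: "(nat \<Rightarrow> complex ^ 2 ^ 2) \<Rightarrow> C2 \<Rightarrow> C2 \<Rightarrow> spinor \<Rightarrow> spinor" where
  "clifford c z X \<phi> = (\<Sum>k\<in>frame_idx. (X \<bullet> Y k z) *\<^sub>R (c k *v \<phi>))"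

text \<open>Spinorial Levi-Civita connection: the lift to the spin group of the connection form of
  the frame acts by \<open>1/4 \<Sum>\<^sub>j\<^sub>k g(\<nabla>\<^sub>X e\<^sub>j, e\<^sub>k) e\<^sub>j \<cdot> e\<^sub>k\<close>.\<close>

definition spin_connection ::
  "(nat \<Rightarrow> complex ^ 2 ^ 2) \<Rightarrow> C2 \<Rightarrow> C2 \<Rightarrow> (C2 \<Rightarrow> spinor) \<Rightarrow> spinor" where
  "spin_connection c z X \<phi> = dir_deriv \<phi> z X +
     (1/4) *\<^sub>R (\<Sum>j\<in>frame_idx. \<Sum>k\<in>frame_idx. (levi_civita z X (Y j) \<bullet> Y k z) *\<^sub>R
        clifford c z (Y j z) (clifford c z (Y k z) (\<phi> z)))"

definition dirac :: "(nat \<Rightarrow> complex ^ 2 ^ 2) \<Rightarrow> (C2 \<Rightarrow> spinor) \<Rightarrow> C2 \<Rightarrow> spinor" where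
  "dirac c \<phi> z = (\<Sum>k\<in>frame_idx. clifford c z (Y k z) (spin_connection c z (Y k z) \<phi>))"

definition magnetic_dirac ::
  "(nat \<Rightarrow> complex ^ 2 ^ 2) \<Rightarrow> real \<Rightarrow> (C2 \<Rightarrow> spinor) \<Rightarrow> C2 \<Rightarrow> spinor" where
  "magnetic_dirac c t \<phi> z =
     dirac c \<phi> z + (\<i> * complex_of_real t) *s clifford c z (reeb z) (\<phi> z)"

section \<open>Spectrum in the Hilbert space of square-integrable spinors\<close>

text \<open>Square-integrable spinors are represented by functions rather than by classes modulo null sets;
  an unbounded operator is represented by its graph, a relation that is invariant
  under almost everywhere equality.\<close>

definition L2_spinors :: "(C2 \<Rightarrow> spinor) set" where
  "L2_spinors = {\<phi>. \<phi> \<in> borel_measurable S3_measure \<and>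
     integrable S3_measure (\<lambda>z. (norm (\<phi> z))\<^sup>2)}"

definition L2norm :: "(C2 \<Rightarrow> spinor) \<Rightarrow> real" where
  "L2norm \<phi> = sqrt (integral\<^sup>L S3_measure (\<lambda>z. (norm (\<phi> z))\<^sup>2))"

text \<open>Graph of the closure of the operator \<open>T\<close> with domain the smooth spinors.\<close>

definition closure_graph ::
  "((C2 \<Rightarrow> spinor) \<Rightarrow> C2 \<Rightarrow> spinor) \<Rightarrow> (C2 \<Rightarrow> spinor) \<Rightarrow> (C2 \<Rightarrow> spinor) \<Rightarrow> bool" where
  "closure_graph T \<phi> \<psi> \<longleftrightarrow> \<phi> \<in> L2_spinors \<and> \<psi> \<in> L2_spinors \<and>
     (\<exists>f :: nat \<Rightarrow> C2 \<Rightarrow> spinor. (\<forall>n. smooth_on_S3 (f n)) \<and>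
        (\<lambda>n. L2norm (\<lambda>z. f n z - \<phi> z)) \<longlonglongrightarrow> 0 \<and>
        (\<lambda>n. L2norm (\<lambda>z. T (f n) z - \<psi> z)) \<longlonglongrightarrow> 0)"

text \<open>The first condition below is surjectivity of \<open>T - \<mu>\<close>; the second says that \<open>T - \<mu>\<close>
  is injective (modulo null sets) with bounded inverse.\<close>

definition resolvent_set :: "((C2 \<Rightarrow> spinor) \<Rightarrow> C2 \<Rightarrow> spinor) \<Rightarrow> complex set" where
  "resolvent_set T = {\<mu>.
     (\<forall>\<psi>\<in>L2_spinors. \<exists>\<phi> \<xi>. closure_graph T \<phi> \<xi> \<and> (\<forall>z\<in>S3. \<xi> z - \<mu> *s \<phi> z = \<psi> z)) \<and>
     (\<exists>C. \<forall>\<phi> \<xi>. closure_graph T \<phi> \<xi> \<longrightarrow> L2norm \<phi> \<le> C * L2norm (\<lambda>z. \<xi> z - \<mu> *s \<phi> z))}"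

definition spectrum :: "((C2 \<Rightarrow> spinor) \<Rightarrow> C2 \<Rightarrow> spinor) \<Rightarrow> complex set" where
  "spectrum T = - resolvent_set T"

end

(* In the frame the operator is D = c2 Y2 + c3 Y3 + c4 Y4 + 3/2 + i t c2, acting on functions with values in C^2.
   The Y_k generate isometric flows, so the integral of Y_k f vanishes for smooth f and D is symmetric on smooth spinors.
   For a linear form l = alpha z1 + beta z2 put l' = alpha cnj z2 - beta cnj z1. The Y_k map the functions
   l^a l'^b to combinations of l^a l'^b, l^(a-1) l'^(b+1) and l^(a+1) l'^(b-1). Hence D splits into explicit blocks
   of size one or two, and their eigenvalues are the numbers in the theorem. The span of all l^a l'^b is
   closed under multiplication by the coordinates, so by Stone-Weierstrass the
   eigenspinors are total in L2. By orthogonality (D - mu)^-1 is bounded, on the span of the eigenspinors, by the inverse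
   of the distance from mu to the eigenvalues, which is positive because they are discrete; symmetry carries
   the bound over to all smooth spinors. *)

theory Submission
  imports Defs
begin

section \<open>Differentiability classes\<close>

text \<open>The linear maps \<open>Y k\<close> act as the imaginary unit quaternions and commute
  with the action of SU(2) on C^2, which moves only the coefficients (\<alpha>, \<beta>). So for
  fixed (\<alpha>, \<beta>) other than 0 the products l^a l'^b with a + b = n carry one copy of the
  irreducible representation of dimension n + 1, and varying the coefficients reaches all copies.
  Hence the blocks do not depend on (\<alpha>, \<beta>), and neither bases of the multiplicity
  spaces nor norms of eigenspinors have to be computed. The obstacle is the domain of the closure:
  the eigenspinors are total in L2, but this says nothing about approximating f and D f
  simultaneously, so a bound on their span does not extend to smooth f by continuity. Instead f is
  paired with some w = (D - cnj \<mu>) u close to f, and symmetry moves the operator onto f. The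
  bound then passes to the closure, and together with completeness of L2 it also yields
  surjectivity.\<close>

lemma Ck_on_cong:
  assumes "open U" "\<And>x. x \<in> U \<Longrightarrow> f x = g x" "Ck_on n U f"
  shows "Ck_on n U g"
  using assms(2,3)
proof (induction n arbitrary: f g)
  case 0
  then show ?case by (simp cong: continuous_on_cong)
next
  case (Suc n)
  have d: "(g has_derivative frechet_derivative f (at x)) (at x)" if "x \<in> U" for x
    using Suc.prems that assms(1)
    by (intro has_derivative_transform_within_open[of f _ x UNIV U g])
       (auto simp: frechet_derivative_works)
  have e: "frechet_derivative f (at x) = frechet_derivative g (at x)" if "x \<in> U" for x
    using frechet_derivative_at[OF d[OF that]] .
  have "Ck_on n U (\<lambda>x. frechet_derivative g (at x) v)" for v
    by (rule Suc.IH[of "\<lambda>x. frechet_derivative f (at x) v"]) (use Suc.prems e in auto)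
  then show ?case
    using d by (auto simp: differentiable_def)
qed

text \<open>Lets any explicit derivative formula take the place of
  \<open>frechet_derivative\<close>; the inductions below run on such formulas.\<close>

lemma Ck_on_SucI:
  assumes "open U" "\<And>x. x \<in> U \<Longrightarrow> (f has_derivative f' x) (at x)"
    "\<And>v. Ck_on n U (\<lambda>x. f' x v)"
  shows "Ck_on (Suc n) U f"
proof -
  have "frechet_derivative f (at x) = f' x" if "x \<in> U" for x
    using frechet_derivative_at[OF assms(2)[OF that]] by simp
  then have "Ck_on n U (\<lambda>x. frechet_derivative f (at x) v)" for v
    by (intro Ck_on_cong[OF assms(1) _ assms(3)]) simp
  then show ?thesis
    using assms(2) by (auto simp: differentiable_def)
qed

lemma Ck_on_SucD:
  assumes "Ck_on (Suc n) U f"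
  shows "\<And>x. x \<in> U \<Longrightarrow> (f has_derivative frechet_derivative f (at x)) (at x)"
    "\<And>v. Ck_on n U (\<lambda>x. frechet_derivative f (at x) v)"
  using assms by (auto simp: frechet_derivative_works)

lemma Ck_on_lower: "Ck_on (Suc n) U f \<Longrightarrow> Ck_on n U f"
proof (induction n arbitrary: f)
  case 0
  then show ?case
    by (auto intro!: continuous_at_imp_continuous_on differentiable_imp_continuous_within)
next
  case (Suc n)
  then show ?case using Ck_on.simps(2) by blast
qed

lemma Ck_on_const: "Ck_on n U (\<lambda>x. c)"
  by (induction n arbitrary: c) auto

lemma Ck_on_bounded_linear:
  assumes "open U" "bounded_linear L" "Ck_on n U f"
  shows "Ck_on n U (\<lambda>x. L (f x))"
  using assms(3)
proof (induction n arbitrary: f)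
  case 0
  then show ?case using assms(2) by (auto intro: bounded_linear.continuous_on)
next
  case (Suc n)
  show ?case
    using Suc Ck_on_SucD[OF Suc.prems] assms(1,2)
    by (intro Ck_on_SucI[where f' = "\<lambda>x v. L (frechet_derivative f (at x) v)"])
       (auto intro: bounded_linear.has_derivative)
qed

lemma Ck_on_id: "Ck_on n U (\<lambda>x. x)"
proof (cases n)
  case (Suc m)
  then show ?thesis by (auto simp: Ck_on_const)
qed simp

lemma Ck_on_add:
  assumes "open U" "Ck_on n U f" "Ck_on n U g"
  shows "Ck_on n U (\<lambda>x. f x + g x)"
  using assms(2,3)
proof (induction n arbitrary: f g)
  case 0
  then show ?case by (auto intro: continuous_on_add)
next
  case (Suc n)
  show ?case
    using Suc.IH Ck_on_SucD[OF Suc.prems(1)] Ck_on_SucD[OF Suc.prems(2)] assms(1)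
    by (intro Ck_on_SucI[where f' = "\<lambda>x v. frechet_derivative f (at x) v + frechet_derivative g (at x) v"])
       (auto intro: has_derivative_add)
qed

text \<open>One product rule for real bilinear maps serves multiplication, scaling and the form
  \<open>herm\<close>. The factor that is left undifferentiated is handled by
  \<open>Ck_on_lower\<close>.\<close>

lemma Ck_on_bilinear:
  assumes "open U" "bounded_bilinear B" "Ck_on n U f" "Ck_on n U g"
  shows "Ck_on n U (\<lambda>x. B (f x) (g x))"
  using assms(3,4)
proof (induction n arbitrary: f g)
  case 0
  then show ?case using assms(2) by (auto intro: bounded_bilinear.continuous_on)
next
  case (Suc n)
  show ?case
    using Suc.IH Ck_on_SucD[OF Suc.prems(1)] Ck_on_SucD[OF Suc.prems(2)] assms(1,2)
      Ck_on_lower[OF Suc.prems(1)] Ck_on_lower[OF Suc.prems(2)]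
    by (intro Ck_on_SucI[where f' = "\<lambda>x v. B (f x) (frechet_derivative g (at x) v)
          + B (frechet_derivative f (at x) v) (g x)"])
       (auto intro!: bounded_bilinear.FDERIV[of B] Ck_on_add)
qed

lemma open_punctured: "open (- {0::'a::real_normed_vector})"
  by (simp add: open_Compl)

lemma has_derivative_inverse_norm:
  fixes x :: "'a::real_inner"
  assumes "x \<noteq> 0"
  shows "((\<lambda>x. inverse (norm x)) has_derivative (\<lambda>v. - (inverse (norm x) ^ 3 * (x \<bullet> v)))) (at x)"
proof -
  have "((\<lambda>x. inverse (norm x)) has_derivative
      (\<lambda>v. - (inverse (norm x) * (v \<bullet> sgn x) * inverse (norm x)))) (at x)"
    using assms by (intro Deriv.has_derivative_inverse has_derivative_norm has_derivative_ident) auto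
  moreover have "inverse (norm x) * (v \<bullet> sgn x) * inverse (norm x) = inverse (norm x) ^ 3 * (x \<bullet> v)" for v
    by (simp add: sgn_div_norm inner_commute power3_eq_cube)
  ultimately show ?thesis by simp
qed

text \<open>The derivative of 1/|x| is again a polynomial expression in 1/|x| and x, so the
  induction on the order closes on itself.\<close>

lemma Ck_on_inverse_norm: "Ck_on n (- {0}) (\<lambda>x::'a::real_inner. inverse (norm x))"
proof (induction n)
  case 0
  then show ?case by (auto intro!: continuous_intros)
next
  case (Suc n)
  have m: "Ck_on n (- {0}) (\<lambda>x. f x * g x)"
    if "Ck_on n (- {0}) f" "Ck_on n (- {0}) g" for f g :: "'a \<Rightarrow> real"
    by (rule Ck_on_bilinear[OF open_punctured bounded_bilinear_mult that])
  show ?case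
  proof (rule Ck_on_SucI[where f' = "\<lambda>x v. - ((inverse (norm x) * inverse (norm x) * inverse (norm x)) * (x \<bullet> v))"])
    show "((\<lambda>x. inverse (norm x)) has_derivative (\<lambda>v. - ((inverse (norm x) * inverse (norm x) * inverse (norm x)) * (x \<bullet> v)))) (at x)"
      if "x \<in> - {0}" for x :: 'a
      using has_derivative_inverse_norm[of x] that by (simp add: power3_eq_cube)
  next
    fix v :: 'a
    have "Ck_on n (- {0}) (\<lambda>x. x \<bullet> v)"
      by (rule Ck_on_bounded_linear[OF _ bounded_linear_inner_left Ck_on_id]) (rule open_punctured)
    then have "Ck_on n (- {0}) (\<lambda>x. (inverse (norm x) * inverse (norm x) * inverse (norm x)) * (x \<bullet> v))"
      using Suc m by simp
    then show "Ck_on n (- {0}) (\<lambda>x. - ((inverse (norm x) * inverse (norm x) * inverse (norm x)) * (x \<bullet> v)))"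
      by (rule Ck_on_bounded_linear[OF _ bounded_linear_minus[OF bounded_linear_ident], rotated]) (rule open_punctured)
  qed (rule open_punctured)
qed

lemma Ck_on_radial_id: "Ck_on n (- {0}) (\<lambda>x::'a::real_inner. x /\<^sub>R norm x)"
  by (rule Ck_on_bilinear[OF _ bounded_bilinear_scaleR Ck_on_inverse_norm Ck_on_id]) (rule open_punctured)

subsection \<open>Smooth functions on the sphere\<close>

lemma radial_S3: "z \<in> S3 \<Longrightarrow> radial f z = f z"
  by (simp add: radial_def)

lemma normalize_in_S3: "x \<noteq> 0 \<Longrightarrow> x /\<^sub>R norm x \<in> S3"
  by simp

lemma S3_nonzero: "z \<in> S3 \<Longrightarrow> z \<noteq> 0"
  by auto

lemma smooth_on_S3D: "smooth_on_S3 f \<Longrightarrow> Ck_on n (- {0}) (radial f)"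
  by (simp only: smooth_on_S3_def)

lemma smooth_on_S3I: "(\<And>n. Ck_on n (- {0}) (\<lambda>x. f (x /\<^sub>R norm x))) \<Longrightarrow> smooth_on_S3 f"
  by (simp add: smooth_on_S3_def radial_def[abs_def])

lemma smooth_on_S3_const: "smooth_on_S3 (\<lambda>z. c)"
  by (rule smooth_on_S3I) (rule Ck_on_const)

lemma smooth_on_S3_id: "smooth_on_S3 (\<lambda>z. z)"
  by (rule smooth_on_S3I) (rule Ck_on_radial_id)

lemma smooth_on_S3_add:
  assumes "smooth_on_S3 f" "smooth_on_S3 g"
  shows "smooth_on_S3 (\<lambda>z. f z + g z)"
  by (rule smooth_on_S3I)
    (rule Ck_on_add[OF open_punctured assms[THEN smooth_on_S3D, unfolded radial_def[abs_def]]])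

lemma smooth_on_S3_bounded_linear:
  assumes "bounded_linear L" "smooth_on_S3 f"
  shows "smooth_on_S3 (\<lambda>z. L (f z))"
  by (rule smooth_on_S3I)
    (rule Ck_on_bounded_linear[OF open_punctured assms(1) assms(2)[THEN smooth_on_S3D, unfolded radial_def[abs_def]]])

lemma smooth_on_S3_bilinear:
  assumes "bounded_bilinear B" "smooth_on_S3 f" "smooth_on_S3 g"
  shows "smooth_on_S3 (\<lambda>z. B (f z) (g z))"
  by (rule smooth_on_S3I)
    (rule Ck_on_bilinear[OF open_punctured assms(1) assms(2,3)[THEN smooth_on_S3D, unfolded radial_def[abs_def]]])

lemma smooth_on_S3_power:
  fixes f :: "C2 \<Rightarrow> 'b::real_normed_algebra_1"
  shows "smooth_on_S3 f \<Longrightarrow> smooth_on_S3 (\<lambda>z. f z ^ n)"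
  by (induction n) (auto simp: smooth_on_S3_const intro: smooth_on_S3_bilinear[OF bounded_bilinear_mult])

lemma smooth_radial_has_derivative:
  assumes "smooth_on_S3 f" "x \<noteq> 0"
  shows "(radial f has_derivative frechet_derivative (radial f) (at x)) (at x)"
  using Ck_on_SucD(1)[OF smooth_on_S3D[OF assms(1), of "Suc 0"], of x] assms(2) by simp

lemma smooth_continuous_radial: "smooth_on_S3 f \<Longrightarrow> continuous_on (- {0}) (radial f)"
  using smooth_on_S3D[of f 0] by simp

lemma smooth_continuous:
  assumes "smooth_on_S3 f" shows "continuous_on S3 f"
proof -
  have "continuous_on S3 (radial f)"
    using smooth_continuous_radial[OF assms] by (rule continuous_on_subset) auto
  then show ?thesis by (rule continuous_on_eq) (simp add: radial_def)
qed

text \<open>Smoothness gives continuity of the derivative in each constant direction only; expanding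
  the varying direction \<open>V z\<close> in the standard basis reduces to that.\<close>

lemma smooth_continuous_frechet:
  fixes f :: "C2 \<Rightarrow> 'b::real_normed_vector"
  assumes "smooth_on_S3 f" "continuous_on S3 V"
  shows "continuous_on S3 (\<lambda>z. dir_deriv f z (V z))"
proof -
  have c: "continuous_on S3 (\<lambda>z. frechet_derivative (radial f) (at z) v)" for v
  proof -
    have "continuous_on (- {0}) (\<lambda>z. frechet_derivative (radial f) (at z) v)"
      using Ck_on_SucD(2)[OF smooth_on_S3D[OF assms(1), of "Suc 0"], of v] by simp
    then show ?thesis by (rule continuous_on_subset) auto
  qed
  have e: "dir_deriv f z (V z) = (\<Sum>b\<in>Basis. (V z \<bullet> b) *\<^sub>R frechet_derivative (radial f) (at z) b)"
    if "z \<in> S3" for z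
  proof -
    interpret bounded_linear "frechet_derivative (radial f) (at z)"
      using smooth_radial_has_derivative[OF assms(1) S3_nonzero[OF that]] has_derivative_bounded_linear by blast
    have "dir_deriv f z (V z) = frechet_derivative (radial f) (at z) (\<Sum>b\<in>Basis. (V z \<bullet> b) *\<^sub>R b)"
      by (simp add: dir_deriv_def euclidean_representation)
    then show ?thesis by (simp add: sum scaleR)
  qed
  have "continuous_on S3 (\<lambda>z. \<Sum>b\<in>Basis. (V z \<bullet> b) *\<^sub>R frechet_derivative (radial f) (at z) b)"
    by (intro continuous_intros c assms(2))
  then show ?thesis by (rule continuous_on_eq) (simp add: e)
qed

section \<open>Differentiation rules on the sphere\<close>

lemma dir_deriv_add:
  assumes "smooth_on_S3 f" "smooth_on_S3 g" "z \<in> S3"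
  shows "dir_deriv (\<lambda>z. f z + g z) z X = dir_deriv f z X + dir_deriv g z X"
proof -
  have "(radial (\<lambda>z. f z + g z) has_derivative
     (\<lambda>X. frechet_derivative (radial f) (at z) X + frechet_derivative (radial g) (at z) X)) (at z)"
    using has_derivative_add[OF smooth_radial_has_derivative[OF assms(1)] smooth_radial_has_derivative[OF assms(2)]]
      S3_nonzero[OF assms(3)] by (simp add: radial_def[abs_def])
  from frechet_derivative_at[OF this, THEN fun_cong, of X] show ?thesis
    by (simp add: dir_deriv_def)
qed

lemma dir_deriv_bounded_linear:
  assumes "smooth_on_S3 f" "bounded_linear L" "z \<in> S3"
  shows "dir_deriv (\<lambda>z. L (f z)) z X = L (dir_deriv f z X)"
proof -
  have "(radial (\<lambda>z. L (f z)) has_derivative (\<lambda>X. L (frechet_derivative (radial f) (at z) X))) (at z)"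
    using bounded_linear.has_derivative[OF assms(2) smooth_radial_has_derivative[OF assms(1)]]
      S3_nonzero[OF assms(3)] by (simp add: radial_def[abs_def])
  from frechet_derivative_at[OF this, THEN fun_cong, of X] show ?thesis
    by (simp add: dir_deriv_def)
qed

lemma dir_deriv_bilinear:
  assumes "smooth_on_S3 f" "smooth_on_S3 g" "bounded_bilinear B" "z \<in> S3"
  shows "dir_deriv (\<lambda>z. B (f z) (g z)) z X = B (f z) (dir_deriv g z X) + B (dir_deriv f z X) (g z)"
proof -
  have "(radial (\<lambda>z. B (f z) (g z)) has_derivative
     (\<lambda>X. B (radial f z) (frechet_derivative (radial g) (at z) X) + B (frechet_derivative (radial f) (at z) X) (radial g z))) (at z)"
    using bounded_bilinear.FDERIV[OF assms(3) smooth_radial_has_derivative[OF assms(1)] smooth_radial_has_derivative[OF assms(2)]]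
      S3_nonzero[OF assms(4)] by (simp add: radial_def[abs_def])
  from frechet_derivative_at[OF this, THEN fun_cong, of X] show ?thesis
    using assms(4) by (simp add: dir_deriv_def radial_S3)
qed

text \<open>At a point of the sphere the derivative of x / |x| is the orthogonal projection onto the
  tangent space. For tangent X the radial extension may therefore be forgotten and f differentiated
  as it stands.\<close>

lemma dir_deriv_tangent:
  assumes "(f has_derivative f') (at z)" "z \<in> S3" "X \<bullet> z = 0"
  shows "dir_deriv f z X = f' X"
proof -
  have z: "z \<noteq> 0" "norm z = 1" using assms by auto
  have 1: "((\<lambda>x. x /\<^sub>R norm x) has_derivative (\<lambda>v. v - (z \<bullet> v) *\<^sub>R z)) (at z)"
    using has_derivative_scaleR[OF has_derivative_inverse_norm[OF z(1)] has_derivative_ident] z by simp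
  have "(f has_derivative f') (at (z /\<^sub>R norm z))" using assms(1) z by simp
  from diff_chain_at[OF 1 this]
  have "(radial f has_derivative (\<lambda>v. f' (v - (z \<bullet> v) *\<^sub>R z))) (at z)"
    by (simp add: o_def radial_def[abs_def])
  from frechet_derivative_at[OF this, THEN fun_cong, of X] show ?thesis
    using assms(3) by (simp add: dir_deriv_def inner_commute)
qed

section \<open>Rotation invariance and integration by parts\<close>

text \<open>Fubini: for each fixed y the map is a translation in x.\<close>

lemma lborel_shear_fst:
  fixes L :: "'b::euclidean_space \<Rightarrow> 'a::euclidean_space"
  assumes [measurable]: "L \<in> borel_measurable borel"
  shows "distr lborel borel (\<lambda>(x, y). (x + L y, y)) = (lborel :: ('a \<times> 'b) measure)"
proof (rule measure_eqI)
  fix A :: "('a \<times> 'b) set" assume "A \<in> sets (distr lborel borel (\<lambda>(x, y). (x + L y, y)))"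
  then have A[measurable]: "A \<in> sets borel" by simp
  have "(\<lambda>(x, y). (x + L y, y)) \<in> borel \<Otimes>\<^sub>M borel \<rightarrow>\<^sub>M (borel \<Otimes>\<^sub>M borel :: ('a \<times> 'b) measure)"
    by measurable
  then have [measurable]: "(\<lambda>(x, y). (x + L y, y)) \<in> borel_measurable (borel :: ('a \<times> 'b) measure)"
    by (simp add: borel_prod)
  have [measurable]: "A \<in> sets (borel \<Otimes>\<^sub>M borel)"
    by (subst borel_prod) (rule A)
  have "emeasure (distr lborel borel (\<lambda>(x, y). (x + L y, y))) A
      = (\<integral>\<^sup>+ p. indicator A p \<partial>(distr lborel borel (\<lambda>(x, y). (x + L y, y))))"
    by simp
  also have "\<dots> = (\<integral>\<^sup>+ p. indicator A ((\<lambda>(x, y). (x + L y, y)) p) \<partial>lborel)"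
    by (rule nn_integral_distr) auto
  also have "\<dots> = (\<integral>\<^sup>+ y. \<integral>\<^sup>+ x. indicator A (x + L y, y) \<partial>lborel \<partial>lborel)"
    by (subst lborel_prod[symmetric], subst lborel_pair.nn_integral_snd[symmetric])
      (auto simp: lborel_prod)
  also have "\<dots> = (\<integral>\<^sup>+ y. \<integral>\<^sup>+ x. indicator A (x, y) \<partial>lborel \<partial>lborel)"
  proof (rule nn_integral_cong)
    fix y :: 'b
    have "(\<integral>\<^sup>+ x. indicator A (x, y) \<partial>lborel) = (\<integral>\<^sup>+ x. indicator A (x, y) \<partial>(distr lborel borel ((+) (L y))))"
      by (simp add: lborel_distr_plus)
    also have "\<dots> = (\<integral>\<^sup>+ x. indicator A (x + L y, y) \<partial>lborel)"
      by (subst nn_integral_distr) (auto simp: add.commute)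
    finally show "(\<integral>\<^sup>+ x. indicator A (x + L y, y) \<partial>lborel) = (\<integral>\<^sup>+ x. indicator A (x, y) \<partial>lborel)" by (rule sym)
  qed
  also have "\<dots> = (\<integral>\<^sup>+ p. indicator A p \<partial>lborel)"
    by (subst lborel_prod[symmetric], subst lborel_pair.nn_integral_snd[symmetric]) auto
  finally show "emeasure (distr lborel borel (\<lambda>(x, y). (x + L y, y))) A = emeasure lborel A"
    by simp
qed simp

lemma lborel_shear_snd:
  fixes L :: "'a::euclidean_space \<Rightarrow> 'b::euclidean_space"
  assumes [measurable]: "L \<in> borel_measurable borel"
  shows "distr lborel borel (\<lambda>(x, y). (x, y + L x)) = (lborel :: ('a \<times> 'b) measure)"
proof (rule measure_eqI)
  fix A :: "('a \<times> 'b) set" assume "A \<in> sets (distr lborel borel (\<lambda>(x, y). (x, y + L x)))"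
  then have A[measurable]: "A \<in> sets borel" by simp
  have "(\<lambda>(x, y). (x, y + L x)) \<in> borel \<Otimes>\<^sub>M borel \<rightarrow>\<^sub>M (borel \<Otimes>\<^sub>M borel :: ('a \<times> 'b) measure)"
    by measurable
  then have [measurable]: "(\<lambda>(x, y). (x, y + L x)) \<in> borel_measurable (borel :: ('a \<times> 'b) measure)"
    by (simp add: borel_prod)
  have [measurable]: "A \<in> sets (borel \<Otimes>\<^sub>M borel)"
    by (subst borel_prod) (rule A)
  have "emeasure (distr lborel borel (\<lambda>(x, y). (x, y + L x))) A
      = (\<integral>\<^sup>+ p. indicator A p \<partial>(distr lborel borel (\<lambda>(x, y). (x, y + L x))))"
    by simp
  also have "\<dots> = (\<integral>\<^sup>+ p. indicator A ((\<lambda>(x, y). (x, y + L x)) p) \<partial>lborel)"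
    by (rule nn_integral_distr) auto
  also have "\<dots> = (\<integral>\<^sup>+ x. \<integral>\<^sup>+ y. indicator A (x, y + L x) \<partial>lborel \<partial>lborel)"
    by (subst lborel_prod[symmetric], subst lborel.nn_integral_fst[symmetric])
      (auto simp: lborel_prod)
  also have "\<dots> = (\<integral>\<^sup>+ x. \<integral>\<^sup>+ y. indicator A (x, y) \<partial>lborel \<partial>lborel)"
  proof (rule nn_integral_cong)
    fix x :: 'a
    have "(\<integral>\<^sup>+ y. indicator A (x, y) \<partial>lborel) = (\<integral>\<^sup>+ y. indicator A (x, y) \<partial>(distr lborel borel ((+) (L x))))"
      by (simp add: lborel_distr_plus)
    also have "\<dots> = (\<integral>\<^sup>+ y. indicator A (x, y + L x) \<partial>lborel)"
      by (subst nn_integral_distr) (auto simp: add.commute)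
    finally show "(\<integral>\<^sup>+ y. indicator A (x, y + L x) \<partial>lborel) = (\<integral>\<^sup>+ y. indicator A (x, y) \<partial>lborel)" by (rule sym)
  qed
  also have "\<dots> = (\<integral>\<^sup>+ p. indicator A p \<partial>lborel)"
    by (subst lborel_prod[symmetric], subst lborel.nn_integral_fst[symmetric]) auto
  finally show "emeasure (distr lborel borel (\<lambda>(x, y). (x, y + L x))) A = emeasure lborel A"
    by simp
qed simp

text \<open>A plane rotation is a product of three shears, as
  \<open>tan (s/2) = sin s / (1 + cos s)\<close>.\<close>

lemma lborel_rotation:
  fixes w :: complex and p q :: real
  assumes w: "norm w = 1" and pq: "p\<^sup>2 + q\<^sup>2 = 1" "p \<noteq> - 1"
  shows "distr lborel borel (\<lambda>(x, y). (p *\<^sub>R x + q *\<^sub>R (w * cnj y), p *\<^sub>R y - q *\<^sub>R (w * cnj x)))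
    = (lborel :: C2 measure)"
proof -
  define a where "a = q / (1 + p)"
  have a: "a * (1 + p) = q" using pq by (simp add: a_def add_eq_0_iff)
  have b: "1 - a * q = p"
  proof -
    have "(1 - a * q) * (1 + p) = 1 + p - q * (a * (1 + p))" by (simp add: algebra_simps)
    also have "\<dots> = p * (1 + p)" using pq(1) unfolding a by (simp add: algebra_simps power2_eq_square)
    finally have "(1 - a * q) * (1 + p) = p * (1 + p)" .
    then show ?thesis using pq(2) by (simp add: add_eq_0_iff)
  qed
  define S where "S = (\<lambda>(x, y). (x + a *\<^sub>R (w * cnj y), y) :: C2)"
  define S' where "S' = (\<lambda>(x, y). (x, y + (- q) *\<^sub>R (w * cnj x)) :: C2)"
  have cnj_m[measurable]: "cnj \<in> borel_measurable borel"
    by (intro borel_measurable_continuous_onI continuous_intros)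
  have S: "distr lborel borel S = lborel" unfolding S_def by (rule lborel_shear_fst) measurable
  have S': "distr lborel borel S' = lborel" unfolding S'_def by (rule lborel_shear_snd) measurable
  have [measurable]: "S \<in> borel_measurable borel" "S' \<in> borel_measurable borel"
    unfolding S_def S'_def by (intro borel_measurable_continuous_onI continuous_intros, simp add: case_prod_beta, intro continuous_intros)+
  have ww: "w * cnj w = 1" using w by (simp add: complex_norm_square[symmetric])
  have e: "(S \<circ> (S' \<circ> S)) z = (\<lambda>(x, y). (p *\<^sub>R x + q *\<^sub>R (w * cnj y), p *\<^sub>R y - q *\<^sub>R (w * cnj x))) z" for z
  proof (cases z)
    case (Pair x y)
    have ww': "w * (cnj w * u) = u" for u using ww by (simp add: mult.assoc[symmetric])
    have 1: "y + (- q) *\<^sub>R (w * cnj (x + a *\<^sub>R (w * cnj y))) = (1 - a * q) *\<^sub>R y - q *\<^sub>R (w * cnj x)"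
      by (simp add: algebra_simps ww' scaleR_conv_of_real)
    have 2: "x + a *\<^sub>R (w * cnj y) + a *\<^sub>R (w * cnj (p *\<^sub>R y - q *\<^sub>R (w * cnj x)))
       = (1 - a * q) *\<^sub>R x + (a * (1 + p)) *\<^sub>R (w * cnj y)"
      by (simp add: algebra_simps ww' scaleR_conv_of_real)
    show ?thesis using 1 2 a b by (simp add: Pair S_def S'_def)
  qed
  have "distr lborel borel (S \<circ> (S' \<circ> S)) = distr (distr (distr lborel borel S) borel S') borel S"
    by (simp add: distr_distr comp_def)
  also have "\<dots> = lborel" by (simp add: S S')
  finally show ?thesis using e by (simp add: fun_eq_iff cong: distr_cong)
qed

subsection \<open>The flows of the frame\<close>

lemma reeb_eq: "reeb z = (\<i> * fst z, \<i> * snd z)"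
  by (cases z) (simp add: reeb_def complex_eq_iff)

lemma Y3_eq: "Y3 z = (- (\<i> * cnj (snd z)), \<i> * cnj (fst z))"
  by (cases z) (simp add: Y3_def complex_eq_iff)

lemma Y4_eq: "Y4 z = (cnj (snd z), - cnj (fst z))"
  by (cases z) (simp add: Y4_def complex_eq_iff)

lemmas Y_eq = Y_def reeb_eq Y3_eq Y4_eq

lemma linear_Y: "linear (Y k)"
  by (rule linearI) (auto simp: Y_eq algebra_simps scaleR_conv_of_real)

lemmas bounded_linear_Y = linear_Y[unfolded linear_conv_bounded_linear]

lemma Y_Y: "Y k (Y k z) = - z"
  by (cases z) (simp add: Y_eq algebra_simps flip: mult.assoc)

text \<open>Since \<open>Y k\<close> squares to -1, this is the one-parameter group exp (s
  Y_k).\<close>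

definition flow :: "nat \<Rightarrow> real \<Rightarrow> C2 \<Rightarrow> C2" where
  "flow k s z = cos s *\<^sub>R z + sin s *\<^sub>R Y k z"

lemma flow_0: "flow k 0 z = z"
  by (simp add: flow_def)

lemma continuous_flow: "continuous_on A (flow k s)"
  unfolding flow_def
  by (intro continuous_intros bounded_linear.continuous_on[OF bounded_linear_Y])

lemma flow_has_vector_derivative:
  "((\<lambda>s. flow k s z) has_vector_derivative Y k (flow k s z)) (at s within A)"
proof -
  have "((\<lambda>s. flow k s z) has_vector_derivative (- sin s *\<^sub>R z + cos s *\<^sub>R Y k z)) (at s within A)"
    unfolding flow_def
    by (auto intro!: derivative_eq_intros simp: has_vector_derivative_def algebra_simps)
  also have "- sin s *\<^sub>R z + cos s *\<^sub>R Y k z = Y k (flow k s z)"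
    by (simp add: flow_def linear_add[OF linear_Y] linear_scale[OF linear_Y] Y_Y)
  finally show ?thesis .
qed

lemma norm_Y: "norm (Y k z) = norm z"
  by (cases z) (simp add: Y_eq norm_Pair norm_mult add.commute)

lemma Y_inner_self: "Y k z \<bullet> z = 0"
  by (cases z) (simp add: Y_eq inner_complex_def algebra_simps)

lemma norm_flow: "norm (flow k s z) = norm z"
proof -
  have "(norm (flow k s z))\<^sup>2 = (cos s)\<^sup>2 * (norm z)\<^sup>2 + (sin s)\<^sup>2 * (norm (Y k z))\<^sup>2"
    using Y_inner_self[of k z] unfolding power2_norm_eq_inner flow_def
    by (simp add: inner_add_left inner_add_right inner_commute power2_eq_square)
  also have "\<dots> = (norm z)\<^sup>2"
    using sin_cos_squared_add[of s] by (simp add: norm_Y distrib_right[symmetric])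
  finally show ?thesis by simp
qed

lemma flow_scaleR: "flow k s (r *\<^sub>R z) = r *\<^sub>R flow k s z"
  by (simp add: flow_def linear_scale[OF linear_Y] algebra_simps)

text \<open>The flows of \<open>Y3\<close> and \<open>Y4\<close> have exactly the form treated in
  \<open>lborel_rotation\<close>; the angle \<pi> is excluded because the shear parameter tan (s/2)
  is infinite there.\<close>

lemma lborel_flow:
  assumes "cos s \<noteq> - 1"
  shows "distr lborel borel (flow k s) = lborel"
proof -
  let ?R = "\<lambda>w p q. (\<lambda>(x, y). (p *\<^sub>R x + q *\<^sub>R (w * cnj y), p *\<^sub>R y - q *\<^sub>R (w * cnj x))) :: C2 \<Rightarrow> C2"
  consider "k = 2" | "k = 3" | "k \<noteq> 2" "k \<noteq> 3" by blast
  then show ?thesis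
  proof cases
    case 1
    \<comment> \<open>The Hopf flow multiplies both coordinates by exp (i s). It is a product of two
      quarter turns of the above form, which multiplies by - i cnj w; this w makes that factor equal
      to exp (i s).\<close>
    define w where "w = - (\<i> * cos s + sin s)"
    have w: "norm w = 1"
      by (simp add: w_def cmod_def)
    have m[measurable]: "?R w p q \<in> borel_measurable borel" for w p q
      by (intro borel_measurable_continuous_onI, simp add: case_prod_beta, intro continuous_intros)
    have e: "?R \<i> 0 1 (?R w 0 1 z) = flow k s z" for z
      using 1 by (cases z) (simp add: flow_def Y_eq w_def algebra_simps scaleR_conv_of_real)
    have "distr lborel borel (flow k s) = distr lborel borel (?R \<i> 0 1 \<circ> ?R w 0 1)"
      by (rule arg_cong[where f = "distr lborel borel"]) (intro ext, simp only: o_apply e)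
    also have "\<dots> = distr (distr lborel borel (?R w 0 1)) borel (?R \<i> 0 1)"
      using m[of 0 1 \<i>] m[of 0 1 w] by (intro distr_distr[symmetric]) auto
    also have "\<dots> = lborel"
      using lborel_rotation[OF w, of 0 1] lborel_rotation[of \<i> 0 1] by simp
    finally show ?thesis .
  next
    case 2
    have "flow k s = ?R (- \<i>) (cos s) (sin s)"
      using 2 by (auto simp: fun_eq_iff flow_def Y_eq)
    then show ?thesis using lborel_rotation[of "- \<i>" "cos s" "sin s"] assms by simp
  next
    case 3
    have "flow k s = ?R 1 (cos s) (sin s)"
      using 3 by (auto simp: fun_eq_iff flow_def Y_eq)
    then show ?thesis using lborel_rotation[of 1 "cos s" "sin s"] assms by simp
  qed
qed

subsection \<open>The measure of the sphere\<close>

lemma space_S3_measure [simp]: "space S3_measure = S3"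
  by (simp add: S3_measure_def space_scale_measure)

lemma sets_S3_measure [simp, measurable_cong]: "sets S3_measure = sets (restrict_space borel S3)"
  by (simp add: S3_measure_def)

lemma emeasure_S3_measure:
  assumes "A \<in> sets S3_measure"
  shows "emeasure S3_measure A = 4 * emeasure lborel {x \<in> ball 0 1 - {0}. x /\<^sub>R norm x \<in> A}"
proof -
  have m: "(\<lambda>x::C2. x /\<^sub>R norm x) \<in> measurable (restrict_space lborel (ball 0 1 - {0})) (restrict_space borel S3)"
  proof (rule measurable_restrict_space2)
    have "(\<lambda>x::C2. x /\<^sub>R norm x) \<in> borel_measurable borel" by measurable
    then show "(\<lambda>x::C2. x /\<^sub>R norm x) \<in> borel_measurable (restrict_space lborel (ball 0 1 - {0}))"
      by (intro measurable_restrict_space1) simp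
  qed (auto simp: space_restrict_space)
  have B: "ball 0 1 - {0::C2} \<in> sets lborel" by simp
  have "emeasure S3_measure A
     = 4 * emeasure (restrict_space lborel (ball 0 1 - {0})) ((\<lambda>x::C2. x /\<^sub>R norm x) -` A \<inter> space (restrict_space lborel (ball 0 1 - {0})))"
    using assms m by (simp add: S3_measure_def emeasure_distr)
  also have "(\<lambda>x::C2. x /\<^sub>R norm x) -` A \<inter> space (restrict_space lborel (ball 0 1 - {0}))
      = {x \<in> ball 0 1 - {0}. x /\<^sub>R norm x \<in> A}"
    by (auto simp: space_restrict_space)
  also have "emeasure (restrict_space lborel (ball 0 1 - {0})) {x \<in> ball 0 1 - {0}. x /\<^sub>R norm x \<in> A}
      = emeasure lborel {x \<in> ball 0 1 - {0}. x /\<^sub>R norm x \<in> A}"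
    using B by (intro emeasure_restrict_space) auto
  finally show ?thesis .
qed

lemma S3_measure_finite: "finite_measure S3_measure"
proof
  have "emeasure S3_measure S3 \<le> 4 * emeasure lborel (ball (0::C2) 1)"
    by (subst emeasure_S3_measure)
      (auto intro!: mult_left_mono emeasure_mono simp: sets_restrict_space)
  also have "\<dots> < \<infinity>"
    using emeasure_lborel_ball_finite[of "0::C2" 1] by (simp add: ennreal_mult_less_top)
  finally show "emeasure S3_measure (space S3_measure) \<noteq> \<infinity>" by simp
qed

interpretation S3: finite_measure S3_measure by (rule S3_measure_finite)

lemma flow_measurable: "flow k s \<in> measurable S3_measure S3_measure"
proof -
  have "flow k s \<in> measurable (restrict_space borel S3) (restrict_space borel S3)"
    by (rule measurable_restrict_space2)
      (auto simp: space_restrict_space norm_flow continuous_flow intro: borel_measurable_continuous_on_restrict)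
  then show ?thesis using measurable_cong_sets[OF sets_S3_measure sets_S3_measure] by blast
qed

text \<open>The flow is linear and isometric, so it commutes with normalization and the cone over a
  preimage is the preimage of the cone. Invariance thus descends from Lebesgue measure.\<close>

lemma S3_measure_flow:
  assumes "cos s \<noteq> - 1"
  shows "distr S3_measure S3_measure (flow k s) = S3_measure"
proof (rule measure_eqI)
  fix A assume "A \<in> sets (distr S3_measure S3_measure (flow k s))"
  then have A: "A \<in> sets S3_measure" by simp
  let ?C = "\<lambda>A. {x::C2 \<in> ball 0 1 - {0}. x /\<^sub>R norm x \<in> A}"
  have fm: "flow k s \<in> borel_measurable borel"
    by (intro borel_measurable_continuous_onI continuous_flow)
  have fA: "flow k s -` A \<inter> S3 \<in> sets S3_measure"
    using measurable_sets[OF flow_measurable A] by simp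
  obtain A' where A': "A' \<in> sets borel" "A = A' \<inter> S3"
    using A by (auto simp: sets_restrict_space)
  have "?C A = {x \<in> ball 0 1 - {0}. x /\<^sub>R norm x \<in> A'}"
    using A' by auto
  also have "\<dots> = (\<lambda>x. x /\<^sub>R norm x) -` A' \<inter> (ball 0 1 - {0})" by auto
  also have "\<dots> \<in> sets borel"
    using A'(1) measurable_sets[of "\<lambda>x::C2. x /\<^sub>R norm x" borel borel A'] by auto
  finally have CA: "?C A \<in> sets borel" .
  have "emeasure (distr S3_measure S3_measure (flow k s)) A = emeasure S3_measure (flow k s -` A \<inter> S3)"
    using emeasure_distr[OF flow_measurable A] by simp
  also have "\<dots> = 4 * emeasure lborel (?C (flow k s -` A \<inter> S3))"
    by (rule emeasure_S3_measure[OF fA])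
  also have "?C (flow k s -` A \<inter> S3) = flow k s -` (?C A)"
  proof (intro set_eqI iffI)
    fix x
    have *: "flow k s (x /\<^sub>R norm x) = flow k s x /\<^sub>R norm (flow k s x)"
      by (simp add: flow_scaleR norm_flow)
    have **: "flow k s x = 0 \<longleftrightarrow> x = 0"
      using norm_flow[of k s x] by (metis norm_eq_zero)
    show "x \<in> flow k s -` ?C A" if "x \<in> ?C (flow k s -` A \<inter> S3)"
      using that * ** norm_flow[of k s x] by auto
    show "x \<in> ?C (flow k s -` A \<inter> S3)" if "x \<in> flow k s -` ?C A"
      using that * ** norm_flow[of k s x] by auto
  qed
  also have "emeasure lborel (flow k s -` ?C A) = emeasure (distr lborel borel (flow k s)) (?C A)"
    using CA fm by (subst emeasure_distr) auto
  also have "\<dots> = emeasure lborel (?C A)" by (simp add: lborel_flow[OF assms])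
  also have "4 * \<dots> = emeasure S3_measure A" by (rule emeasure_S3_measure[OF A, symmetric])
  finally show "emeasure (distr S3_measure S3_measure (flow k s)) A = emeasure S3_measure A" .
qed simp

lemma borel_measurable_S3: "continuous_on S3 f \<Longrightarrow> f \<in> borel_measurable S3_measure"
  using borel_measurable_continuous_on_restrict[of S3 f]
    measurable_cong_sets[OF sets_S3_measure refl] by blast

lemma bounded_S3:
  fixes f :: "C2 \<Rightarrow> 'b::real_normed_vector"
  assumes "continuous_on S3 f"
  obtains B where "B \<ge> 0" "\<And>z. z \<in> S3 \<Longrightarrow> norm (f z) \<le> B"
proof -
  have "bounded (f ` S3)"
    by (intro compact_imp_bounded compact_continuous_image assms compact_sphere)
  then obtain B where "B > 0" "\<forall>x\<in>f ` S3. norm x \<le> B"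
    using bounded_pos by blast
  then show thesis using that[of B] by auto
qed

lemma integrable_S3:
  fixes f :: "C2 \<Rightarrow> 'b::{banach, second_countable_topology}"
  assumes "continuous_on S3 f"
  shows "integrable S3_measure f"
proof -
  obtain B where "\<And>z. z \<in> S3 \<Longrightarrow> norm (f z) \<le> B"
    using bounded_S3[OF assms] by metis
  then show ?thesis
    using borel_measurable_S3[OF assms] by (intro S3.integrable_const_bound[where B = B]) auto
qed

section \<open>Derivatives along the frame have integral zero\<close>

lemma flow_deriv:
  fixes f :: "C2 \<Rightarrow> 'b::real_normed_vector"
  assumes "smooth_on_S3 f" "z \<in> S3"
  shows "((\<lambda>s. f (flow k s z)) has_vector_derivative dir_deriv f (flow k s z) (Y k (flow k s z))) (at s)"
proof -
  have S: "flow k u z \<in> S3" for u using assms(2) by (simp add: norm_flow)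
  let ?f' = "frechet_derivative (radial f) (at (flow k s z))"
  have f': "(radial f has_derivative ?f') (at (flow k s z))"
    by (rule smooth_radial_has_derivative[OF assms(1) S3_nonzero[OF S]])
  have "((radial f \<circ> (\<lambda>s. flow k s z)) has_derivative (?f' \<circ> (\<lambda>h. h *\<^sub>R Y k (flow k s z)))) (at s)"
    by (rule diff_chain_at[OF flow_has_vector_derivative[unfolded has_vector_derivative_def] f'])
  then have "((radial f \<circ> (\<lambda>s. flow k s z)) has_vector_derivative ?f' (Y k (flow k s z))) (at s)"
    unfolding has_vector_derivative_def o_def linear_scale[OF has_derivative_linear[OF f']] .
  moreover have "radial f \<circ> (\<lambda>s. flow k s z) = (\<lambda>s. f (flow k s z))"
    using S by (auto simp: radial_S3 fun_eq_iff)
  ultimately show ?thesis by (simp add: dir_deriv_def)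
qed

text \<open>The integral of f along the flow is constant in time, so all difference quotients
  integrate to zero; they converge to the derivative boundedly.\<close>

lemma integral_dir_deriv_Y:
  fixes f :: "C2 \<Rightarrow> complex"
  assumes f: "smooth_on_S3 f"
  shows "integral\<^sup>L S3_measure (\<lambda>z. dir_deriv f z (Y k z)) = 0"
proof -
  let ?D = "\<lambda>z. dir_deriv f z (Y k z)"
  have cD: "continuous_on S3 ?D"
    by (rule smooth_continuous_frechet[OF f bounded_linear.continuous_on[OF bounded_linear_Y continuous_on_id]])
  have cf: "continuous_on S3 f" by (rule smooth_continuous[OF f])
  obtain B where B: "B \<ge> 0" "\<And>z. z \<in> S3 \<Longrightarrow> norm (?D z) \<le> B"
    using bounded_S3[OF cD] by metis
  \<comment> \<open>Times in (0, 1] tend to 0 and stay away from the excluded angle \<pi>.\<close>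
  define s where "s n = 1 / (real n + 1)" for n
  have s: "0 < s n" "s n \<le> 1" for n by (auto simp: s_def)
  have "s \<longlonglongrightarrow> 0"
    using LIMSEQ_inverse_real_of_nat by (simp add: s_def[abs_def] inverse_eq_divide add.commute)
  then have sl: "filterlim s (at 0) sequentially"
    using s by (auto simp: filterlim_at intro!: always_eventually less_imp_neq[symmetric])
  define G where "G n z = (f (flow k (s n) z) - f z) /\<^sub>R s n" for n z
  have cG: "continuous_on S3 (G n)" for n
    unfolding G_def
    by (intro continuous_intros cf continuous_on_compose2[OF cf continuous_flow]) (auto simp: norm_flow)
  have "(\<lambda>n. integral\<^sup>L S3_measure (G n)) \<longlonglongrightarrow> integral\<^sup>L S3_measure ?D"
  proof (rule integral_dominated_convergence[where w = "\<lambda>_. B"])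
    show "AE z in S3_measure. (\<lambda>n. G n z) \<longlonglongrightarrow> ?D z"
    proof (rule AE_I2)
      fix z assume z: "z \<in> space S3_measure"
      have q: "((\<lambda>h. norm (f (flow k h z) - f z - h *\<^sub>R ?D z) / \<bar>h\<bar>) \<longlongrightarrow> 0) (at 0)"
        using flow_deriv[OF f, of z k 0] z
        by (simp add: flow_0 has_vector_derivative_def has_derivative_at)
      have "norm (f (flow k h z) - f z - h *\<^sub>R ?D z) / \<bar>h\<bar> = norm ((f (flow k h z) - f z) /\<^sub>R h - ?D z)"
        if "h \<noteq> 0" for h
      proof -
        have "(f (flow k h z) - f z) /\<^sub>R h - ?D z = (f (flow k h z) - f z - h *\<^sub>R ?D z) /\<^sub>R h"
          using that by (simp add: scaleR_diff_right)
        then show ?thesis by (simp add: divide_inverse mult.commute)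
      qed
      then have "((\<lambda>h. norm ((f (flow k h z) - f z) /\<^sub>R h - ?D z)) \<longlongrightarrow> 0) (at 0)"
        by (intro Lim_transform_eventually[OF q]) (auto simp: eventually_at_filter)
      then have "((\<lambda>h. (f (flow k h z) - f z) /\<^sub>R h) \<longlongrightarrow> ?D z) (at 0)"
        by (simp only: tendsto_norm_zero_iff LIM_zero_iff)
      then show "(\<lambda>n. G n z) \<longlonglongrightarrow> ?D z"
        unfolding G_def by (rule filterlim_compose[OF _ sl])
    qed
    show "AE z in S3_measure. norm (G n z) \<le> B" for n
    proof (rule AE_I2)
      fix z assume z: "z \<in> space S3_measure"
      \<comment> \<open>The mean value theorem along the orbit bounds each quotient by the supremum
        B of the derivative, which is a constant dominating function.\<close>
      have "\<exists>x\<in>{0<..<s n}. norm (f (flow k (s n) z) - f (flow k 0 z))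
          \<le> norm ((s n - 0) *\<^sub>R dir_deriv f (flow k x z) (Y k (flow k x z)))"
      proof (rule mvt_general)
        have d: "((\<lambda>s. f (flow k s z)) has_derivative
          (\<lambda>h. h *\<^sub>R dir_deriv f (flow k x z) (Y k (flow k x z)))) (at x)" for x
          using flow_deriv[OF f, of z k x] z by (simp add: has_vector_derivative_def)
        then show "((\<lambda>s. f (flow k s z)) has_derivative
          (\<lambda>h. h *\<^sub>R dir_deriv f (flow k x z) (Y k (flow k x z)))) (at x)" for x .
        show "continuous_on {0..s n} (\<lambda>s. f (flow k s z))"
          using d has_derivative_continuous continuous_at_imp_continuous_on by blast
      qed (use s in auto)
      then obtain x where "norm (f (flow k (s n) z) - f z)
          \<le> s n * norm (dir_deriv f (flow k x z) (Y k (flow k x z)))"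
        using s[of n] by (auto simp: flow_0)
      also have "\<dots> \<le> s n * B"
        using s[of n] z by (intro mult_left_mono B(2)) (auto simp: norm_flow)
      finally show "norm (G n z) \<le> B"
        using s[of n] by (simp add: G_def inverse_eq_divide pos_divide_le_eq mult.commute)
    qed
  qed (auto intro: borel_measurable_S3 cD cG)
  moreover have "integral\<^sup>L S3_measure (G n) = 0" for n
  proof -
    have "cos (s n) \<noteq> - 1"
      using cos_gt_zero[of "s n"] s[of n] pi_gt3 by linarith
    note inv = S3_measure_flow[OF this, of k]
    have "integral\<^sup>L S3_measure (\<lambda>z. f (flow k (s n) z)) = integral\<^sup>L (distr S3_measure S3_measure (flow k (s n))) f"
      by (rule integral_distr[symmetric, OF flow_measurable borel_measurable_S3[OF cf]])
    then have e: "integral\<^sup>L S3_measure (\<lambda>z. f (flow k (s n) z)) = integral\<^sup>L S3_measure f"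
      by (simp add: inv)
    have "continuous_on S3 (\<lambda>z. f (flow k (s n) z))"
      by (rule continuous_on_compose2[OF cf continuous_flow]) (auto simp: norm_flow)
    then show ?thesis
      unfolding G_def using e integrable_S3[OF cf] by (simp add: integrable_S3)
  qed
  ultimately show ?thesis
    using LIMSEQ_unique[OF _ tendsto_const] by auto
qed

section \<open>The Dirac operator in the frame\<close>

lemma matrix_vector_scaleR: "A *v (r *\<^sub>R x) = r *\<^sub>R (A *v x :: spinor)"
  by (simp add: vec_eq_iff matrix_vector_mult_def scaleR_sum_right)

lemma bounded_linear_matrix: "bounded_linear (\<lambda>x::spinor. A *v x :: spinor)"
  by (simp add: linear_conv_bounded_linear[symmetric] linearI matrix_vector_right_distrib matrix_vector_scaleR)

lemma bounded_bilinear_smult: "bounded_bilinear (\<lambda>a (x::spinor). a *s x)"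
  by (auto simp: bilinear_conv_bounded_bilinear[symmetric] bilinear_def vec_eq_iff algebra_simps intro!: linearI)

lemma bounded_bilinear_herm: "bounded_bilinear herm"
  by (auto simp: bilinear_conv_bounded_bilinear[symmetric] bilinear_def herm_def algebra_simps
      sum.distrib scaleR_sum_right intro!: linearI)

lemmas bounded_linear_smult_left = bounded_bilinear.bounded_linear_left[OF bounded_bilinear_smult]
lemmas bounded_linear_smult_right = bounded_bilinear.bounded_linear_right[OF bounded_bilinear_smult]

lemmas matrix_diff = linear_diff[OF bounded_linear.linear[OF bounded_linear_matrix]]
  and smult_add = linear_add[OF bounded_linear.linear[OF bounded_linear_smult_right]]
  and smult_diff = linear_diff[OF bounded_linear.linear[OF bounded_linear_smult_right]]
  and smult_add_left = linear_add[OF bounded_linear.linear[OF bounded_linear_smult_left]]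

lemma herm_smult_left: "herm (a *s x) y = a * herm x y"
  by (simp add: herm_def sum_distrib_left mult.assoc)

lemma herm_smult_right: "herm x (a *s y) = cnj a * herm x y"
  by (simp add: herm_def sum_distrib_left mult.assoc mult.left_commute)

lemma herm_self: "herm x x = of_real ((norm x)\<^sup>2)"
  by (simp add: herm_def norm_vec_def L2_set_def real_sqrt_pow2 sum_nonneg complex_norm_square[symmetric] of_real_sum[symmetric] del: of_real_sum of_real_power)

lemmas herm_add_left = bounded_bilinear.add_left[OF bounded_bilinear_herm]
  and herm_add_right = bounded_bilinear.add_right[OF bounded_bilinear_herm]
  and herm_diff_left = bounded_bilinear.diff_left[OF bounded_bilinear_herm]
  and herm_diff_right = bounded_bilinear.diff_right[OF bounded_bilinear_herm]
  and herm_sum_left = bounded_bilinear.sum_left[OF bounded_bilinear_herm]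
  and herm_sum_right = bounded_bilinear.sum_right[OF bounded_bilinear_herm]
  and herm_scaleR_left = bounded_bilinear.scaleR_left[OF bounded_bilinear_herm]
  and herm_scaleR_right = bounded_bilinear.scaleR_right[OF bounded_bilinear_herm]

lemma norm_smult: "norm (a *s (x::spinor)) = norm a * norm x"
proof -
  have "of_real ((norm (a *s x))\<^sup>2) = (of_real ((norm a * norm x)\<^sup>2) :: complex)"
    unfolding herm_self[symmetric] herm_smult_left herm_smult_right
    by (simp add: herm_self power_mult_distrib complex_norm_square[of a, unfolded of_real_power] mult_ac)
  then have "(norm (a *s x))\<^sup>2 = (norm a * norm x)\<^sup>2"
    by (simp only: of_real_eq_iff)
  then show ?thesis by (simp add: power2_eq_iff_nonneg)
qed

lemma matrix_smult: "A *v (a *s x) = a *s (A *v x :: spinor)"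
  by (simp add: vec_eq_iff matrix_vector_mult_def sum_distrib_left mult.left_commute)

lemma scaleR_eq_smult: "r *\<^sub>R (x::spinor) = complex_of_real r *s x"
proof (intro vec_eq_iff[THEN iffD2] allI)
  show "(r *\<^sub>R x) $ i = (complex_of_real r *s x) $ i" for i
    by (simp only: vector_scaleR_component vector_smult_component) (simp only: scaleR_conv_of_real)
qed

lemma mat_mult_vector: "mat a *v x = a *s (x::spinor)"
  by (simp add: vec_eq_iff matrix_vector_mult_def mat_def if_distrib[of "\<lambda>u. u * _"] cong: if_cong)

lemma clifford_Y: "z \<in> S3 \<Longrightarrow> k \<in> frame_idx \<Longrightarrow> clifford c z (Y k z) \<phi> = c k *v \<phi>"
  using Y_orthonormal_tangent(2)[of z]
  by (auto simp: clifford_def)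

text \<open>The quaternion relations; together with \<open>Y_Y\<close> they determine all connection
  coefficients of the frame.\<close>

lemma Y_mult:
  "Y 2 (Y 3 z) = Y 4 z" "Y 3 (Y 2 z) = - Y 4 z"
  "Y 3 (Y 4 z) = Y 2 z" "Y 4 (Y 3 z) = - Y 2 z"
  "Y 4 (Y 2 z) = Y 3 z" "Y 2 (Y 4 z) = - Y 3 z"
  by (simp_all add: Y_eq algebra_simps flip: mult.assoc)

text \<open>\<open>Y j\<close> is a linear map, hence its own flat derivative, and the normal
  correction is orthogonal to the tangent vector \<open>Y l z\<close>.\<close>

lemma levi_civita_Y:
  assumes "z \<in> S3" "l \<in> frame_idx"
  shows "levi_civita z (Y k z) (Y j) \<bullet> Y l z = Y j (Y k z) \<bullet> Y l z"
proof -
  have "dir_deriv (Y j) z (Y k z) = Y j (Y k z)"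
    using assms by (intro dir_deriv_tangent bounded_linear_imp_has_derivative[OF bounded_linear_Y] Y_inner_self)
  then show ?thesis
    using Y_inner_self[of l z] by (simp add: levi_civita_def inner_diff_left inner_commute[of z])
qed

locale spinor_mod =
  fixes c :: "nat \<Rightarrow> complex ^ 2 ^ 2" and t :: real
  assumes spinor_module: "spinor_module c"
begin

abbreviation T :: "(C2 \<Rightarrow> spinor) \<Rightarrow> C2 \<Rightarrow> spinor" where
  "T \<equiv> magnetic_dirac c t"

lemma c_anticommute:
  assumes "j \<in> frame_idx" "k \<in> frame_idx"
  shows "c j *v (c k *v v) + c k *v (c j *v v) = (if j = k then - 2 else 0) *s v"
proof -
  have "(c j ** c k + c k ** c j) *v v = (if j = k then - 2 else 0) *s v"
    using assms spinor_module unfolding spinor_module_def by (simp only: mat_mult_vector)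
  then show ?thesis
    by (simp add: matrix_vector_mult_add_rdistrib matrix_vector_mul_assoc)
qed

lemma c_square:
  assumes "k \<in> frame_idx"
  shows "c k *v (c k *v v) = - v"
proof -
  have "2 *s (c k *v (c k *v v)) = 2 *s (- v)"
    using c_anticommute[OF assms assms, of v] by (simp add: vec_eq_iff)
  then show ?thesis by (simp add: vec_eq_iff)
qed

lemma c_swap: "j \<in> frame_idx \<Longrightarrow> k \<in> frame_idx \<Longrightarrow> j \<noteq> k \<Longrightarrow> c j *v (c k *v v) = - (c k *v (c j *v v))"
  using c_anticommute[of j k v] by (simp add: eq_neg_iff_add_eq_0)

lemma c_minus: "c k *v (- v) = - (c k *v v)"
  using matrix_smult[of "c k" "-1" v] by simp

text \<open>The volume element convention c2 c3 c4 = -1, multiplied by c2, gives c3 c4 = c2.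
  Anticommutation then yields the other products, so the \<open>c k\<close> multiply like quaternion
  units.\<close>

lemma c_mult:
  "c 3 *v (c 4 *v v) = c 2 *v v" "c 4 *v (c 3 *v v) = - (c 2 *v v)"
  "c 2 *v (c 3 *v v) = c 4 *v v" "c 3 *v (c 2 *v v) = - (c 4 *v v)"
  "c 4 *v (c 2 *v v) = c 3 *v v" "c 2 *v (c 4 *v v) = - (c 3 *v v)"
proof -
  have 34: "c 3 *v (c 4 *v v) = c 2 *v v" for v
  proof -
    have "- (c 2 ** c 3 ** c 4) = mat 1"
      using spinor_module unfolding spinor_module_def by blast
    then have "c 2 ** c 3 ** c 4 = - mat 1" by (simp add: minus_equation_iff)
    also have "\<dots> = mat (- 1)" by (simp add: vec_eq_iff mat_def)
    finally have "(c 2 ** c 3 ** c 4) *v v = (- 1) *s v" by (simp only: mat_mult_vector)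
    then have "c 2 *v (c 3 *v (c 4 *v v)) = - v"
      by (simp add: matrix_vector_mul_assoc matrix_mul_assoc)
    then have "c 2 *v (c 2 *v (c 3 *v (c 4 *v v))) = - (c 2 *v v)" by (simp add: c_minus)
    then show ?thesis by (simp add: c_square)
  qed
  then show "c 3 *v (c 4 *v v) = c 2 *v v" .
  show 43: "c 4 *v (c 3 *v v) = - (c 2 *v v)" by (subst c_swap) (auto simp: 34)
  have 23: "c 2 *v (c 3 *v v) = c 4 *v v" for v
    by (simp add: 34[symmetric] c_swap[of 4 3] c_minus c_square)
  then show "c 2 *v (c 3 *v v) = c 4 *v v" .
  show "c 3 *v (c 2 *v v) = - (c 4 *v v)" by (subst c_swap) (auto simp: 23)
  have 42: "c 4 *v (c 2 *v v) = c 3 *v v" for v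
    by (simp add: 34[symmetric] c_swap[of 4 3] c_minus c_square)
  then show "c 4 *v (c 2 *v v) = c 3 *v v" .
  show "c 2 *v (c 4 *v v) = - (c 3 *v v)" by (subst c_swap) (auto simp: 42)
qed

lemma c_skew: "k \<in> frame_idx \<Longrightarrow> herm (c k *v x) y = - herm x (c k *v y)"
  using spinor_module unfolding spinor_module_def by blast

lemma spin_connection_Y:
  assumes "z \<in> S3" "k \<in> frame_idx"
  shows "spin_connection c z (Y k z) \<phi> = dir_deriv \<phi> z (Y k z) - (1/2) *\<^sub>R (c k *v \<phi> z)"
proof -
  have o: "Y a z \<bullet> Y b z = (if a = b then 1 else 0)" if "a \<in> frame_idx" "b \<in> frame_idx" for a b
    using Y_orthonormal_tangent(2)[OF assms(1) that] .
  have "(\<Sum>j\<in>frame_idx. \<Sum>l\<in>frame_idx. (levi_civita z (Y k z) (Y j) \<bullet> Y l z) *\<^sub>R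
        clifford c z (Y j z) (clifford c z (Y l z) (\<phi> z)))
      = (\<Sum>j\<in>frame_idx. \<Sum>l\<in>frame_idx. (Y j (Y k z) \<bullet> Y l z) *\<^sub>R (c j *v (c l *v \<phi> z)))"
    using assms by (intro sum.cong refl) (simp only: levi_civita_Y clifford_Y)
  \<comment> \<open>For j = k the vector \<open>Y j (Y k z)\<close> is - z, which is normal, so this
    term vanishes. Each of the other two indices j contributes minus \<open>c k\<close>.\<close>
  also have "\<dots> = (- 2) *\<^sub>R (c k *v \<phi> z)"
    using assms(2) Y_inner_self[of 2 z] Y_inner_self[of 3 z] Y_inner_self[of 4 z]
    by (auto simp: Y_mult Y_Y o c_mult inner_commute scaleR_2)
  finally show ?thesis
    by (simp add: spin_connection_def)
qed

text \<open>The constant 3/2 arises because c_k applied to the connection term - (1/2) c_k gives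
  1/2, once for each of the three frame directions.\<close>

lemma magnetic_dirac_eq:
  assumes "z \<in> S3"
  shows "T f z = (\<Sum>k\<in>frame_idx. c k *v dir_deriv f z (Y k z)) + (3/2) *\<^sub>R f z
     + (\<i> * of_real t) *s (c 2 *v f z)"
proof -
  have "clifford c z (Y k z) (spin_connection c z (Y k z) f)
      = c k *v dir_deriv f z (Y k z) + (1/2) *\<^sub>R f z" if "k \<in> frame_idx" for k
    using assms that
    by (simp only: clifford_Y spin_connection_Y)
      (simp add: matrix_diff matrix_vector_scaleR c_square)
  then have "dirac c f z = (\<Sum>k\<in>frame_idx. c k *v dir_deriv f z (Y k z) + (1/2) *\<^sub>R f z)"
    unfolding dirac_def by (intro sum.cong refl) simp
  also have "\<dots> = (\<Sum>k\<in>frame_idx. c k *v dir_deriv f z (Y k z)) + (3/2) *\<^sub>R f z"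
    by (simp add: sum.distrib sum_constant_scaleR)
  finally show ?thesis
    using clifford_Y[OF assms, of 2 c "f z"]
    by (simp add: magnetic_dirac_def Y_def)
qed

lemma T_continuous:
  assumes "smooth_on_S3 f"
  shows "continuous_on S3 (T f)"
proof -
  have "continuous_on S3 (\<lambda>z. (\<Sum>k\<in>frame_idx. c k *v dir_deriv f z (Y k z)) + (3/2) *\<^sub>R f z
     + (\<i> * of_real t) *s (c 2 *v f z))"
    using smooth_continuous[OF assms]
    by (intro continuous_intros bounded_linear.continuous_on[OF bounded_linear_matrix]
        bounded_linear.continuous_on[OF bounded_linear_smult_right]
        smooth_continuous_frechet[OF assms] bounded_linear.continuous_on[OF bounded_linear_Y])
  then show ?thesis
    by (rule continuous_on_eq) (simp add: magnetic_dirac_eq)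
qed

lemma T_add:
  assumes "smooth_on_S3 f" "smooth_on_S3 g" "z \<in> S3"
  shows "T (\<lambda>z. f z + g z) z = T f z + T g z"
  using assms
  by (simp add: magnetic_dirac_eq dir_deriv_add matrix_vector_right_distrib scaleR_add_right
      smult_add del: vector_add_ldistrib)

lemma T_smult:
  assumes "smooth_on_S3 f" "z \<in> S3"
  shows "T (\<lambda>z. a *s f z) z = a *s T f z"
  using assms
  by (simp add: magnetic_dirac_eq dir_deriv_bounded_linear[OF _ bounded_linear_smult_right]
      matrix_smult scaleR_eq_smult smult_add mult_ac)

text \<open>Each \<open>c k\<close> is skew-Hermitian, and integrating the derivative of
  \<open>herm (f z) (c k *v g z)\<close> to zero makes \<open>Y k\<close> skew as well, so their
  product is symmetric. In order zero, 3/2 is real and i t c2 is Hermitian.\<close>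

lemma T_symmetric:
  assumes f: "smooth_on_S3 f" and g: "smooth_on_S3 g"
  shows "integral\<^sup>L S3_measure (\<lambda>z. herm (T f z) (g z)) = integral\<^sup>L S3_measure (\<lambda>z. herm (f z) (T g z))"
proof -
  let ?D = "\<lambda>k f z. dir_deriv f z (Y k z)"
  note cont = continuous_intros smooth_continuous[OF f] smooth_continuous[OF g]
    bounded_linear.continuous_on[OF bounded_linear_matrix]
    bounded_linear.continuous_on[OF bounded_linear_smult_right]
    bounded_bilinear.continuous_on[OF bounded_bilinear_herm]
    smooth_continuous_frechet[OF f] smooth_continuous_frechet[OF g]
    bounded_linear.continuous_on[OF bounded_linear_Y]
  have i1: "integrable S3_measure (\<lambda>z. herm (c k *v ?D k f z) (g z))"
    and i2: "integrable S3_measure (\<lambda>z. herm (f z) (c k *v ?D k g z))" for k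
    by (intro integrable_S3 cont)+
  have k: "integral\<^sup>L S3_measure (\<lambda>z. herm (c k *v ?D k f z) (g z))
      = integral\<^sup>L S3_measure (\<lambda>z. herm (f z) (c k *v ?D k g z))" if k: "k \<in> frame_idx" for k
  proof -
    have cg: "smooth_on_S3 (\<lambda>z. c k *v g z)"
      by (rule smooth_on_S3_bounded_linear[OF bounded_linear_matrix g])
    have "0 = integral\<^sup>L S3_measure (\<lambda>z. dir_deriv (\<lambda>z. herm (f z) (c k *v g z)) z (Y k z))"
      by (rule integral_dir_deriv_Y[symmetric, OF smooth_on_S3_bilinear[OF bounded_bilinear_herm f cg]])
    also have "\<dots> = integral\<^sup>L S3_measure (\<lambda>z. herm (f z) (c k *v ?D k g z) - herm (c k *v ?D k f z) (g z))"
      by (rule Bochner_Integration.integral_cong)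
        (simp_all add: dir_deriv_bilinear[OF f cg bounded_bilinear_herm] c_skew[OF k]
          dir_deriv_bounded_linear[OF g bounded_linear_matrix])
    also have "\<dots> = integral\<^sup>L S3_measure (\<lambda>z. herm (f z) (c k *v ?D k g z))
        - integral\<^sup>L S3_measure (\<lambda>z. herm (c k *v ?D k f z) (g z))"
      by (rule Bochner_Integration.integral_diff[OF i2 i1])
    finally show ?thesis by simp
  qed
  define r where "r z = herm ((3/2) *\<^sub>R f z + (\<i> * of_real t) *s (c 2 *v f z)) (g z)" for z
  have r: "r z = herm (f z) ((3/2) *\<^sub>R g z + (\<i> * of_real t) *s (c 2 *v g z))" for z
    unfolding r_def
    by (simp add: herm_add_left herm_add_right herm_scaleR_left herm_scaleR_right
        herm_smult_left herm_smult_right c_skew)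
  have ir: "integrable S3_measure r"
    unfolding r_def by (intro integrable_S3 cont)
  have "integral\<^sup>L S3_measure (\<lambda>z. herm (T f z) (g z))
      = integral\<^sup>L S3_measure (\<lambda>z. (\<Sum>k\<in>frame_idx. herm (c k *v ?D k f z) (g z)) + r z)"
    by (rule Bochner_Integration.integral_cong)
      (simp_all only: magnetic_dirac_eq space_S3_measure add.assoc r_def herm_add_left herm_sum_left)
  also have "\<dots> = (\<Sum>k\<in>frame_idx. integral\<^sup>L S3_measure (\<lambda>z. herm (c k *v ?D k f z) (g z))) + integral\<^sup>L S3_measure r"
    using i1 ir by (subst Bochner_Integration.integral_add) (auto intro!: Bochner_Integration.integral_sum)
  also have "\<dots> = (\<Sum>k\<in>frame_idx. integral\<^sup>L S3_measure (\<lambda>z. herm (f z) (c k *v ?D k g z))) + integral\<^sup>L S3_measure r"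
    using k by simp
  also have "\<dots> = integral\<^sup>L S3_measure (\<lambda>z. (\<Sum>k\<in>frame_idx. herm (f z) (c k *v ?D k g z)) + r z)"
    using i2 ir by (subst Bochner_Integration.integral_add) (auto intro!: Bochner_Integration.integral_sum[symmetric])
  also have "\<dots> = integral\<^sup>L S3_measure (\<lambda>z. herm (f z) (T g z))"
    by (rule Bochner_Integration.integral_cong)
      (simp_all only: magnetic_dirac_eq space_S3_measure add.assoc r herm_add_right herm_sum_right)
  finally show ?thesis .
qed

end

section \<open>Eigenspinors\<close>

definition lin :: "complex \<Rightarrow> complex \<Rightarrow> C2 \<Rightarrow> complex" where
  "lin \<alpha> \<beta> z = \<alpha> * fst z + \<beta> * snd z"

text \<open>This is \<open>lin \<alpha> \<beta>\<close> composed with the quaternionic structure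
  \<open>Y 4\<close>, so both forms transform alike under SU(2).\<close>

definition lin' :: "complex \<Rightarrow> complex \<Rightarrow> C2 \<Rightarrow> complex" where
  "lin' \<alpha> \<beta> z = \<alpha> * cnj (snd z) - \<beta> * cnj (fst z)"

text \<open>A harmonic polynomial of bidegree (a, b): the coefficient vectors (\<alpha>, \<beta>) of
  l and (- \<beta>, \<alpha>) of l' pair to zero.\<close>

definition hpoly :: "nat \<Rightarrow> nat \<Rightarrow> complex \<Rightarrow> complex \<Rightarrow> C2 \<Rightarrow> complex" where
  "hpoly a b \<alpha> \<beta> z = lin \<alpha> \<beta> z ^ a * lin' \<alpha> \<beta> z ^ b"

lemma bounded_linear_lin: "bounded_linear (lin \<alpha> \<beta>)"
  by (simp add: linear_conv_bounded_linear[symmetric] lin_def linearI algebra_simps)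

lemma bounded_linear_lin': "bounded_linear (lin' \<alpha> \<beta>)"
  by (simp add: linear_conv_bounded_linear[symmetric] lin'_def linearI algebra_simps)

lemma smooth_hpoly: "smooth_on_S3 (hpoly a b \<alpha> \<beta>)"
  unfolding hpoly_def
  by (intro smooth_on_S3_bilinear[OF bounded_bilinear_mult] smooth_on_S3_power
      smooth_on_S3_bounded_linear[OF bounded_linear_lin smooth_on_S3_id]
      smooth_on_S3_bounded_linear[OF bounded_linear_lin' smooth_on_S3_id])

lemma lin_Y:
  "lin \<alpha> \<beta> (Y 2 z) = \<i> * lin \<alpha> \<beta> z" "lin' \<alpha> \<beta> (Y 2 z) = - \<i> * lin' \<alpha> \<beta> z"
  "lin \<alpha> \<beta> (Y 3 z) = - \<i> * lin' \<alpha> \<beta> z" "lin' \<alpha> \<beta> (Y 3 z) = - \<i> * lin \<alpha> \<beta> z"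
  "lin \<alpha> \<beta> (Y 4 z) = lin' \<alpha> \<beta> z" "lin' \<alpha> \<beta> (Y 4 z) = - lin \<alpha> \<beta> z"
  by (simp_all add: Y_eq lin_def lin'_def algebra_simps)

lemma dir_deriv_hpoly:
  assumes "z \<in> S3"
  shows "dir_deriv (hpoly a b \<alpha> \<beta>) z (Y k z)
    = of_nat a * lin \<alpha> \<beta> z ^ (a - 1) * lin' \<alpha> \<beta> z ^ b * lin \<alpha> \<beta> (Y k z)
    + of_nat b * lin \<alpha> \<beta> z ^ a * lin' \<alpha> \<beta> z ^ (b - 1) * lin' \<alpha> \<beta> (Y k z)"
proof -
  have 1: "(lin \<alpha> \<beta> has_derivative lin \<alpha> \<beta>) (at z)" "(lin' \<alpha> \<beta> has_derivative lin' \<alpha> \<beta>) (at z)"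
    by (rule bounded_linear_imp_has_derivative[OF bounded_linear_lin]
        bounded_linear_imp_has_derivative[OF bounded_linear_lin'])+
  have "(hpoly a b \<alpha> \<beta> has_derivative
     (\<lambda>X. lin \<alpha> \<beta> z ^ a * (of_nat b * lin' \<alpha> \<beta> X * lin' \<alpha> \<beta> z ^ (b - 1))
       + (of_nat a * lin \<alpha> \<beta> X * lin \<alpha> \<beta> z ^ (a - 1)) * lin' \<alpha> \<beta> z ^ b)) (at z)"
    unfolding hpoly_def by (intro has_derivative_mult has_derivative_power 1)
  from dir_deriv_tangent[OF this assms Y_inner_self]
  show ?thesis by (simp add: mult_ac)
qed

text \<open>At a = 0 the truncated exponent is harmless because the factor \<open>of_nat a\<close>
  vanishes; the same convention underlies all formulas with a - 1 or b - 1 below.\<close>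

lemma power_pred: "of_nat a * (x::complex) ^ (a - 1) * x = of_nat a * x ^ a"
  by (cases a) auto

text \<open>The usual action of su(2): \<open>Y 2\<close> is diagonal with weight i (a - b), while
  \<open>Y 3\<close> and \<open>Y 4\<close> combine a raising and a lowering operator.\<close>

lemma dir_deriv_hpoly_Y:
  assumes "z \<in> S3"
  shows "dir_deriv (hpoly a b \<alpha> \<beta>) z (Y 2 z) = \<i> * (of_nat a - of_nat b) * hpoly a b \<alpha> \<beta> z"
    "dir_deriv (hpoly a b \<alpha> \<beta>) z (Y 3 z)
      = - \<i> * (of_nat a * hpoly (a - 1) (b + 1) \<alpha> \<beta> z + of_nat b * hpoly (a + 1) (b - 1) \<alpha> \<beta> z)"
    "dir_deriv (hpoly a b \<alpha> \<beta>) z (Y 4 z)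
      = of_nat a * hpoly (a - 1) (b + 1) \<alpha> \<beta> z - of_nat b * hpoly (a + 1) (b - 1) \<alpha> \<beta> z"
proof -
  let ?l = "lin \<alpha> \<beta> z" and ?m = "lin' \<alpha> \<beta> z"
  have "dir_deriv (hpoly a b \<alpha> \<beta>) z (Y 2 z)
      = \<i> * ((of_nat a * ?l ^ (a - 1) * ?l) * ?m ^ b - ?l ^ a * (of_nat b * ?m ^ (b - 1) * ?m))"
    unfolding dir_deriv_hpoly[OF assms] lin_Y by (simp add: algebra_simps)
  also have "\<dots> = \<i> * (of_nat a - of_nat b) * hpoly a b \<alpha> \<beta> z"
    unfolding power_pred by (simp add: hpoly_def algebra_simps)
  finally show "dir_deriv (hpoly a b \<alpha> \<beta>) z (Y 2 z) = \<i> * (of_nat a - of_nat b) * hpoly a b \<alpha> \<beta> z" .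
qed (simp_all only: dir_deriv_hpoly[OF assms] lin_Y, simp_all add: hpoly_def algebra_simps)

definition eigvals :: "real \<Rightarrow> real set" where
  "eigvals t = {3/2 + t + real k | k :: nat. True} \<union>
     {3/2 - t + real k | k :: nat. True} \<union>
     {1/2 + sqrt ((1 + t + 2 * real p - real k)\<^sup>2 + 4 * (real k - real p) * (real p + 1))
        | p k :: nat. p < k} \<union>
     {1/2 - sqrt ((1 + t + 2 * real p - real k)\<^sup>2 + 4 * (real k - real p) * (real p + 1))
        | p k :: nat. p < k}"

context spinor_mod
begin

definition eigen :: "real \<Rightarrow> (C2 \<Rightarrow> spinor) \<Rightarrow> bool" where
  "eigen l f \<longleftrightarrow> smooth_on_S3 f \<and> (\<forall>z\<in>S3. T f z = complex_of_real l *s f z)"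

lemma smooth_smult: "smooth_on_S3 f \<Longrightarrow> smooth_on_S3 (\<lambda>z. a *s (f z :: spinor))"
  by (rule smooth_on_S3_bounded_linear[OF bounded_linear_smult_right])

lemma eigen_add: "eigen l f \<Longrightarrow> eigen l g \<Longrightarrow> eigen l (\<lambda>z. f z + g z)"
  by (auto simp: eigen_def T_add smult_add intro: smooth_on_S3_add)

lemma eigen_smult: "eigen l f \<Longrightarrow> eigen l (\<lambda>z. a *s f z)"
  by (auto simp: eigen_def T_smult mult.commute intro: smooth_smult)

lemma eigen_0: "eigen l (\<lambda>z. 0)"
proof -
  have "T (\<lambda>z. 0 *s 0) z = 0" if "z \<in> S3" for z
    using T_smult[OF smooth_on_S3_const that, of 0 0] by simp
  then show ?thesis by (auto simp: eigen_def smooth_on_S3_const)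
qed

text \<open>Contributions to the same eigenvalue are merged into a single \<open>g l\<close>, so
  distinct summands belong to distinct eigenvalues and are orthogonal without any choice of
  basis.\<close>

definition eigspan :: "(C2 \<Rightarrow> spinor) set" where
  "eigspan = {v. \<exists>F g. finite F \<and> F \<subseteq> eigvals t \<and> (\<forall>l\<in>F. eigen l (g l))
     \<and> (\<forall>z\<in>S3. v z = (\<Sum>l\<in>F. g l z))}"

lemma eigspan_eigen: "eigen l f \<Longrightarrow> l \<in> eigvals t \<Longrightarrow> f \<in> eigspan"
  unfolding eigspan_def by (intro CollectI exI[of _ "{l}"] exI[of _ "\<lambda>_. f"]) auto

lemma eigspan_cong: "v \<in> eigspan \<Longrightarrow> (\<And>z. z \<in> S3 \<Longrightarrow> v z = w z) \<Longrightarrow> w \<in> eigspan"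
  unfolding eigspan_def by auto

lemma eigspan_smult:
  assumes "v \<in> eigspan" shows "(\<lambda>z. a *s v z) \<in> eigspan"
proof -
  obtain F g where "finite F" "F \<subseteq> eigvals t" "\<forall>l\<in>F. eigen l (g l)" "\<forall>z\<in>S3. v z = (\<Sum>l\<in>F. g l z)"
    using assms unfolding eigspan_def by blast
  then show ?thesis unfolding eigspan_def
    by (intro CollectI exI[of _ F] exI[of _ "\<lambda>l z. a *s g l z"])
      (auto simp: eigen_smult linear_sum[OF bounded_linear.linear[OF bounded_linear_smult_right]])
qed

lemma eigspan_add:
  assumes "v \<in> eigspan" "w \<in> eigspan" shows "(\<lambda>z. v z + w z) \<in> eigspan"
proof -
  obtain F g where F: "finite F" "F \<subseteq> eigvals t" "\<forall>l\<in>F. eigen l (g l)" "\<forall>z\<in>S3. v z = (\<Sum>l\<in>F. g l z)"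
    using assms(1) unfolding eigspan_def by blast
  obtain G k where G: "finite G" "G \<subseteq> eigvals t" "\<forall>l\<in>G. eigen l (k l)" "\<forall>z\<in>S3. w z = (\<Sum>l\<in>G. k l z)"
    using assms(2) unfolding eigspan_def by blast
  \<comment> \<open>Both families are extended by the zero spinor, so that they can be added over
    the union of their index sets.\<close>
  define g' where "g' l = (if l \<in> F then g l else (\<lambda>z. 0))" for l
  define k' where "k' l = (if l \<in> G then k l else (\<lambda>z. 0))" for l
  have "(\<Sum>l\<in>F \<union> G. g' l z + k' l z) = (\<Sum>l\<in>F. g l z) + (\<Sum>l\<in>G. k l z)" for z
  proof -
    have "(\<Sum>l\<in>F \<union> G. g' l z) = (\<Sum>l\<in>F. g' l z)" "(\<Sum>l\<in>F \<union> G. k' l z) = (\<Sum>l\<in>G. k' l z)"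
      by (rule sum.mono_neutral_right; use F(1) G(1) in \<open>simp add: g'_def k'_def\<close>)+
    then show ?thesis by (simp add: sum.distrib g'_def k'_def)
  qed
  moreover have "eigen l (\<lambda>z. g' l z + k' l z)" if "l \<in> F \<union> G" for l
    using F(3) G(3) by (auto intro!: eigen_add simp: g'_def k'_def eigen_0)
  ultimately show ?thesis unfolding eigspan_def using F G
    by (intro CollectI exI[of _ "F \<union> G"] exI[of _ "\<lambda>l z. g' l z + k' l z"]) auto
qed

lemma smooth_hpoly_spinor: "smooth_on_S3 (\<lambda>z. hpoly a b \<alpha> \<beta> z *s (e :: spinor))"
  by (rule smooth_on_S3_bounded_linear[OF bounded_linear_smult_left smooth_hpoly])

lemma T_hpoly:
  assumes "z \<in> S3"
  shows "T (\<lambda>z. hpoly a b \<alpha> \<beta> z *s e) z =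
     (\<i> * (of_nat a - of_nat b) * hpoly a b \<alpha> \<beta> z) *s (c 2 *v e)
   + (- \<i> * (of_nat a * hpoly (a - 1) (b + 1) \<alpha> \<beta> z + of_nat b * hpoly (a + 1) (b - 1) \<alpha> \<beta> z)) *s (c 3 *v e)
   + (of_nat a * hpoly (a - 1) (b + 1) \<alpha> \<beta> z - of_nat b * hpoly (a + 1) (b - 1) \<alpha> \<beta> z) *s (c 4 *v e)
   + ((3/2) * hpoly a b \<alpha> \<beta> z) *s e + (\<i> * of_real t * hpoly a b \<alpha> \<beta> z) *s (c 2 *v e)"
  using assms
  by (simp add: magnetic_dirac_eq dir_deriv_bounded_linear[OF smooth_hpoly bounded_linear_smult_left]
      dir_deriv_hpoly_Y matrix_smult scaleR_eq_smult add.assoc)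

section \<open>Diagonalization of the blocks\<close>

context
  fixes e :: spinor
  assumes e: "c 2 *v e = - \<i> *s e"
begin

text \<open>A vector of the other eigenspace of \<open>c 2\<close>; the sign is chosen so that
  \<open>c 3\<close> maps it back to e.\<close>

definition e' :: spinor where "e' = - (c 3 *v e)"

lemma c_e:
  "c 3 *v e = - e'" "c 4 *v e = - \<i> *s e'"
  "c 2 *v e' = \<i> *s e'" "c 3 *v e' = e" "c 4 *v e' = - \<i> *s e"
proof -
  show 3: "c 3 *v e = - e'" by (simp add: e'_def)
  have "c 4 *v e = - (c 3 *v (c 2 *v e))" by (simp add: c_mult)
  also have "\<dots> = \<i> *s (c 3 *v e)" by (simp add: e matrix_smult c_minus)
  finally show 4: "c 4 *v e = - \<i> *s e'" by (simp add: 3)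
  show "c 2 *v e' = \<i> *s e'" using 4 by (simp add: e'_def c_minus c_mult)
  show "c 3 *v e' = e" by (simp add: e'_def c_minus c_square)
  show "c 4 *v e' = - \<i> *s e" by (simp add: e'_def c_minus c_mult e)
qed

text \<open>On e the lowering parts of \<open>c 3\<close> with \<open>Y 3\<close> and
  \<open>c 4\<close> with \<open>Y 4\<close> cancel and the raising parts add up; on
  \<open>e'\<close> it is the other way round. This is what keeps the blocks at size one or
  two.\<close>

lemma T_hpoly_e:
  assumes "z \<in> S3"
  shows "T (\<lambda>z. hpoly a b \<alpha> \<beta> z *s e) z =
    ((of_nat a - of_nat b + 3/2 + of_real t) * hpoly a b \<alpha> \<beta> z) *s e
    + (2 * \<i> * of_nat b * hpoly (a + 1) (b - 1) \<alpha> \<beta> z) *s e'"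
  unfolding T_hpoly[OF assms] e c_e
  by (simp add: vec_eq_iff algebra_simps)

lemma T_hpoly_e':
  assumes "z \<in> S3"
  shows "T (\<lambda>z. hpoly a b \<alpha> \<beta> z *s e') z =
    ((of_nat b - of_nat a + 3/2 - of_real t) * hpoly a b \<alpha> \<beta> z) *s e'
    + (- 2 * \<i> * of_nat a * hpoly (a - 1) (b + 1) \<alpha> \<beta> z) *s e"
  unfolding T_hpoly[OF assms] e c_e
  by (simp add: vec_eq_iff algebra_simps)

text \<open>A block of size one: the coupling to \<open>e'\<close> carries the factor b = 0. In the
  antiholomorphic case the coupling to e carries the factor a = 0.\<close>

lemma eigen_holomorphic: "eigen (3/2 + t + real a) (\<lambda>z. hpoly a 0 \<alpha> \<beta> z *s e)"
  unfolding eigen_def by (auto simp: smooth_hpoly_spinor T_hpoly_e mult_ac add_ac)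

lemma eigen_antiholomorphic: "eigen (3/2 - t + real b) (\<lambda>z. hpoly 0 b \<alpha> \<beta> z *s e')"
  unfolding eigen_def by (auto simp: smooth_hpoly_spinor T_hpoly_e' algebra_simps)

text \<open>In the basis given by \<open>hpoly p b *s e\<close> and \<open>hpoly (p + 1) (b - 1) *s e'\<close> the operator minus
  \<open>1/2\<close> is the matrix with rows \<open>A, - 2 \<i> (p + 1)\<close> and \<open>2 \<i> b, - A\<close>, whose square is \<open>R\<^sup>2\<close>.\<close>

definition mixed :: "real \<Rightarrow> real \<Rightarrow> nat \<Rightarrow> nat \<Rightarrow> complex \<Rightarrow> complex \<Rightarrow> C2 \<Rightarrow> spinor" where
  "mixed A R p b \<alpha> \<beta> z = of_real (A + R) *s (hpoly p b \<alpha> \<beta> z *s e)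
      + (2 * \<i> * of_nat b) *s (hpoly (p + 1) (b - 1) \<alpha> \<beta> z *s e')"

text \<open>If M^2 = R^2 then M (M + R) = R (M + R), so the columns of M + R are eigenvectors;
  \<open>mixed\<close> is the first column. R may have either sign, which gives both eigenvalues of
  the block.\<close>

lemma eigen_mixed:
  assumes "b > 0" "A = 1 + t + real p - real b" "R\<^sup>2 = A\<^sup>2 + 4 * real b * (real p + 1)"
  shows "eigen (1/2 + R) (mixed A R p b \<alpha> \<beta>)"
proof -
  let ?f = "\<lambda>z. of_real (A + R) *s (hpoly p b \<alpha> \<beta> z *s e)"
  let ?g = "\<lambda>z. (2 * \<i> * of_nat b) *s (hpoly (p + 1) (b - 1) \<alpha> \<beta> z *s e')"
  have sm: "smooth_on_S3 ?f" "smooth_on_S3 ?g"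
    by (intro smooth_smult smooth_hpoly_spinor)+
  have "T (\<lambda>z. ?f z + ?g z) z = of_real (1/2 + R) *s (?f z + ?g z)" if z: "z \<in> S3" for z
  proof -
    have R: "(of_real R)\<^sup>2 = (of_real A)\<^sup>2 + 4 * of_nat b * (of_nat p + 1 :: complex)"
      using arg_cong[OF assms(3), of complex_of_real] by simp
    have t: "of_real t = (of_real A - 1 - of_nat p + of_nat b :: complex)"
      using assms(2) by simp
    have b: "of_nat (b - 1) = (of_nat b - 1 :: complex)" using assms(1) by (simp add: of_nat_diff)
    have "T (\<lambda>z. ?f z + ?g z) z = of_real (A + R) *s T (\<lambda>z. hpoly p b \<alpha> \<beta> z *s e) z
        + (2 * \<i> * of_nat b) *s T (\<lambda>z. hpoly (p + 1) (b - 1) \<alpha> \<beta> z *s e') z"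
      using z by (simp only: T_add[OF sm z] T_smult[OF smooth_hpoly_spinor z])
    also have "\<dots> = ((of_real A + of_real R) * (1/2 + of_real A) * hpoly p b \<alpha> \<beta> z
          + 4 * of_nat b * (of_nat p + 1) * hpoly p b \<alpha> \<beta> z) *s e
        + (2 * \<i> * of_nat b * hpoly (p + 1) (b - 1) \<alpha> \<beta> z * (1/2 + of_real R)) *s e'"
      using assms(1) unfolding T_hpoly_e[OF z] T_hpoly_e'[OF z] b t
      by (simp add: vec_eq_iff algebra_simps)
    also have "(of_real A + of_real R) * (1/2 + of_real A) * hpoly p b \<alpha> \<beta> z
          + 4 * of_nat b * (of_nat p + 1) * hpoly p b \<alpha> \<beta> z
        = (of_real A + of_real R) * (1/2 + of_real R) * hpoly p b \<alpha> \<beta> z"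
    proof -
      have "4 * of_nat b * (of_nat p + 1) = (of_real R)\<^sup>2 - (of_real A :: complex)\<^sup>2" using R by simp
      then show ?thesis by (simp only:) (simp add: algebra_simps power2_eq_square)
    qed
    finally show ?thesis by (simp add: vec_eq_iff algebra_simps)
  qed
  then show ?thesis
    using sm unfolding eigen_def mixed_def by (auto intro: smooth_on_S3_add)
qed

text \<open>Reindexing by k = p + b, where b > 0 becomes p < k.\<close>

lemma eigvals_mixed:
  assumes "b > 0" "A = 1 + t + real p - real b" "R = sqrt (A\<^sup>2 + 4 * real b * (real p + 1))"
  shows "1/2 + R \<in> eigvals t" "1/2 - R \<in> eigvals t"
proof -
  have "p < p + b" using assms(1) by simp
  moreover have "R = sqrt ((1 + t + 2 * real p - real (p + b))\<^sup>2 + 4 * (real (p + b) - real p) * (real p + 1))"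
  proof -
    have "1 + t + 2 * real p - real (p + b) = 1 + t + real p - real b" "real (p + b) - real p = real b"
      by simp_all
    then show ?thesis by (simp only: assms(2,3))
  qed
  ultimately show "1/2 + R \<in> eigvals t" "1/2 - R \<in> eigvals t"
    unfolding eigvals_def by blast+
qed

text \<open>For b > 0 the radicand is positive, so the eigenvectors for R and - R are distinct; they
  differ by 2 R times the first basis vector of the block, and the second one follows by
  subtraction.\<close>

lemma eigspan_hpoly_pair:
  assumes "b > 0"
  shows "(\<lambda>z. hpoly p b \<alpha> \<beta> z *s e) \<in> eigspan" (is "?f \<in> _")
    "(\<lambda>z. hpoly (p + 1) (b - 1) \<alpha> \<beta> z *s e') \<in> eigspan" (is "?g \<in> _")
proof -
  define A where "A = 1 + t + real p - real b"
  define R where "R = sqrt (A\<^sup>2 + 4 * real b * (real p + 1))"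
  have R2: "R\<^sup>2 = A\<^sup>2 + 4 * real b * (real p + 1)" by (simp add: R_def)
  have "A\<^sup>2 + 4 * real b * (real p + 1) > 0"
    using assms by (intro add_nonneg_pos) auto
  then have R: "R > 0" by (simp add: R_def)
  have 1: "mixed A R p b \<alpha> \<beta> \<in> eigspan"
    by (rule eigspan_eigen[OF eigen_mixed[OF assms A_def R2] eigvals_mixed(1)[OF assms A_def R_def]])
  have "eigen (1/2 + (- R)) (mixed A (- R) p b \<alpha> \<beta>)"
    by (rule eigen_mixed[OF assms A_def]) (simp add: R2)
  then have 2: "mixed A (- R) p b \<alpha> \<beta> \<in> eigspan"
    using eigspan_eigen eigvals_mixed(2)[OF assms A_def R_def] by simp
  have "(\<lambda>z. (1 / of_real (2 * R)) *s (mixed A R p b \<alpha> \<beta> z + (- 1) *s mixed A (- R) p b \<alpha> \<beta> z)) \<in> eigspan"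
    by (intro eigspan_smult eigspan_add 1 2)
  then show f: "?f \<in> eigspan"
    by (rule eigspan_cong) (use R in \<open>simp add: mixed_def vec_eq_iff field_simps\<close>)
  have "(\<lambda>z. (1 / (2 * \<i> * of_nat b)) *s (mixed A R p b \<alpha> \<beta> z + (- of_real (A + R)) *s (hpoly p b \<alpha> \<beta> z *s e))) \<in> eigspan"
    by (intro eigspan_smult eigspan_add 1 f)
  then show "?g \<in> eigspan"
    by (rule eigspan_cong) (use assms in \<open>simp add: mixed_def vec_eq_iff field_simps\<close>)
qed

lemma eigspan_hpoly_e: "(\<lambda>z. hpoly a b \<alpha> \<beta> z *s e) \<in> eigspan"
proof (cases b)
  case 0
  then show ?thesis
    using eigspan_eigen[OF eigen_holomorphic] by (auto simp: eigvals_def)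
qed (simp add: eigspan_hpoly_pair)

lemma eigspan_hpoly_e': "(\<lambda>z. hpoly a b \<alpha> \<beta> z *s e') \<in> eigspan"
proof (cases a)
  case 0
  then show ?thesis
    using eigspan_eigen[OF eigen_antiholomorphic] by (auto simp: eigvals_def)
next
  case (Suc p)
  \<comment> \<open>As second member of its block, \<open>hpoly (Suc p) b\<close> is paired with
    \<open>hpoly p (Suc b)\<close>.\<close>
  then show ?thesis using eigspan_hpoly_pair(2)[of "Suc b" p] by simp
qed

text \<open>Applying \<open>c 2\<close> reverses the relative sign of the two terms, since they lie
  in its eigenspaces for - i and i.\<close>

lemma e_independent:
  assumes "x *s e + y *s e' = 0" "e \<noteq> 0"
  shows "x = 0 \<and> y = 0"
proof -
  have e': "e' \<noteq> 0"
    using c_e(4) assms(2) by (auto simp: matrix_vector_mult_0_right)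
  have "c 2 *v (x *s e + y *s e') = 0" using assms(1) by simp
  then have "(- \<i>) *s ((\<i> * y) *s e') = (- \<i>) *s ((\<i> * x) *s e)"
    by (simp add: matrix_vector_right_distrib matrix_smult e c_e mult.commute del: vector_smult_assoc)
  then have xy: "x *s e = y *s e'" by simp
  have "x *s e + x *s e = 0" "y *s e' + y *s e' = 0"
    using assms(1) unfolding xy by simp_all
  then have "x *s e = 0" "y *s e' = 0" by (simp_all add: vec_eq_iff)
  then show ?thesis using assms(2) e' by simp
qed

end

end

text \<open>A rational point of the sphere with both coordinates nonzero: there l = 3/5 and l' =
  4/5, so no product of their powers vanishes. It witnesses that all eigenspinors built from (1, 0)
  are nonzero.\<close>

lemma hpoly_point: "hpoly a b 1 0 (3/5, 4/5) \<noteq> 0"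
  by (simp add: hpoly_def lin_def lin'_def)

lemma point_in_S3: "(3/5, 4/5) \<in> S3"
  by (simp add: norm_Pair power2_eq_square)

section \<open>Discreteness of the eigenvalues\<close>

lemma finite_eigvals_bounded: "finite {l \<in> eigvals t. \<bar>l\<bar> \<le> M}"
proof -
  have fin: "finite {k. real k \<le> x}" for x
    by (rule finite_subset[of _ "{..nat \<lceil>x\<rceil>}"]) (auto simp: le_nat_iff, linarith)
  define R where "R p k = sqrt ((1 + t + 2 * real p - real k)\<^sup>2 + 4 * (real k - real p) * (real p + 1))" for p k
  define K where "K = {k. real k \<le> (M + 1/2)\<^sup>2}"
  \<comment> \<open>For p < k the product (k - p) (p + 1) equals k + p (k - p - 1), which is at
    least k. So a bound on the root bounds k and thereby p; the shift by 1/2 passes from the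
    eigenvalue to the root.\<close>
  have K: "k \<in> K" if "p < k" "R p k \<le> M + 1/2" for p k
  proof -
    have "real k \<le> (real k - real p) * (real p + 1)"
    proof -
      have "real p * (real k - real p - 1) \<ge> 0" using that(1) by (intro mult_nonneg_nonneg) auto
      then show ?thesis by (simp add: algebra_simps)
    qed
    then have "real k \<le> (1 + t + 2 * real p - real k)\<^sup>2 + 4 * ((real k - real p) * (real p + 1))"
      using zero_le_power2[of "1 + t + 2 * real p - real k"] by linarith
    also have "\<dots> = (R p k)\<^sup>2"
      using that(1) by (simp add: R_def)
    also have "\<dots> \<le> (M + 1/2)\<^sup>2"
      using that by (intro power_mono) (auto simp: R_def)
    finally show ?thesis by (simp add: K_def)
  qed
  have "finite (\<Union>k\<in>K. {..<k})"
    by (auto simp: K_def fin)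
  then have P: "finite ((\<Union>k\<in>K. {..<k}) \<times> K)" by (auto simp: K_def fin)
  have "{l \<in> eigvals t. \<bar>l\<bar> \<le> M} \<subseteq> (\<lambda>k. 3/2 + t + real k) ` {k. real k \<le> M - 3/2 - t}
      \<union> (\<lambda>k. 3/2 - t + real k) ` {k. real k \<le> M - 3/2 + t}
      \<union> (\<lambda>(p, k). 1/2 + R p k) ` ((\<Union>k\<in>K. {..<k}) \<times> K)
      \<union> (\<lambda>(p, k). 1/2 - R p k) ` ((\<Union>k\<in>K. {..<k}) \<times> K)"
  proof
    fix l assume l: "l \<in> {l \<in> eigvals t. \<bar>l\<bar> \<le> M}"
    then consider k where "l = 3/2 + t + real k" | k where "l = 3/2 - t + real k"
      | p k where "p < k" "l = 1/2 + R p k" | p k where "p < k" "l = 1/2 - R p k"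
      unfolding eigvals_def R_def by blast
    then show "l \<in> (\<lambda>k. 3/2 + t + real k) ` {k. real k \<le> M - 3/2 - t}
      \<union> (\<lambda>k. 3/2 - t + real k) ` {k. real k \<le> M - 3/2 + t}
      \<union> (\<lambda>(p, k). 1/2 + R p k) ` ((\<Union>k\<in>K. {..<k}) \<times> K)
      \<union> (\<lambda>(p, k). 1/2 - R p k) ` ((\<Union>k\<in>K. {..<k}) \<times> K)"
    proof cases
      case 1 then show ?thesis using l by auto
    next
      case 2 then show ?thesis using l by auto
    next
      case 3
      then have "k \<in> K" using l by (intro K[of p]) auto
      then show ?thesis using 3 by (force intro!: image_eqI[of _ _ "(p, k)"])
    next
      case 4
      then have "k \<in> K" using l by (intro K[of p]) auto
      then show ?thesis using 4 by (force intro!: image_eqI[of _ _ "(p, k)"])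
    qed
  qed
  then show ?thesis
    by (rule finite_subset) (intro finite_UnI finite_imageI fin P)
qed

text \<open>Eigenvalues beyond |\<mu>| + 1 in modulus have distance at least 1 from \<mu>; the
  remaining ones are finite in number.\<close>

lemma eigvals_separated:
  assumes "\<mu> \<notin> complex_of_real ` eigvals t"
  obtains d where "d > 0" "\<And>l. l \<in> eigvals t \<Longrightarrow> d \<le> norm (complex_of_real l - \<mu>)"
proof -
  define F where "F = {l \<in> eigvals t. \<bar>l\<bar> \<le> norm \<mu> + 1}"
  have "finite (complex_of_real ` F)"
    unfolding F_def by (intro finite_imageI finite_eigvals_bounded)
  from finite_set_avoid[OF this, of \<mu>] obtain d where
    d: "d > 0" "\<And>x. x \<in> complex_of_real ` F \<Longrightarrow> x \<noteq> \<mu> \<Longrightarrow> d \<le> dist \<mu> x" by blast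
  have "min d 1 \<le> norm (complex_of_real l - \<mu>)" if l: "l \<in> eigvals t" for l
  proof (cases "l \<in> F")
    case True
    moreover have "complex_of_real l \<noteq> \<mu>" using assms l by blast
    ultimately have "d \<le> dist \<mu> (complex_of_real l)" by (intro d(2)) auto
    then show ?thesis by (simp add: dist_norm norm_minus_commute)
  next
    case False
    then have "\<bar>l\<bar> > norm \<mu> + 1" using l by (simp add: F_def)
    then have "1 \<le> norm (complex_of_real l) - norm \<mu>" by simp
    also have "\<dots> \<le> norm (complex_of_real l - \<mu>)" by (rule norm_triangle_ineq2)
    finally show ?thesis by simp
  qed
  then show thesis using d(1) by (intro that[of "min d 1"]) auto
qed

section \<open>Density of the eigenspinors\<close>

text \<open>The rule \<open>hspan_cong\<close> makes this a space of functions on the sphere, where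
  |z|^2 may be replaced by 1. Closure under multiplication by coordinates rests on this.\<close>

inductive_set hspan :: "(C2 \<Rightarrow> complex) set" where
  hspan_hpoly: "hpoly a b \<alpha> \<beta> \<in> hspan"
| hspan_add: "f \<in> hspan \<Longrightarrow> g \<in> hspan \<Longrightarrow> (\<lambda>z. f z + g z) \<in> hspan"
| hspan_mult: "f \<in> hspan \<Longrightarrow> (\<lambda>z. x * f z) \<in> hspan"
| hspan_cong: "f \<in> hspan \<Longrightarrow> (\<And>z. z \<in> S3 \<Longrightarrow> f z = g z) \<Longrightarrow> g \<in> hspan"

lemma hspan_diff: "f \<in> hspan \<Longrightarrow> g \<in> hspan \<Longrightarrow> (\<lambda>z. f z - g z) \<in> hspan"
  using hspan_add[OF _ hspan_mult[of g "- 1"], of f] by simp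

lemma hspan_0: "(\<lambda>z. 0) \<in> hspan"
  using hspan_mult[OF hspan_hpoly, of 0] by simp

lemma hspan_sum: "(\<And>i. i \<in> I \<Longrightarrow> f i \<in> hspan) \<Longrightarrow> (\<lambda>z. \<Sum>i\<in>I. f i z) \<in> hspan"
  by (induction I rule: infinite_finite_induct) (auto intro: hspan_0 hspan_add)

text \<open>The coefficients of a polynomial curve in a linear space lie in that space: passing from
  \<open>f s\<close> to \<open>f (2 s) - 2\<^sup>n f s\<close> removes the leading term.\<close>

lemma hspan_coeff:
  assumes "\<And>s::complex. (\<lambda>z. \<Sum>m\<le>N. s ^ m * P m z) \<in> hspan" "m \<le> N"
  shows "P m \<in> hspan"
  using assms
proof (induction N arbitrary: P m)
  case 0
  then show ?case using "0.prems"(1)[of 0] by simp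
next
  case (Suc N)
  \<comment> \<open>The rescaling trick multiplies the m-th coefficient by this number, which has to
    be divided out again.\<close>
  have two: "(2::complex) ^ m - 2 ^ Suc N \<noteq> 0" if "m \<le> N" for m
  proof
    assume "(2::complex) ^ m - 2 ^ Suc N = 0"
    then have "norm ((2::complex) ^ m) = norm ((2::complex) ^ Suc N)" by simp
    then have "(2::real) ^ m = 2 ^ Suc N" by (simp only: norm_power norm_numeral)
    then show False using that by (simp only: power_inject_exp)
  qed
  have IH: "P m \<in> hspan" if "m \<le> N" for m
  proof -
    have "(\<lambda>z. (2 ^ m - 2 ^ Suc N) * P m z) \<in> hspan"
    proof (rule Suc.IH[of "\<lambda>m z. (2 ^ m - 2 ^ Suc N) * P m z", OF _ that])
      fix s :: complex
      have "(\<lambda>z. (\<Sum>m\<le>Suc N. (2 * s) ^ m * P m z) - 2 ^ Suc N * (\<Sum>m\<le>Suc N. s ^ m * P m z)) \<in> hspan"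
        by (intro hspan_diff hspan_mult Suc.prems(1))
      also have "(\<lambda>z. (\<Sum>m\<le>Suc N. (2 * s) ^ m * P m z) - 2 ^ Suc N * (\<Sum>m\<le>Suc N. s ^ m * P m z))
          = (\<lambda>z. \<Sum>m\<le>N. s ^ m * ((2 ^ m - 2 ^ Suc N) * P m z))"
        by (simp add: fun_eq_iff sum_distrib_left sum_subtractf algebra_simps power_mult_distrib)
      finally show "(\<lambda>z. \<Sum>m\<le>N. s ^ m * ((2 ^ m - 2 ^ Suc N) * P m z)) \<in> hspan" .
    qed
    from hspan_mult[OF this, of "1 / (2 ^ m - 2 ^ Suc N)"] show ?thesis
      using two[OF that] by simp
  qed
  show ?case
  proof (cases "m \<le> N")
    case False
    then have m: "m = Suc N" using Suc.prems(2) by simp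
    have "(\<lambda>z. (\<Sum>m\<le>Suc N. 1 ^ m * P m z) - (\<Sum>m\<le>N. P m z)) \<in> hspan"
      by (intro hspan_diff Suc.prems(1) hspan_sum IH) auto
    then show ?thesis by (simp add: m)
  qed (rule IH)
qed

text \<open>Polarization: this is the derivative at s = 0 of \<open>hpoly\<close> with coefficients
  moved to (\<alpha> + s \<gamma>, \<beta> + s \<delta>). It is the linear coefficient of a
  polynomial curve in \<open>hspan\<close>, so \<open>hspan_coeff\<close> applies.\<close>

lemma hspan_derivative:
  "(\<lambda>z. of_nat a * lin \<alpha> \<beta> z ^ (a - 1) * lin \<gamma> \<delta> z * lin' \<alpha> \<beta> z ^ b
     + of_nat b * lin \<alpha> \<beta> z ^ a * lin' \<alpha> \<beta> z ^ (b - 1) * lin' \<gamma> \<delta> z) \<in> hspan"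
proof -
  define q where "q z = [:lin \<alpha> \<beta> z, lin \<gamma> \<delta> z:] ^ a * [:lin' \<alpha> \<beta> z, lin' \<gamma> \<delta> z:] ^ b" for z
  have poly_q: "poly (q z) s = hpoly a b (\<alpha> + s * \<gamma>) (\<beta> + s * \<delta>) z" for z s
    by (simp add: q_def hpoly_def lin_def lin'_def algebra_simps)
  have lin_deg: "degree [:x, y:] \<le> 1" for x y :: complex by simp
  have "degree (q z) \<le> a + b" for z
  proof -
    have "degree (q z) \<le> degree ([:lin \<alpha> \<beta> z, lin \<gamma> \<delta> z:] ^ a) + degree ([:lin' \<alpha> \<beta> z, lin' \<gamma> \<delta> z:] ^ b)"
      unfolding q_def by (rule degree_mult_le)
    also have "\<dots> \<le> degree [:lin \<alpha> \<beta> z, lin \<gamma> \<delta> z:] * a + degree [:lin' \<alpha> \<beta> z, lin' \<gamma> \<delta> z:] * b"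
      by (intro add_mono degree_power_le)
    also have "\<dots> \<le> 1 * a + 1 * b"
      by (intro add_mono mult_right_mono lin_deg) auto
    finally show ?thesis by simp
  qed
  \<comment> \<open>The upper index exceeds the degree bound by one so that the coefficient of index
    1 is in range even when a + b = 0.\<close>
  then have sum_q: "poly (q z) s = (\<Sum>m\<le>Suc (a + b). s ^ m * coeff (q z) m)" for z s
  proof -
    have "poly (q z) s = (\<Sum>m\<le>degree (q z). s ^ m * coeff (q z) m)"
      by (simp add: poly_altdef mult.commute)
    also have "\<dots> = (\<Sum>m\<le>Suc (a + b). s ^ m * coeff (q z) m)"
      using \<open>degree (q z) \<le> a + b\<close> by (intro sum.mono_neutral_left) (auto simp: coeff_eq_0)
    finally show ?thesis .
  qed
  have "(\<lambda>z. coeff (q z) 1) \<in> hspan"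
  proof (rule hspan_coeff[where N = "Suc (a + b)" and P = "\<lambda>m z. coeff (q z) m" and m = 1])
    show "(\<lambda>z. \<Sum>m\<le>Suc (a + b). s ^ m * coeff (q z) m) \<in> hspan" for s
      using hspan_hpoly[of a b "\<alpha> + s * \<gamma>" "\<beta> + s * \<delta>"]
      by (simp only: sum_q[symmetric] poly_q)
  qed simp
  moreover have "coeff (q z) 1 = of_nat a * lin \<alpha> \<beta> z ^ (a - 1) * lin \<gamma> \<delta> z * lin' \<alpha> \<beta> z ^ b
     + of_nat b * lin \<alpha> \<beta> z ^ a * lin' \<alpha> \<beta> z ^ (b - 1) * lin' \<gamma> \<delta> z" for z
  proof -
    have "coeff (q z) 1 = poly (pderiv (q z)) 0"
      by (simp add: poly_0_coeff_0 coeff_pderiv)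
    then show ?thesis
      by (simp add: q_def pderiv_mult pderiv_power pderiv_pCons mult_ac)
  qed
  ultimately show ?thesis by simp
qed

text \<open>The difference of the two products is alternating in the coefficient pairs: it is their
  determinant, up to sign, times |z|^2, which is 1 on the sphere.\<close>

lemma lin_commutator:
  assumes "z \<in> S3"
  shows "lin \<alpha> \<beta> z * lin' \<gamma> \<delta> z = lin \<gamma> \<delta> z * lin' \<alpha> \<beta> z + (\<gamma> * \<beta> - \<alpha> * \<delta>)"
proof -
  have "(norm z)\<^sup>2 = 1" using assms by simp
  then have "(norm (fst z))\<^sup>2 + (norm (snd z))\<^sup>2 = 1"
    by (cases z) (simp add: norm_Pair)
  then have "complex_of_real ((norm (fst z))\<^sup>2 + (norm (snd z))\<^sup>2) = 1" by (simp only: of_real_1)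
  then have "fst z * cnj (fst z) + snd z * cnj (snd z) = 1"
    by (simp only: of_real_add complex_norm_square)
  then have "(\<gamma> * \<beta> - \<alpha> * \<delta>) = (\<gamma> * \<beta> - \<alpha> * \<delta>) * (fst z * cnj (fst z) + snd z * cnj (snd z))"
    by simp
  also have "\<dots> = lin \<alpha> \<beta> z * lin' \<gamma> \<delta> z - lin \<gamma> \<delta> z * lin' \<alpha> \<beta> z"
    by (simp add: lin_def lin'_def algebra_simps)
  finally show ?thesis by simp
qed

text \<open>In the polarization of \<open>hpoly (a + 1) b\<close>, the commutator turns the second
  term into b times the wanted product plus a term of lower degree. With the first term the wanted
  product occurs a + b + 1 times.\<close>

lemma hspan_lin_hpoly: "(\<lambda>z. lin \<gamma> \<delta> z * hpoly a b \<alpha> \<beta> z) \<in> hspan"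
proof -
  let ?k = "\<gamma> * \<beta> - \<alpha> * \<delta>" and ?n = "of_nat (a + b + 1) :: complex"
  have "(\<lambda>z. (1 / ?n) *
      ((of_nat (a + 1) * lin \<alpha> \<beta> z ^ (a + 1 - 1) * lin \<gamma> \<delta> z * lin' \<alpha> \<beta> z ^ b
       + of_nat b * lin \<alpha> \<beta> z ^ (a + 1) * lin' \<alpha> \<beta> z ^ (b - 1) * lin' \<gamma> \<delta> z)
      - of_nat b * ?k * hpoly a (b - 1) \<alpha> \<beta> z)) \<in> hspan"
    by (intro hspan_mult hspan_diff hspan_derivative hspan_hpoly)
  then show ?thesis
  proof (rule hspan_cong)
    fix z assume z: "z \<in> S3"
    have n: "?n \<noteq> 0" by (simp only: of_nat_eq_0_iff)
    have "of_nat b * lin \<alpha> \<beta> z ^ (a + 1) * lin' \<alpha> \<beta> z ^ (b - 1) * lin' \<gamma> \<delta> z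
        = of_nat b * lin \<alpha> \<beta> z ^ a * lin' \<alpha> \<beta> z ^ (b - 1) * (lin \<alpha> \<beta> z * lin' \<gamma> \<delta> z)"
      by simp
    also have "\<dots> = (of_nat b * lin' \<alpha> \<beta> z ^ (b - 1) * lin' \<alpha> \<beta> z) * lin \<alpha> \<beta> z ^ a * lin \<gamma> \<delta> z
        + of_nat b * ?k * hpoly a (b - 1) \<alpha> \<beta> z"
      unfolding lin_commutator[OF z, of \<alpha> \<beta> \<gamma> \<delta>] by (simp add: hpoly_def algebra_simps)
    also have "\<dots> = of_nat b * (lin \<gamma> \<delta> z * hpoly a b \<alpha> \<beta> z) + of_nat b * ?k * hpoly a (b - 1) \<alpha> \<beta> z"
      unfolding power_pred by (simp add: hpoly_def)
    finally show "(1 / ?n) *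
      ((of_nat (a + 1) * lin \<alpha> \<beta> z ^ (a + 1 - 1) * lin \<gamma> \<delta> z * lin' \<alpha> \<beta> z ^ b
       + of_nat b * lin \<alpha> \<beta> z ^ (a + 1) * lin' \<alpha> \<beta> z ^ (b - 1) * lin' \<gamma> \<delta> z)
      - of_nat b * ?k * hpoly a (b - 1) \<alpha> \<beta> z) = lin \<gamma> \<delta> z * hpoly a b \<alpha> \<beta> z"
      using n by (simp add: hpoly_def divide_eq_eq) (simp add: algebra_simps)
  qed
qed

text \<open>As before, but starting from \<open>hpoly a (b + 1)\<close> and using the commutator on
  the first term, which reverses the sign of the correction.\<close>

lemma hspan_lin'_hpoly: "(\<lambda>z. lin' \<gamma> \<delta> z * hpoly a b \<alpha> \<beta> z) \<in> hspan"
proof -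
  let ?k = "\<gamma> * \<beta> - \<alpha> * \<delta>" and ?n = "of_nat (a + b + 1) :: complex"
  have "(\<lambda>z. (1 / ?n) *
      ((of_nat a * lin \<alpha> \<beta> z ^ (a - 1) * lin \<gamma> \<delta> z * lin' \<alpha> \<beta> z ^ (b + 1)
       + of_nat (b + 1) * lin \<alpha> \<beta> z ^ a * lin' \<alpha> \<beta> z ^ (b + 1 - 1) * lin' \<gamma> \<delta> z)
      + of_nat a * ?k * hpoly (a - 1) b \<alpha> \<beta> z)) \<in> hspan"
    by (intro hspan_mult hspan_add hspan_derivative hspan_hpoly)
  then show ?thesis
  proof (rule hspan_cong)
    fix z assume z: "z \<in> S3"
    have n: "?n \<noteq> 0" by (simp only: of_nat_eq_0_iff)
    have c: "lin \<gamma> \<delta> z * lin' \<alpha> \<beta> z = lin \<alpha> \<beta> z * lin' \<gamma> \<delta> z - ?k"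
      using lin_commutator[OF z, of \<alpha> \<beta> \<gamma> \<delta>] by simp
    have "of_nat a * lin \<alpha> \<beta> z ^ (a - 1) * lin \<gamma> \<delta> z * lin' \<alpha> \<beta> z ^ (b + 1)
        = of_nat a * lin \<alpha> \<beta> z ^ (a - 1) * lin' \<alpha> \<beta> z ^ b * (lin \<gamma> \<delta> z * lin' \<alpha> \<beta> z)"
      by simp
    also have "\<dots> = (of_nat a * lin \<alpha> \<beta> z ^ (a - 1) * lin \<alpha> \<beta> z) * lin' \<alpha> \<beta> z ^ b * lin' \<gamma> \<delta> z
        - of_nat a * ?k * hpoly (a - 1) b \<alpha> \<beta> z"
      unfolding c by (simp add: hpoly_def algebra_simps)
    also have "\<dots> = of_nat a * (lin' \<gamma> \<delta> z * hpoly a b \<alpha> \<beta> z) - of_nat a * ?k * hpoly (a - 1) b \<alpha> \<beta> z"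
      unfolding power_pred by (simp add: hpoly_def)
    finally show "(1 / ?n) *
      ((of_nat a * lin \<alpha> \<beta> z ^ (a - 1) * lin \<gamma> \<delta> z * lin' \<alpha> \<beta> z ^ (b + 1)
       + of_nat (b + 1) * lin \<alpha> \<beta> z ^ a * lin' \<alpha> \<beta> z ^ (b + 1 - 1) * lin' \<gamma> \<delta> z)
      + of_nat a * ?k * hpoly (a - 1) b \<alpha> \<beta> z) = lin' \<gamma> \<delta> z * hpoly a b \<alpha> \<beta> z"
      using n by (simp add: hpoly_def divide_eq_eq) (simp add: algebra_simps)
  qed
qed

lemma hspan_lin: "f \<in> hspan \<Longrightarrow> (\<lambda>z. lin \<gamma> \<delta> z * f z) \<in> hspan"
proof (induction rule: hspan.induct)
  case (hspan_add f g)
  then show ?case using hspan.hspan_add by (simp add: distrib_left)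
next
  case (hspan_mult f x)
  then show ?case using hspan.hspan_mult[of _ x] by (simp add: mult.left_commute)
next
  case (hspan_cong f g)
  then show ?case using hspan.hspan_cong[OF hspan_cong.IH] by simp
qed (rule hspan_lin_hpoly)

lemma hspan_lin': "f \<in> hspan \<Longrightarrow> (\<lambda>z. lin' \<gamma> \<delta> z * f z) \<in> hspan"
proof (induction rule: hspan.induct)
  case (hspan_add f g)
  then show ?case using hspan.hspan_add by (simp add: distrib_left)
next
  case (hspan_mult f x)
  then show ?case using hspan.hspan_mult[of _ x] by (simp add: mult.left_commute)
next
  case (hspan_cong f g)
  then show ?case using hspan.hspan_cong[OF hspan_cong.IH] by simp
qed (rule hspan_lin'_hpoly)

lemma real_linear_as_lin:
  fixes f :: "C2 \<Rightarrow> real"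
  assumes "bounded_linear f"
  obtains \<alpha> \<beta> \<gamma> \<delta> where "\<And>z. complex_of_real (f z) = lin \<alpha> \<beta> z + lin' \<gamma> \<delta> z"
proof -
  let ?a = "f (1, 0)" and ?b = "f (\<i>, 0)" and ?c = "f (0, 1)" and ?d = "f (0, \<i>)"
  \<comment> \<open>In each coordinate x A + y B = w (A - i B)/2 + cnj w (A + i B)/2 for w = x + i
    y. The coefficients of the conjugates appear swapped, one with a sign, because
    \<open>lin'\<close> pairs \<alpha> with \<open>cnj (snd z)\<close> and - \<beta> with
    \<open>cnj (fst z)\<close>.\<close>
  have "complex_of_real (f z) = lin (Complex (?a/2) (- ?b/2)) (Complex (?c/2) (- ?d/2)) z
     + lin' (Complex (?c/2) (?d/2)) (- Complex (?a/2) (?b/2)) z" for z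
  proof -
    have l: "linear f" by (rule bounded_linear.linear[OF assms])
    have "z = Re (fst z) *\<^sub>R (1, 0) + Im (fst z) *\<^sub>R (\<i>, 0) + Re (snd z) *\<^sub>R (0, 1) + Im (snd z) *\<^sub>R (0, \<i>)"
      by (cases z) (simp add: complex_eq_iff)
    then have "f z = Re (fst z) * ?a + Im (fst z) * ?b + Re (snd z) * ?c + Im (snd z) * ?d"
      using linear_add[OF l] linear_scale[OF l] by (metis real_scaleR_def)
    then show ?thesis by (simp add: lin_def lin'_def complex_eq_iff algebra_simps)
  qed
  then show thesis by (rule that)
qed

text \<open>Phrased as stability under multiplication rather than membership, so that the product
  case of the induction is a composition.\<close>

lemma hspan_real_polynomial:
  assumes "real_polynomial_function p" "f \<in> hspan"
  shows "(\<lambda>z. complex_of_real (p z) * f z) \<in> hspan"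
  using assms
proof (induction arbitrary: f rule: real_polynomial_function.induct)
  case (linear p)
  obtain \<alpha> \<beta> \<gamma> \<delta> where "\<And>z. complex_of_real (p z) = lin \<alpha> \<beta> z + lin' \<gamma> \<delta> z"
    using real_linear_as_lin[OF linear(1)] by metis
  then show ?case
    using hspan_add[OF hspan_lin[OF linear(2)] hspan_lin'[OF linear(2)]] by (simp add: distrib_right)
next
  case (const x)
  then show ?case by (intro hspan_mult)
next
  case (add p q)
  then show ?case using hspan_add[OF add.IH] by (simp add: distrib_right)
next
  case (mult p q)
  then show ?case using mult.IH(1)[OF mult.IH(2)] by (simp add: mult.assoc)
qed

lemma hspan_dense:
  fixes f :: "C2 \<Rightarrow> complex"
  assumes "continuous_on S3 f" "e > 0"
  obtains g where "g \<in> hspan" "\<And>z. z \<in> S3 \<Longrightarrow> norm (f z - g z) < e"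
proof -
  have "continuous_on S3 (\<lambda>z. Re (f z))" "continuous_on S3 (\<lambda>z. Im (f z))"
    by (intro continuous_intros assms(1))+
  then obtain p q where p: "real_polynomial_function p" "\<And>z. z \<in> S3 \<Longrightarrow> \<bar>Re (f z) - p z\<bar> < e / 2"
    and q: "real_polynomial_function q" "\<And>z. z \<in> S3 \<Longrightarrow> \<bar>Im (f z) - q z\<bar> < e / 2"
    using Stone_Weierstrass_real_polynomial_function[OF compact_sphere, of 0 1 _ "e / 2"] assms(2)
    by (metis half_gt_zero)
  have 1: "(\<lambda>z. 1) \<in> hspan"
    by (rule hspan_cong[OF hspan_hpoly[of 0 0]]) (simp add: hpoly_def)
  have "(\<lambda>z. complex_of_real (p z) * 1 + \<i> * (complex_of_real (q z) * 1)) \<in> hspan"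
    by (intro hspan_add hspan_mult hspan_real_polynomial p q 1)
  moreover have "norm (f z - (complex_of_real (p z) * 1 + \<i> * (complex_of_real (q z) * 1))) < e" if "z \<in> S3" for z
    using cmod_le[of "f z - (complex_of_real (p z) * 1 + \<i> * (complex_of_real (q z) * 1))"]
      p(2)[OF that] q(2)[OF that] by simp
  ultimately show thesis by (rule that)
qed

section \<open>Totality of the eigenspinors and nonvanishing of each one\<close>

context spinor_mod
begin

text \<open>The map w + i c2 w is twice the projection onto the eigenspace for - i. If it vanished
  identically, c2 would be the scalar i, which cannot anticommute with the invertible c3.\<close>

lemma exists_e: obtains e :: spinor where "e \<noteq> 0" "c 2 *v e = - \<i> *s e"
proof -
  have "\<exists>w. w + \<i> *s (c 2 *v w) \<noteq> 0"
  proof (rule ccontr)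
    assume "\<not> ?thesis"
    then have "\<i> *s (w + \<i> *s (c 2 *v w)) = 0" for w by simp
    then have *: "c 2 *v w = \<i> *s w" for w
      by (simp add: smult_add)
    have "c 2 *v (c 3 *v w) = - (c 3 *v (c 2 *v w))" for w by (rule c_swap) auto
    then have "(2 * \<i>) *s (c 3 *v w) = 0" for w
      unfolding * matrix_smult by (simp add: vec_eq_iff)
    then have "c 3 *v w = 0" for w by simp
    then have "w = 0" for w :: spinor using c_square[of 3 w] by simp
    then show False using zero_neq_one by metis
  qed
  then obtain w where w: "w + \<i> *s (c 2 *v w) \<noteq> 0" by blast
  have "c 2 *v (w + \<i> *s (c 2 *v w)) = - \<i> *s (w + \<i> *s (c 2 *v w))"
    by (simp add: matrix_vector_right_distrib matrix_smult c_square smult_add)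
  then show thesis using w that by blast
qed

lemma eigspan_hpoly: "(\<lambda>z. hpoly a b \<alpha> \<beta> z *s w) \<in> eigspan"
proof -
  define e1 where "e1 = (1/2) *s (w + \<i> *s (c 2 *v w))"
  define e2 where "e2 = (1/2) *s (w - \<i> *s (c 2 *v w))"
  have 1: "c 2 *v e1 = - \<i> *s e1"
    by (simp add: e1_def matrix_vector_right_distrib matrix_smult c_square smult_add mult.commute)
  have 2: "c 2 *v e2 = \<i> *s e2"
    by (simp add: e2_def matrix_diff matrix_smult c_square smult_diff mult.commute smult_add)
  have 3: "c 2 *v (c 3 *v e2) = - \<i> *s (c 3 *v e2)"
    using c_swap[of 2 3 e2] by (simp add: 2 matrix_smult)
  \<comment> \<open>The component in the eigenspace for i is the partner of
    \<open>c 3 *v e2\<close>, which lies in the eigenspace for - i; so the results for the pair e,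
    \<open>e'\<close> apply to it.\<close>
  have "e' (c 3 *v e2) = e2" by (simp add: e'_def[OF 3] c_square)
  then have "(\<lambda>z. hpoly a b \<alpha> \<beta> z *s e1 + hpoly a b \<alpha> \<beta> z *s e2) \<in> eigspan"
    using eigspan_add[OF eigspan_hpoly_e[OF 1] eigspan_hpoly_e'[OF 3]] by simp
  moreover have "w = e1 + e2" by (simp add: e1_def e2_def vec_eq_iff)
  ultimately show ?thesis by (simp add: smult_add)
qed

lemma eigspan_hspan: "f \<in> hspan \<Longrightarrow> (\<lambda>z. f z *s w) \<in> eigspan"
proof (induction rule: hspan.induct)
  case (hspan_add f g)
  then show ?case using eigspan_add by (simp add: smult_add_left)
next
  case (hspan_mult f x)
  then show ?case using eigspan_smult[OF hspan_mult.IH, of x] by simp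
next
  case (hspan_cong f g)
  then show ?case using eigspan_cong[OF hspan_cong.IH] by simp
qed (rule eigspan_hpoly)

lemma eigspan_dense:
  fixes f :: "C2 \<Rightarrow> spinor"
  assumes "continuous_on S3 f" "r > 0"
  obtains v where "v \<in> eigspan" "\<And>z. z \<in> S3 \<Longrightarrow> norm (f z - v z) < r"
proof -
  have "continuous_on S3 (\<lambda>z. f z $ i)" for i by (intro continuous_intros assms(1))
  then have "\<exists>g. g \<in> hspan \<and> (\<forall>z\<in>S3. norm (f z $ i - g z) < r / 2)" for i
    using hspan_dense[of "\<lambda>z. f z $ i" "r / 2"] assms(2) by (metis half_gt_zero)
  then obtain g where g: "\<And>i. g i \<in> hspan" "\<And>i z. z \<in> S3 \<Longrightarrow> norm (f z $ i - g i z) < r / 2"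
    by metis
  define v where "v z = g 1 z *s axis 1 1 + g 2 z *s (axis 2 1 :: spinor)" for z
  have "norm (f z - v z) < r" if z: "z \<in> S3" for z
  proof -
    have "f z - v z = (f z $ 1 - g 1 z) *s axis 1 1 + (f z $ 2 - g 2 z) *s axis 2 1"
      by (simp add: v_def vec_eq_iff forall_2 axis_def)
    then have "norm (f z - v z) \<le> norm ((f z $ 1 - g 1 z) *s axis 1 1 :: spinor) + norm ((f z $ 2 - g 2 z) *s axis 2 1 :: spinor)"
      by (simp only: norm_triangle_ineq)
    also have "\<dots> = norm (f z $ 1 - g 1 z) + norm (f z $ 2 - g 2 z)"
      unfolding norm_smult by (simp add: norm_vec_def L2_set_def sum_2 axis_def)
    also have "\<dots> < r" using g(2)[OF z, of 1] g(2)[OF z, of 2] by simp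
    finally show ?thesis .
  qed
  moreover have "v \<in> eigspan" unfolding v_def by (intro eigspan_add eigspan_hspan g)
  ultimately show thesis by (rule that[rotated])
qed

text \<open>Explicit eigenspinors are evaluated at one point where they cannot vanish.\<close>

lemma eigenvalue_attained:
  assumes "l \<in> eigvals t"
  obtains f z where "eigen l f" "z \<in> S3" "f z \<noteq> 0"
proof -
  obtain e where e: "e \<noteq> 0" "c 2 *v e = - \<i> *s e" by (rule exists_e)
  have e': "e' e \<noteq> 0" using c_e(4)[OF e(2)] e(1) by auto
  let ?z = "(3/5, 4/5) :: C2"
  have mixed: "\<exists>f. eigen (1/2 + R) f \<and> f ?z \<noteq> 0"
    if R: "R\<^sup>2 = (1 + t + 2 * real p - real k)\<^sup>2 + 4 * (real k - real p) * (real p + 1)" and pk: "p < k" for R p k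
  proof (intro exI conjI)
    define A where "A = 1 + t + real p - real (k - p)"
    have kp: "real k - real p = real (k - p)" and "1 + t + 2 * real p - real k = A"
      using pk by (simp_all add: A_def of_nat_diff)
    then have "R\<^sup>2 = A\<^sup>2 + 4 * real (k - p) * (real p + 1)"
      using R by (simp only:)
    then show "eigen (1/2 + R) (mixed e A R p (k - p) 1 0)"
      using pk by (intro eigen_mixed[OF e(2)]) (auto simp: A_def)
    \<comment> \<open>The component along e could vanish when A + R = 0, but the one along
      \<open>e'\<close> carries the factor k - p > 0.\<close>
    show "mixed e A R p (k - p) 1 0 ?z \<noteq> 0"
    proof
      assume "mixed e A R p (k - p) 1 0 ?z = 0"
      then have "(of_real (A + R) * hpoly p (k - p) 1 0 ?z) *s e
          + (2 * \<i> * of_nat (k - p) * hpoly (p + 1) (k - p - 1) 1 0 ?z) *s e' e = 0"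
        by (simp add: mixed_def[OF e(2)])
      from e_independent[OF e(2) this e(1)] show False
        using pk hpoly_point by simp
    qed
  qed
  from assms consider k where "l = 3/2 + t + real k" | k where "l = 3/2 - t + real k"
    | R p k where "p < k" "l = 1/2 + R" "R\<^sup>2 = (1 + t + 2 * real p - real k)\<^sup>2 + 4 * (real k - real p) * (real p + 1)"
  proof -
    have sq: "(sqrt ((1 + t + 2 * real p - real k)\<^sup>2 + 4 * (real k - real p) * (real p + 1)))\<^sup>2
        = (1 + t + 2 * real p - real k)\<^sup>2 + 4 * (real k - real p) * (real p + 1)" if "p < k" for p k
      using that by simp
    assume *: "\<And>k. l = 3/2 + t + real k \<Longrightarrow> thesis" "\<And>k. l = 3/2 - t + real k \<Longrightarrow> thesis"
      "\<And>p k R. p < k \<Longrightarrow> l = 1/2 + R \<Longrightarrow> R\<^sup>2 = (1 + t + 2 * real p - real k)\<^sup>2 + 4 * (real k - real p) * (real p + 1) \<Longrightarrow> thesis"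
    from assms show thesis
      unfolding eigvals_def
    proof (elim UnE CollectE exE conjE)
      fix p k :: nat
      assume "l = 1/2 - sqrt ((1 + t + 2 * real p - real k)\<^sup>2 + 4 * (real k - real p) * (real p + 1))" "p < k"
      then show thesis
        using *(3)[of p k "- sqrt ((1 + t + 2 * real p - real k)\<^sup>2 + 4 * (real k - real p) * (real p + 1))"] sq by simp
    qed (use * sq in blast)+
  qed
  then have "\<exists>f. eigen l f \<and> f ?z \<noteq> 0"
  proof cases
    case (1 k)
    then show ?thesis
      using eigen_holomorphic[OF e(2), of k 1 0] hpoly_point[of k 0] e(1) by (auto intro!: exI)
  next
    case (2 k)
    then show ?thesis
      using eigen_antiholomorphic[OF e(2), of k 1 0] hpoly_point[of 0 k] e' by (auto intro!: exI)
  next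
    case (3 R p k)
    then show ?thesis using mixed by blast
  qed
  then show thesis using that point_in_S3 by blast
qed

end

section \<open>Square-integrable spinors\<close>

lemma L2I:
  assumes "f \<in> borel_measurable S3_measure" "integrable S3_measure g" "\<And>z. z \<in> S3 \<Longrightarrow> (norm (f z))\<^sup>2 \<le> g z"
  shows "f \<in> L2_spinors"
proof -
  have "integrable S3_measure (\<lambda>z. (norm (f z))\<^sup>2)"
  proof (rule Bochner_Integration.integrable_bound[OF assms(2)])
    show "(\<lambda>z. (norm (f z))\<^sup>2) \<in> borel_measurable S3_measure" using assms(1) by measurable
    show "AE z in S3_measure. norm ((norm (f z))\<^sup>2) \<le> norm (g z)"
    proof (rule AE_I2)
      fix z assume "z \<in> space S3_measure"
      then show "norm ((norm (f z))\<^sup>2) \<le> norm (g z)"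
        using assms(3)[of z] by simp
    qed
  qed
  then show ?thesis using assms(1) by (simp add: L2_spinors_def)
qed

lemma L2D:
  assumes "f \<in> L2_spinors"
  shows "f \<in> borel_measurable S3_measure" "integrable S3_measure (\<lambda>z. (norm (f z))\<^sup>2)"
  using assms by (auto simp: L2_spinors_def)

lemma L2_continuous: "continuous_on S3 f \<Longrightarrow> f \<in> L2_spinors"
  by (auto simp: L2_spinors_def intro!: borel_measurable_S3 integrable_S3 continuous_intros)

lemma borel_measurable_smult:
  "f \<in> borel_measurable M \<Longrightarrow> (\<lambda>z. a *s (f z :: spinor)) \<in> borel_measurable M"
  using borel_measurable_continuous_on[OF bounded_linear.continuous_on[OF bounded_linear_smult_right continuous_on_id]] .

lemma L2_smult:
  assumes "f \<in> L2_spinors" shows "(\<lambda>z. a *s f z) \<in> L2_spinors"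
  by (rule L2I[OF borel_measurable_smult[OF L2D(1)[OF assms]] integrable_mult_right[OF L2D(2)[OF assms]]])
    (auto simp: norm_smult power_mult_distrib)

lemma norm_add_square_le: "(norm (x + y))\<^sup>2 \<le> 2 * (norm x)\<^sup>2 + 2 * (norm (y::'a::real_normed_vector))\<^sup>2"
proof -
  have "(norm (x + y))\<^sup>2 \<le> (norm x + norm y)\<^sup>2"
    by (intro power_mono norm_triangle_ineq) auto
  also have "\<dots> \<le> 2 * (norm x)\<^sup>2 + 2 * (norm y)\<^sup>2"
    using sum_squares_bound[of "norm x" "norm y"] by (simp add: power2_sum)
  finally show ?thesis .
qed

lemma L2_add:
  assumes "f \<in> L2_spinors" "g \<in> L2_spinors" shows "(\<lambda>z. f z + g z) \<in> L2_spinors"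
proof (rule L2I)
  show "(\<lambda>z. f z + g z) \<in> borel_measurable S3_measure"
    using L2D(1)[OF assms(1)] L2D(1)[OF assms(2)] by measurable
  show "integrable S3_measure (\<lambda>z. 2 * (norm (f z))\<^sup>2 + 2 * (norm (g z))\<^sup>2)"
    using L2D(2)[OF assms(1)] L2D(2)[OF assms(2)] by simp
qed (rule norm_add_square_le)

lemma L2_diff:
  assumes "f \<in> L2_spinors" "g \<in> L2_spinors" shows "(\<lambda>z. f z - g z) \<in> L2_spinors"
proof -
  have "(\<lambda>z. f z + (- 1) *s g z) \<in> L2_spinors"
    by (intro L2_add L2_smult assms)
  moreover have "f z + (- 1) *s g z = f z - g z" for z by (simp add: vec_eq_iff)
  ultimately show ?thesis by simp
qed

lemma L2norm_cong: "(\<And>z. z \<in> S3 \<Longrightarrow> f z = g z) \<Longrightarrow> L2norm f = L2norm g"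
  unfolding L2norm_def by (intro arg_cong[where f = sqrt] Bochner_Integration.integral_cong) auto

lemma L2_cong:
  assumes "f \<in> L2_spinors" "\<And>z. z \<in> S3 \<Longrightarrow> f z = g z"
  shows "g \<in> L2_spinors"
proof (rule L2I[OF _ L2D(2)[OF assms(1)]])
  show "g \<in> borel_measurable S3_measure"
    by (rule measurable_cong[THEN iffD1, OF _ L2D(1)[OF assms(1)]]) (simp only: space_S3_measure assms(2))
qed (simp only: assms(2))

lemma L2norm_nonneg: "L2norm f \<ge> 0"
  by (simp add: L2norm_def)

lemma L2norm_square: "(L2norm f)\<^sup>2 = integral\<^sup>L S3_measure (\<lambda>z. (norm (f z))\<^sup>2)"
  by (simp add: L2norm_def)

lemma L2norm_smult: "L2norm (\<lambda>z. a *s f z) = norm a * L2norm f"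
  by (simp add: L2norm_def norm_smult power_mult_distrib real_sqrt_mult)

lemma L2norm_minus_commute: "L2norm (\<lambda>z. f z - g z) = L2norm (\<lambda>z. g z - f z)"
  by (simp add: L2norm_def norm_minus_commute)

lemma L2norm_0: "L2norm (\<lambda>z. 0) = 0"
  by (simp add: L2norm_def)

lemma L2_norm_mult:
  assumes "f \<in> L2_spinors" "g \<in> L2_spinors"
  shows "integrable S3_measure (\<lambda>z. norm (f z) * norm (g z))" (is ?int)
    and "integral\<^sup>L S3_measure (\<lambda>z. norm (f z) * norm (g z)) \<le> L2norm f * L2norm g"
proof -
  note [measurable] = L2D(1)[OF assms(1)] L2D(1)[OF assms(2)]
  show i: ?int
  proof (rule Bochner_Integration.integrable_bound)
    show "integrable S3_measure (\<lambda>z. (norm (f z))\<^sup>2 + (norm (g z))\<^sup>2)"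
      using L2D(2)[OF assms(1)] L2D(2)[OF assms(2)] by simp
    have "norm (f z) * norm (g z) \<le> (norm (f z))\<^sup>2 + (norm (g z))\<^sup>2" for z
    proof -
      have "2 * (norm (f z) * norm (g z)) \<le> (norm (f z))\<^sup>2 + (norm (g z))\<^sup>2"
        using sum_squares_bound[of "norm (f z)" "norm (g z)"] by simp
      moreover have "0 \<le> norm (f z) * norm (g z)" by simp
      ultimately show ?thesis by linarith
    qed
    then show "AE z in S3_measure. norm (norm (f z) * norm (g z)) \<le> norm ((norm (f z))\<^sup>2 + (norm (g z))\<^sup>2)"
      by simp
  qed measurable
  let ?I = "integral\<^sup>L S3_measure (\<lambda>z. norm (f z) * norm (g z))"
  have "(\<integral>\<^sup>+z. ennreal (norm (f z)) * ennreal (norm (g z)) \<partial>S3_measure)\<^sup>2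
      \<le> (\<integral>\<^sup>+z. (ennreal (norm (f z)))\<^sup>2 \<partial>S3_measure) * (\<integral>\<^sup>+z. (ennreal (norm (g z)))\<^sup>2 \<partial>S3_measure)"
    by (rule Cauchy_Schwarz_nn_integral) auto
  then have "(ennreal ?I)\<^sup>2 \<le> ennreal ((L2norm f)\<^sup>2) * ennreal ((L2norm g)\<^sup>2)"
    using i L2D(2)[OF assms(1)] L2D(2)[OF assms(2)]
    by (simp add: ennreal_mult[symmetric] ennreal_power nn_integral_eq_integral L2norm_square)
  then have "?I\<^sup>2 \<le> (L2norm f * L2norm g)\<^sup>2"
    by (simp add: ennreal_mult[symmetric] ennreal_power power_mult_distrib)
  then show "?I \<le> L2norm f * L2norm g"
    by (rule power2_le_imp_le) (simp add: L2norm_nonneg)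
qed

lemma L2norm_triangle:
  assumes "f \<in> L2_spinors" "g \<in> L2_spinors"
  shows "L2norm (\<lambda>z. f z + g z) \<le> L2norm f + L2norm g"
proof (rule power2_le_imp_le)
  have "(L2norm (\<lambda>z. f z + g z))\<^sup>2 \<le> integral\<^sup>L S3_measure
      (\<lambda>z. (norm (f z))\<^sup>2 + (norm (g z))\<^sup>2 + 2 * (norm (f z) * norm (g z)))"
    unfolding L2norm_square
  proof (rule integral_mono)
    show "integrable S3_measure (\<lambda>z. (norm (f z))\<^sup>2 + (norm (g z))\<^sup>2 + 2 * (norm (f z) * norm (g z)))"
      using assms by (intro Bochner_Integration.integrable_add integrable_mult_right L2D L2_norm_mult)
    show "(norm (f z + g z))\<^sup>2 \<le> (norm (f z))\<^sup>2 + (norm (g z))\<^sup>2 + 2 * (norm (f z) * norm (g z))" for z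
      using power_mono[OF norm_triangle_ineq[of "f z" "g z"], of 2] by (simp add: power2_sum)
  qed (rule L2D(2)[OF L2_add[OF assms]])
  also have "\<dots> = (L2norm f)\<^sup>2 + (L2norm g)\<^sup>2 + 2 * integral\<^sup>L S3_measure (\<lambda>z. norm (f z) * norm (g z))"
    using assms L2_norm_mult(1)[OF assms] by (simp add: L2D L2norm_square)
  also have "\<dots> \<le> (L2norm f + L2norm g)\<^sup>2"
    using L2_norm_mult(2)[OF assms] by (simp add: power2_sum)
  finally show "(L2norm (\<lambda>z. f z + g z))\<^sup>2 \<le> (L2norm f + L2norm g)\<^sup>2" .
qed (simp add: L2norm_nonneg)

lemma L2norm_triangle_diff:
  assumes "f \<in> L2_spinors" "g \<in> L2_spinors" "h \<in> L2_spinors"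
  shows "L2norm (\<lambda>z. f z - h z) \<le> L2norm (\<lambda>z. f z - g z) + L2norm (\<lambda>z. g z - h z)"
  using L2norm_triangle[OF L2_diff[OF assms(1,2)] L2_diff[OF assms(2,3)]] by simp

lemma L2norm_le_add:
  assumes "f \<in> L2_spinors" "g \<in> L2_spinors"
  shows "L2norm f \<le> L2norm g + L2norm (\<lambda>z. f z - g z)"
  using L2norm_triangle[OF assms(2) L2_diff[OF assms]] by simp

lemma L2norm_tendsto:
  assumes "\<And>n. f n \<in> L2_spinors" "g \<in> L2_spinors" "(\<lambda>n. L2norm (\<lambda>z. f n z - g z)) \<longlonglongrightarrow> 0"
  shows "(\<lambda>n. L2norm (f n)) \<longlonglongrightarrow> L2norm g"
proof -
  have "\<bar>L2norm (f n) - L2norm g\<bar> \<le> L2norm (\<lambda>z. f n z - g z)" for n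
    using L2norm_le_add[OF assms(1)[of n] assms(2)] L2norm_le_add[OF assms(2) assms(1)[of n]]
      L2norm_minus_commute[of g "f n"] by simp
  then have "(\<lambda>n. L2norm (f n) - L2norm g) \<longlonglongrightarrow> 0"
    by (intro Lim_null_comparison[OF _ assms(3)]) auto
  then show ?thesis by (simp add: LIM_zero_iff)
qed

lemma L2norm_bound:
  assumes "\<And>z. z \<in> S3 \<Longrightarrow> norm (f z) \<le> r" "f \<in> L2_spinors" "r \<ge> 0"
  shows "L2norm f \<le> r * sqrt (measure S3_measure S3)"
proof -
  have "(L2norm f)\<^sup>2 \<le> integral\<^sup>L S3_measure (\<lambda>z. r\<^sup>2)"
    unfolding L2norm_square using assms by (intro integral_mono L2D) (auto intro: power_mono)
  also have "\<dots> = (r * sqrt (measure S3_measure S3))\<^sup>2"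
    by (simp add: power_mult_distrib mult.commute)
  finally show ?thesis by (rule power2_le_imp_le) (use assms in simp)
qed

lemma L2_dominated_convergence:
  assumes "\<And>n. f n \<in> borel_measurable S3_measure" "h \<in> borel_measurable S3_measure"
    and "\<And>z. z \<in> S3 \<Longrightarrow> (\<lambda>n. f n z) \<longlonglongrightarrow> h z"
    and "integrable S3_measure (\<lambda>z. (g z)\<^sup>2)" "\<And>n z. z \<in> S3 \<Longrightarrow> norm (f n z - h z) \<le> g z"
  shows "(\<lambda>n. L2norm (\<lambda>z. f n z - h z)) \<longlonglongrightarrow> 0"
proof -
  note [measurable] = assms(1,2)
  have "(\<lambda>n. integral\<^sup>L S3_measure (\<lambda>z. (norm (f n z - h z))\<^sup>2)) \<longlonglongrightarrow> integral\<^sup>L S3_measure (\<lambda>z. 0)"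
  proof (rule integral_dominated_convergence[OF _ _ assms(4)])
    show "AE z in S3_measure. (\<lambda>n. (norm (f n z - h z))\<^sup>2) \<longlonglongrightarrow> 0"
    proof (rule AE_I2)
      fix z assume "z \<in> space S3_measure"
      then have "(\<lambda>n. norm (f n z - h z)) \<longlonglongrightarrow> 0"
        using assms(3)[of z] by (simp add: tendsto_norm_zero LIM_zero)
      from tendsto_power[OF this, of 2] show "(\<lambda>n. (norm (f n z - h z))\<^sup>2) \<longlonglongrightarrow> 0" by simp
    qed
    show "AE z in S3_measure. norm ((norm (f n z - h z))\<^sup>2) \<le> (g z)\<^sup>2" for n
      using assms(5) by (intro AE_I2) (auto intro: power_mono)
  qed auto
  from tendsto_real_sqrt[OF this] show ?thesis by (simp add: L2norm_def)
qed

subsection \<open>Density of the continuous spinors\<close>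

text \<open>The L2-closure of the continuous spinors. It is enlarged from indicators of closed sets
  to Borel sets, then to nonnegative functions and finally to all of L2.\<close>

definition L2_limits :: "(C2 \<Rightarrow> spinor) set" where
  "L2_limits = {f \<in> L2_spinors. \<forall>r>0. \<exists>g. continuous_on S3 g \<and> L2norm (\<lambda>z. f z - g z) < r}"

lemma L2_limitsD: "f \<in> L2_limits \<Longrightarrow> f \<in> L2_spinors"
  by (simp add: L2_limits_def)

lemma L2_limitsE:
  assumes "f \<in> L2_limits" "r > 0"
  obtains g where "continuous_on S3 g" "L2norm (\<lambda>z. f z - g z) < r"
  using assms unfolding L2_limits_def by blast

lemma L2_limits_continuous: "continuous_on S3 f \<Longrightarrow> f \<in> L2_limits"
  unfolding L2_limits_def by (auto simp: L2_continuous L2norm_0 intro!: exI[of _ f])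

lemma L2_limits_cong:
  assumes "f \<in> L2_limits" "\<And>z. z \<in> S3 \<Longrightarrow> f z = g z" shows "g \<in> L2_limits"
proof -
  have "L2norm (\<lambda>z. g z - h z) = L2norm (\<lambda>z. f z - h z)" for h
    by (rule L2norm_cong) (simp add: assms(2))
  then show ?thesis using assms L2_cong[of f g] by (auto simp: L2_limits_def)
qed

lemma L2_limits_closed:
  assumes "\<And>n. f n \<in> L2_limits" "h \<in> L2_spinors" "(\<lambda>n. L2norm (\<lambda>z. f n z - h z)) \<longlonglongrightarrow> 0"
  shows "h \<in> L2_limits"
  unfolding L2_limits_def
proof (intro CollectI conjI allI impI)
  fix r :: real assume r: "r > 0"
  then have "\<forall>\<^sub>F n in sequentially. L2norm (\<lambda>z. f n z - h z) < r / 2"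
    by (intro order_tendstoD(2)[OF assms(3)]) simp
  from eventually_happens'[OF sequentially_bot this]
  obtain n where n: "L2norm (\<lambda>z. f n z - h z) < r / 2" by (rule exE)
  obtain g where g: "continuous_on S3 g" "L2norm (\<lambda>z. f n z - g z) < r / 2"
    by (rule L2_limitsE[OF assms(1)[of n] half_gt_zero[OF r]])
  have "L2norm (\<lambda>z. h z - g z) < r"
    using L2norm_triangle_diff[OF assms(2) L2_limitsD[OF assms(1)[of n]] L2_continuous[OF g(1)]] g(2) n
      L2norm_minus_commute[of h "f n"] by simp
  then show "\<exists>g. continuous_on S3 g \<and> L2norm (\<lambda>z. h z - g z) < r" using g(1) by blast
qed (rule assms(2))

lemma L2_limits_add:
  assumes "f \<in> L2_limits" "g \<in> L2_limits" shows "(\<lambda>z. f z + g z) \<in> L2_limits"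
  unfolding L2_limits_def
proof (intro CollectI conjI allI impI)
  fix r :: real assume r: "r > 0"
  obtain u where u: "continuous_on S3 u" "L2norm (\<lambda>z. f z - u z) < r / 2"
    by (rule L2_limitsE[OF assms(1) half_gt_zero[OF r]])
  obtain v where v: "continuous_on S3 v" "L2norm (\<lambda>z. g z - v z) < r / 2"
    by (rule L2_limitsE[OF assms(2) half_gt_zero[OF r]])
  have "L2norm (\<lambda>z. f z + g z - (u z + v z)) = L2norm (\<lambda>z. (f z - u z) + (g z - v z))"
    by (rule L2norm_cong) simp
  also have "\<dots> \<le> L2norm (\<lambda>z. f z - u z) + L2norm (\<lambda>z. g z - v z)"
    by (intro L2norm_triangle L2_diff L2_limitsD assms L2_continuous u v)
  also have "\<dots> < r" using u v by simp
  finally show "\<exists>h. continuous_on S3 h \<and> L2norm (\<lambda>z. f z + g z - h z) < r"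
    using u v by (intro exI[of _ "\<lambda>z. u z + v z"]) (auto intro: continuous_intros)
qed (intro L2_add L2_limitsD assms)

lemma L2_limits_smult:
  assumes "f \<in> L2_limits" shows "(\<lambda>z. a *s f z) \<in> L2_limits"
  unfolding L2_limits_def
proof (intro CollectI conjI allI impI)
  fix r :: real assume r: "r > 0"
  then have ra: "r / (norm a + 1) > 0" by (simp add: add_nonneg_pos)
  obtain u where u: "continuous_on S3 u" "L2norm (\<lambda>z. f z - u z) < r / (norm a + 1)"
    by (rule L2_limitsE[OF assms ra])
  have "L2norm (\<lambda>z. a *s f z - a *s u z) = norm a * L2norm (\<lambda>z. f z - u z)"
    by (simp only: smult_diff[symmetric] L2norm_smult)
  also have "\<dots> \<le> (norm a + 1) * L2norm (\<lambda>z. f z - u z)"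
    by (intro mult_right_mono L2norm_nonneg) simp
  also have "\<dots> < r" using u(2) by (simp add: pos_less_divide_eq mult.commute add_nonneg_pos)
  finally show "\<exists>h. continuous_on S3 h \<and> L2norm (\<lambda>z. a *s f z - h z) < r"
    using bounded_linear.continuous_on[OF bounded_linear_smult_right u(1)] by blast
qed (intro L2_smult L2_limitsD assms)

lemma L2_limits_diff:
  assumes "f \<in> L2_limits" "g \<in> L2_limits" shows "(\<lambda>z. f z - g z) \<in> L2_limits"
proof -
  have "(\<lambda>z. f z + (- 1) *s g z) \<in> L2_limits"
    by (intro L2_limits_add L2_limits_smult assms)
  then show ?thesis by (rule L2_limits_cong) (simp add: vec_eq_iff)
qed

lemma borel_measurable_smult_left:
  "f \<in> borel_measurable M \<Longrightarrow> (\<lambda>z. f z *s (w :: spinor)) \<in> borel_measurable M"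
  using borel_measurable_continuous_on[OF bounded_linear.continuous_on[OF bounded_linear_smult_left continuous_on_id]] .

lemma borel_measurable_of_real_smult:
  assumes "u \<in> borel_measurable M" shows "(\<lambda>z. complex_of_real (u z) *s (w :: spinor)) \<in> borel_measurable M"
  using assms by (intro borel_measurable_smult_left) simp

lemma L2_of_real_smult:
  assumes "u \<in> borel_measurable S3_measure" "integrable S3_measure (\<lambda>z. (u z)\<^sup>2)"
  shows "(\<lambda>z. complex_of_real (u z) *s w) \<in> L2_spinors"
  by (rule L2I[OF borel_measurable_of_real_smult[OF assms(1)] integrable_mult_left[OF assms(2), of "(norm w)\<^sup>2"]])
    (simp add: norm_smult power_mult_distrib)

text \<open>The one limit passage behind closed sets, countable disjoint unions and increasing
  sequences alike. The bound g on the approximants is inherited by the limit, so 2 |w| g dominates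
  the difference.\<close>

lemma L2_limits_of_real_limit:
  assumes "\<And>n. (\<lambda>z. complex_of_real (f n z) *s w) \<in> L2_limits" "\<And>n. f n \<in> borel_measurable S3_measure"
    and "\<And>z. z \<in> S3 \<Longrightarrow> (\<lambda>n. f n z) \<longlonglongrightarrow> h z"
    and "integrable S3_measure (\<lambda>z. (g z)\<^sup>2)" "\<And>n z. z \<in> S3 \<Longrightarrow> \<bar>f n z\<bar> \<le> g z"
  shows "(\<lambda>z. complex_of_real (h z) *s w) \<in> L2_limits"
proof (rule L2_limits_closed[OF assms(1)])
  have hm: "h \<in> borel_measurable S3_measure"
    by (rule borel_measurable_LIMSEQ_real[OF _ assms(2)]) (use assms(3) in auto)
  have hg: "\<bar>h z\<bar> \<le> g z" if "z \<in> S3" for z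
    by (rule LIMSEQ_le_const2[OF tendsto_rabs[OF assms(3)[OF that]]]) (use assms(5) that in auto)
  have h2: "integrable S3_measure (\<lambda>z. (h z)\<^sup>2)"
  proof (rule Bochner_Integration.integrable_bound[OF assms(4)])
    show "(\<lambda>z. (h z)\<^sup>2) \<in> borel_measurable S3_measure" using hm by measurable
    show "AE z in S3_measure. norm ((h z)\<^sup>2) \<le> norm ((g z)\<^sup>2)"
      using hg by (intro AE_I2) (auto simp: abs_le_square_iff[symmetric] intro: order_trans[OF _ abs_ge_self])
  qed
  show "(\<lambda>z. complex_of_real (h z) *s w) \<in> L2_spinors"
    by (rule L2_of_real_smult[OF hm h2])
  show "(\<lambda>n. L2norm (\<lambda>z. complex_of_real (f n z) *s w - complex_of_real (h z) *s w)) \<longlonglongrightarrow> 0"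
  proof (rule L2_dominated_convergence[where g = "\<lambda>z. 2 * norm w * g z"])
    show "(\<lambda>n. complex_of_real (f n z) *s w) \<longlonglongrightarrow> complex_of_real (h z) *s w" if "z \<in> S3" for z
      by (intro bounded_linear.tendsto[OF bounded_linear_smult_left] tendsto_of_real assms(3) that)
    show "integrable S3_measure (\<lambda>z. (2 * norm w * g z)\<^sup>2)"
      using assms(4) by (simp add: power_mult_distrib)
    show "norm (complex_of_real (f n z) *s w - complex_of_real (h z) *s w) \<le> 2 * norm w * g z" if "z \<in> S3" for n z
    proof -
      have "norm (complex_of_real (f n z) *s w - complex_of_real (h z) *s w)
          \<le> norm (complex_of_real (f n z) *s w) + norm (complex_of_real (h z) *s w)"
        by (rule norm_triangle_ineq4)
      also have "\<dots> = (\<bar>f n z\<bar> + \<bar>h z\<bar>) * norm w" by (simp add: norm_smult algebra_simps)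
      also have "\<dots> \<le> (g z + g z) * norm w"
        by (intro mult_right_mono add_mono assms(5) hg that) auto
      finally show ?thesis by (simp add: algebra_simps)
    qed
  qed (intro borel_measurable_of_real_smult assms(2) hm)+
qed

lemma L2_limits_indicator_closed:
  assumes "closed A"
  shows "(\<lambda>z. complex_of_real (indicator A z) *s w) \<in> L2_limits"
\<comment> \<open>By convention \<open>infdist\<close> to the empty set is 0, so the approximation
  by distances below would converge to 1 instead of 0.\<close>
proof (cases "A = {}")
  case True
  then show ?thesis by (simp add: L2_limits_continuous)
next
  case False
  define f where "f n z = max 0 (1 - real n * infdist z A)" for n :: nat and z :: C2
  have cf: "continuous_on S3 (f n)" for n
    unfolding f_def by (intro continuous_intros)
  show ?thesis
  proof (rule L2_limits_of_real_limit[where f = f and g = "\<lambda>_. 1"])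
    show "(\<lambda>z. complex_of_real (f n z) *s w) \<in> L2_limits" for n
      by (intro L2_limits_continuous bounded_linear.continuous_on[OF bounded_linear_smult_left]
          continuous_on_of_real cf)
    show "(\<lambda>n. f n z) \<longlonglongrightarrow> indicator A z" for z
    proof (cases "z \<in> A")
      case True
      then show ?thesis by (simp add: f_def)
    next
      case z: False
      then have d: "infdist z A > 0"
        using in_closed_iff_infdist_zero[OF assms False, of z] infdist_nonneg[of z A] by linarith
      obtain N where N: "real N * infdist z A > 1"
        using reals_Archimedean3[OF d] by blast
      have "f n z = 0" if "n \<ge> N" for n
      proof -
        have "real N * infdist z A \<le> real n * infdist z A"
          using that d by (intro mult_right_mono) auto
        then show ?thesis using N by (simp add: f_def)
      qed
      then show ?thesis using z by (intro tendsto_eventually eventually_sequentiallyI[of N], simp)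
    qed
    show "\<bar>f n z\<bar> \<le> 1" for n z
      using infdist_nonneg[of z A] by (simp add: f_def)
  qed (auto intro: borel_measurable_S3 cf)
qed

text \<open>Dynkin's argument from closed sets, which are stable under intersection and generate the
  Borel sets. Partial sums over disjoint sets are again indicators, hence bounded by 1.\<close>

lemma L2_limits_indicator:
  assumes "A \<in> sets borel"
  shows "(\<lambda>z. complex_of_real (indicator A z) *s w) \<in> L2_limits"
proof -
  have "Int_stable (Collect closed)" "Collect closed \<subseteq> Pow UNIV" "A \<in> sigma_sets UNIV (Collect closed)"
    using assms by (auto simp: Int_stable_def borel_eq_closed)
  then show ?thesis
  proof (induction rule: sigma_sets_induct_disjoint)
    case (basic A)
    then show ?case by (simp add: L2_limits_indicator_closed)
  next
    case empty
    then show ?case by (simp add: L2_limits_continuous)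
  next
    case (compl A)
    have "(\<lambda>z. w - complex_of_real (indicator A z) *s w) \<in> L2_limits"
      by (intro L2_limits_diff compl L2_limits_continuous continuous_on_const)
    then show ?case
      by (rule L2_limits_cong) (auto simp: indicator_def)
  next
    case (union A)
    have m: "A i \<in> sets borel" for i using union(2) by (auto simp: borel_eq_closed)
    have mS: "(indicator (A i) :: C2 \<Rightarrow> real) \<in> borel_measurable S3_measure" for i
    proof -
      have "(indicator (A i) :: C2 \<Rightarrow> real) \<in> borel_measurable (restrict_space borel S3)"
        using m[of i] by (intro measurable_restrict_space1) simp
      then show ?thesis using measurable_cong_sets[OF sets_S3_measure refl] by blast
    qed
    show ?case
    proof (rule L2_limits_of_real_limit[where f = "\<lambda>n z. \<Sum>i<n. indicator (A i) z" and g = "\<lambda>_. 1"])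
      show "(\<lambda>z. complex_of_real (\<Sum>i<n. indicator (A i) z) *s w) \<in> L2_limits" for n
      proof (induction n)
        case 0
        then show ?case by (simp add: L2_limits_continuous)
      next
        case (Suc n)
        then show ?case
          using L2_limits_add[OF Suc union(3)[of n]] by (simp add: smult_add_left)
      qed
      have e: "(\<Sum>i<n. indicator (A i) z) = (indicator (\<Union>i<n. A i) z :: real)" for n z
        using union(1) by (subst indicator_UN_disjoint) (auto intro: disjoint_family_on_mono)
      show "(\<lambda>n. \<Sum>i<n. indicator (A i) z) \<longlonglongrightarrow> (indicator (\<Union> (range A)) z :: real)" for z
        unfolding e by (rule LIMSEQ_indicator_UN)
      show "\<bar>\<Sum>i<n. indicator (A i) z\<bar> \<le> (1 :: real)" for n z
        unfolding e by (simp add: indicator_def)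
    qed (use mS in auto)
  qed
qed

text \<open>Induction over nonnegative measurable functions. Square-integrability passes to summands
  and to members of an increasing sequence because these lie between 0 and the whole
  function.\<close>

lemma L2_limits_nonneg:
  assumes "u \<in> borel_measurable S3_measure" "\<And>z. 0 \<le> u z" "integrable S3_measure (\<lambda>z. (u z)\<^sup>2)"
  shows "(\<lambda>z. complex_of_real (u z) *s w) \<in> L2_limits"
  using assms
proof (induction rule: borel_measurable_induct_real)
  case (set A)
  then obtain A' where A': "A' \<in> sets borel" "A = A' \<inter> S3"
    by (auto simp: sets_restrict_space)
  then show ?case
    by (intro L2_limits_cong[OF L2_limits_indicator[OF A'(1)]]) (auto simp: indicator_def)
next
  case (mult u c)
  show ?case
  proof (cases "c = 0")
    case False
    then have "integrable S3_measure (\<lambda>z. (u z)\<^sup>2)"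
      using mult.prems by (simp add: power_mult_distrib)
    from L2_limits_smult[OF mult.IH[OF this], of "of_real c"] show ?thesis by simp
  qed (simp add: L2_limits_continuous)
next
  case (add u v)
  note [measurable] = add.hyps(1,3)
  have "integrable S3_measure (\<lambda>z. (u z)\<^sup>2)" "integrable S3_measure (\<lambda>z. (v z)\<^sup>2)"
    using add.hyps(2,4)
    by (auto intro!: Bochner_Integration.integrable_bound[OF add.prems] AE_I2 power_mono simp: add_increasing add_increasing2)
  from L2_limits_add[OF add.IH(2)[OF this(2)] add.IH(1)[OF this(1)]] show ?case
    by (simp add: smult_add_left)
next
  case (seq U)
  have le: "U i z \<le> u z" if "z \<in> S3" for i z
  proof (rule incseq_le)
    show "incseq (\<lambda>i. U i z)" using seq.hyps(3) by (simp add: incseq_def le_fun_def del: split_paired_All)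
    show "(\<lambda>i. U i z) \<longlonglongrightarrow> u z" using seq.hyps(4)[of z] that by simp
  qed
  have "integrable S3_measure (\<lambda>z. (U i z)\<^sup>2)" for i
  proof (rule Bochner_Integration.integrable_bound[OF seq.prems])
    show "(\<lambda>z. (U i z)\<^sup>2) \<in> borel_measurable S3_measure" using seq.hyps(1) by measurable
    show "AE z in S3_measure. norm ((U i z)\<^sup>2) \<le> norm ((u z)\<^sup>2)"
      using seq.hyps(2) le by (intro AE_I2) (auto intro!: power_mono)
  qed
  note int = this
  show ?case
  proof (rule L2_limits_of_real_limit[where f = U and g = u])
    show "(\<lambda>z. complex_of_real (U n z) *s w) \<in> L2_limits" for n by (rule seq.IH[OF int])
    show "(\<lambda>n. U n z) \<longlonglongrightarrow> u z" if "z \<in> S3" for z using seq.hyps(4)[of z] that by simp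
    show "\<bar>U n z\<bar> \<le> u z" if "z \<in> S3" for n z using le[OF that] seq.hyps(2)[of n z] by simp
  qed (rule seq.hyps(1) seq.prems)+
qed

lemma L2_limits_all:
  assumes "f \<in> L2_spinors" shows "f \<in> L2_limits"
proof -
  note m = L2D(1)[OF assms]
  \<comment> \<open>For a = 1, - 1, - i, i this is the positive or negative part of the real or
    imaginary part of a component: Re (- i x) = Im x.\<close>
  define u where "u a i z = max 0 (Re (a * f z $ i))" for a i z
  have u: "(\<lambda>z. complex_of_real (u a i z) *s w) \<in> L2_limits" if "norm a = 1" for a i w
  proof (rule L2_limits_nonneg)
    have "continuous_on UNIV (\<lambda>x::spinor. max 0 (Re (a * x $ i)))" by (intro continuous_intros)
    from borel_measurable_continuous_on[OF this m]
    show mu: "u a i \<in> borel_measurable S3_measure" by (simp add: u_def[abs_def])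
    show "integrable S3_measure (\<lambda>z. (u a i z)\<^sup>2)"
    proof (rule Bochner_Integration.integrable_bound[OF L2D(2)[OF assms]])
      show "(\<lambda>z. (u a i z)\<^sup>2) \<in> borel_measurable S3_measure" using mu by measurable
      have "\<bar>u a i z\<bar> \<le> norm (f z)" for z
      proof -
        have "\<bar>u a i z\<bar> \<le> norm (a * f z $ i)"
          using abs_Re_le_cmod[of "a * f z $ i"] by (simp add: u_def)
        also have "\<dots> \<le> norm (f z)" using that by (simp add: norm_mult component_le_norm_cart Finite_Cartesian_Product.norm_nth_le)
        finally show ?thesis .
      qed
      then show "AE z in S3_measure. norm ((u a i z)\<^sup>2) \<le> norm ((norm (f z))\<^sup>2)"
        by (intro AE_I2) (simp add: abs_le_square_iff[symmetric])
    qed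
  qed (simp add: u_def)
  define v where "v i z = complex_of_real (u 1 i z) *s (axis i 1 :: spinor) - complex_of_real (u (- 1) i z) *s axis i 1
    + (complex_of_real (u (- \<i>) i z) *s axis i \<i> - complex_of_real (u \<i> i z) *s axis i \<i>)" for i z
  have v: "v i \<in> L2_limits" for i
    unfolding v_def by (intro L2_limits_add L2_limits_diff u) auto
  have x: "x = complex_of_real (max 0 (Re (1 * x))) - complex_of_real (max 0 (Re (- 1 * x)))
     + (complex_of_real (max 0 (Re (- \<i> * x))) * \<i> - complex_of_real (max 0 (Re (\<i> * x))) * \<i>)" for x
    by (simp add: complex_eq_iff max_def)
  have "(\<lambda>z. v 1 z + v 2 z) \<in> L2_limits"
    by (intro L2_limits_add v)
  then show ?thesis
  proof (rule L2_limits_cong)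
    show "v 1 z + v 2 z = f z" for z
      using x[of "f z $ 1"] x[of "f z $ 2"] by (simp add: vec_eq_iff forall_2 v_def u_def axis_def)
  qed
qed

subsection \<open>Completeness\<close>

lemma L2_nn_integral:
  assumes "f \<in> L2_spinors"
  shows "(\<integral>\<^sup>+z. ennreal ((norm (f z))\<^sup>2) \<partial>S3_measure) = ennreal ((L2norm f)\<^sup>2)"
  using L2D(2)[OF assms] by (simp add: nn_integral_eq_integral L2norm_square)

text \<open>Cauchy-Schwarz against a constant spinor of pointwise norm 1, which is square-integrable
  because the measure is finite.\<close>

lemma L1_le_L2:
  assumes "f \<in> L2_spinors"
  shows "(\<integral>\<^sup>+z. ennreal (norm (f z)) \<partial>S3_measure) \<le> ennreal (L2norm f * L2norm (\<lambda>z. axis 1 1))"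
proof -
  have n: "norm (axis 1 1 :: spinor) = 1" by (simp add: norm_vec_def L2_set_def sum_2 axis_def)
  have c: "(\<lambda>z. axis 1 1) \<in> L2_spinors" by (rule L2_continuous) simp
  show ?thesis
    using L2_norm_mult[OF assms c] by (simp add: n nn_integral_eq_integral ennreal_leI)
qed

text \<open>The Riesz-Fischer argument for a rapidly converging sequence: the increments are
  summable almost everywhere, which gives a pointwise limit, and Fatou turns the Cauchy estimate
  into L2 convergence.\<close>

lemma L2_complete:
  assumes f: "\<And>n. f n \<in> L2_spinors" and C: "C \<ge> 0"
    and step: "\<And>n. L2norm (\<lambda>z. f (Suc n) z - f n z) \<le> C * (1/2) ^ n"
  obtains h where "h \<in> L2_spinors" "(\<lambda>n. L2norm (\<lambda>z. f n z - h z)) \<longlonglongrightarrow> 0"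
proof -
  note [measurable] = L2D(1)[OF f]
  define K where "K = L2norm (\<lambda>z. axis 1 1)"
  have K: "K \<ge> 0" by (simp add: K_def L2norm_nonneg)
  \<comment> \<open>The subtracted term is the geometric tail still to come; keeping it exact lets
    the induction on m close.\<close>
  have Cauchy: "L2norm (\<lambda>z. f (n + m) z - f n z) \<le> 2 * C * (1/2) ^ n - 2 * C * (1/2) ^ (n + m)" for n m
  proof (induction m)
    case 0
    then show ?case by (simp add: L2norm_0)
  next
    case (Suc m)
    have "L2norm (\<lambda>z. f (n + Suc m) z - f n z)
        \<le> L2norm (\<lambda>z. f (Suc (n + m)) z - f (n + m) z) + L2norm (\<lambda>z. f (n + m) z - f n z)"
      using L2norm_triangle_diff[OF f f f] by simp
    also have "\<dots> \<le> C * (1/2) ^ (n + m) + (2 * C * (1/2) ^ n - 2 * C * (1/2) ^ (n + m))"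
      by (intro add_mono step Suc)
    also have "\<dots> = 2 * C * (1/2) ^ n - 2 * C * (1/2) ^ (n + Suc m)" by simp
    finally show ?case .
  qed
  have "(\<integral>\<^sup>+z. (\<Sum>n. ennreal (norm (f (Suc n) z - f n z))) \<partial>S3_measure)
      = (\<Sum>n. \<integral>\<^sup>+z. ennreal (norm (f (Suc n) z - f n z)) \<partial>S3_measure)"
    by (rule nn_integral_suminf) measurable
  also have "\<dots> \<le> (\<Sum>n. ennreal (C * (1/2) ^ n * K))"
  proof (rule suminf_le)
    fix n
    have "(\<integral>\<^sup>+z. ennreal (norm (f (Suc n) z - f n z)) \<partial>S3_measure)
        \<le> ennreal (L2norm (\<lambda>z. f (Suc n) z - f n z) * K)"
      unfolding K_def by (rule L1_le_L2[OF L2_diff[OF f f]])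
    also have "\<dots> \<le> ennreal (C * (1/2) ^ n * K)"
      by (intro ennreal_leI mult_right_mono step K)
    finally show "(\<integral>\<^sup>+z. ennreal (norm (f (Suc n) z - f n z)) \<partial>S3_measure) \<le> ennreal (C * (1/2) ^ n * K)" .
  qed auto
  also have "\<dots> = ennreal (\<Sum>n. C * (1/2) ^ n * K)"
    using C K by (intro suminf_ennreal2) (auto intro!: summable_mult summable_mult2 summable_geometric)
  finally have "(\<integral>\<^sup>+z. (\<Sum>n. ennreal (norm (f (Suc n) z - f n z))) \<partial>S3_measure) \<noteq> \<infinity>"
    by (auto simp: top_unique)
  then have ae: "AE z in S3_measure. (\<Sum>n. ennreal (norm (f (Suc n) z - f n z))) \<noteq> \<infinity>"
    by (intro nn_integral_PInf_AE) auto
  \<comment> \<open>On the null set without convergence \<open>lim\<close> takes an unspecified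
    value; h is measurable all the same.\<close>
  define h where "h z = lim (\<lambda>n. f n z)" for z
  have [measurable]: "h \<in> borel_measurable S3_measure"
    unfolding h_def by measurable
  have conv: "AE z in S3_measure. (\<lambda>n. f n z) \<longlonglongrightarrow> h z"
    using ae
  proof eventually_elim
    case (elim z)
    then have "summable (\<lambda>n. norm (f (Suc n) z - f n z))"
      by (intro summable_suminf_not_top) auto
    then have "summable (\<lambda>n. f (Suc n) z - f n z)" by (rule summable_norm_cancel)
    then have "convergent (\<lambda>n. \<Sum>i<n. f (Suc i) z - f i z)" by (simp only: summable_iff_convergent)
    then have "convergent (\<lambda>n. f n z - f 0 z)"
      by (simp only: sum_lessThan_telescope[of "\<lambda>i. f i z"])
    then have "convergent (\<lambda>n. (f n z - f 0 z) + f 0 z)"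
      by (intro convergent_add convergent_const)
    then have "convergent (\<lambda>n. f n z)" by simp
    then show "(\<lambda>n. f n z) \<longlonglongrightarrow> h z" by (simp add: h_def convergent_LIMSEQ_iff)
  qed
  have fatou: "(\<integral>\<^sup>+z. ennreal ((norm (f n z - h z))\<^sup>2) \<partial>S3_measure) \<le> ennreal ((2 * C * (1/2) ^ n)\<^sup>2)" for n
  proof -
    have "(\<integral>\<^sup>+z. ennreal ((norm (f n z - h z))\<^sup>2) \<partial>S3_measure)
        = (\<integral>\<^sup>+z. liminf (\<lambda>m. ennreal ((norm (f (n + m) z - f n z))\<^sup>2)) \<partial>S3_measure)"
    proof (rule nn_integral_cong_AE)
      show "AE z in S3_measure. ennreal ((norm (f n z - h z))\<^sup>2)
          = liminf (\<lambda>m. ennreal ((norm (f (n + m) z - f n z))\<^sup>2))"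
        using conv
      proof eventually_elim
        case (elim z)
        have "(\<lambda>m. f (n + m) z) \<longlonglongrightarrow> h z"
          using LIMSEQ_ignore_initial_segment[OF elim, of n] by (simp add: add.commute)
        then have "(\<lambda>m. ennreal ((norm (f (n + m) z - f n z))\<^sup>2)) \<longlonglongrightarrow> ennreal ((norm (h z - f n z))\<^sup>2)"
          by (intro tendsto_ennrealI tendsto_intros)
        from lim_imp_Liminf[OF sequentially_bot this] show ?case by (simp add: norm_minus_commute)
      qed
    qed
    also have "\<dots> \<le> liminf (\<lambda>m. \<integral>\<^sup>+z. ennreal ((norm (f (n + m) z - f n z))\<^sup>2) \<partial>S3_measure)"
      by (rule nn_integral_liminf) measurable
    also have "\<dots> \<le> liminf (\<lambda>m::nat. ennreal ((2 * C * (1/2) ^ n)\<^sup>2))"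
    proof (rule Liminf_mono[OF always_eventually], rule allI)
      fix m
      have "L2norm (\<lambda>z. f (n + m) z - f n z) \<le> 2 * C * (1/2) ^ n"
      proof -
        have "0 \<le> 2 * C * (1/2) ^ (n + m)" using C by simp
        then show ?thesis using Cauchy[of n m] by linarith
      qed
      then show "(\<integral>\<^sup>+z. ennreal ((norm (f (n + m) z - f n z))\<^sup>2) \<partial>S3_measure) \<le> ennreal ((2 * C * (1/2) ^ n)\<^sup>2)"
        unfolding L2_nn_integral[OF L2_diff[OF f f]] by (intro ennreal_leI power_mono L2norm_nonneg)
    qed
    also have "\<dots> = ennreal ((2 * C * (1/2) ^ n)\<^sup>2)" by (simp add: Liminf_const)
    finally show ?thesis .
  qed
  have d: "(\<lambda>z. f n z - h z) \<in> L2_spinors" for n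
  proof -
    have "integrable S3_measure (\<lambda>z. (norm (f n z - h z))\<^sup>2)"
      using le_less_trans[OF fatou[of n] ennreal_less_top] by (intro integrableI_nonneg) auto
    then show ?thesis by (simp add: L2_spinors_def)
  qed
  have le: "L2norm (\<lambda>z. f n z - h z) \<le> 2 * C * (1/2) ^ n" for n
  proof (rule power2_le_imp_le)
    show "(L2norm (\<lambda>z. f n z - h z))\<^sup>2 \<le> (2 * C * (1/2) ^ n)\<^sup>2"
      using fatou[of n] C unfolding L2_nn_integral[OF d] by simp
  qed (use C in simp)
  have "(\<lambda>n. (1/2) ^ n :: real) \<longlonglongrightarrow> 0" by (rule LIMSEQ_power_zero) simp
  then have "(\<lambda>n. 2 * C * (1/2) ^ n) \<longlonglongrightarrow> 0" by (rule tendsto_mult_right_zero)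
  then have "(\<lambda>n. L2norm (\<lambda>z. f n z - h z)) \<longlonglongrightarrow> 0"
    by (rule Lim_null_comparison[rotated]) (simp only: real_norm_def abs_of_nonneg[OF L2norm_nonneg] le eventually_True)
  \<comment> \<open>h is f 0 minus the square-integrable difference f 0 - h.\<close>
  moreover have "h \<in> L2_spinors"
    using L2_diff[OF f[of 0] d[of 0]] by simp
  ultimately show thesis by (rule that[rotated])
qed

text \<open>If the norm vanished, the cone over the set where f is nonzero would be a null set; but
  it is open and contains z/2.\<close>

lemma L2norm_pos:
  assumes "continuous_on S3 f" "z \<in> S3" "f z \<noteq> 0"
  shows "L2norm f > 0"
proof (rule ccontr)
  assume "\<not> ?thesis"
  then have "L2norm f = 0" using L2norm_nonneg[of f] by simp
  then have "integral\<^sup>L S3_measure (\<lambda>z. (norm (f z))\<^sup>2) = 0" using L2norm_square[of f] by simp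
  then have "AE z in S3_measure. (norm (f z))\<^sup>2 = 0"
    using L2D(2)[OF L2_continuous[OF assms(1)]] by (subst (asm) integral_nonneg_eq_0_iff_AE) auto
  then have ae: "AE z in S3_measure. f z = 0" by simp
  let ?N = "{z \<in> space S3_measure. f z \<noteq> 0}"
  have N: "?N \<in> sets S3_measure"
    using borel_measurable_S3[OF assms(1)] by measurable
  have 0: "emeasure S3_measure ?N = 0" using AE_E2[OF ae] by simp
  let ?U = "{x \<in> ball 0 1 - {0}. x /\<^sub>R norm x \<in> ?N}"
  have "4 * emeasure lborel ?U = 0"
    using emeasure_S3_measure[OF N] 0 by simp
  then have "emeasure lborel ?U = 0" by simp
  have "continuous_on (ball 0 1 - {0}) (\<lambda>x. f (x /\<^sub>R norm x))"
  proof (rule continuous_on_compose2[OF assms(1)])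
    show "(\<lambda>x. x /\<^sub>R norm x) ` (ball 0 1 - {0}) \<subseteq> S3" using normalize_in_S3 by blast
  qed (auto intro!: continuous_intros)
  moreover have "open (ball 0 1 - {0::C2})" by (intro open_Diff) auto
  ultimately have "open ((\<lambda>x. f (x /\<^sub>R norm x)) -` (- {0}) \<inter> (ball 0 1 - {0}))"
    using continuous_on_open_vimage open_punctured by blast
  also have "(\<lambda>x. f (x /\<^sub>R norm x)) -` (- {0}) \<inter> (ball 0 1 - {0}) = ?U" by auto
  finally have U: "open ?U" .
  have "?U \<in> null_sets lborel"
    using \<open>emeasure lborel ?U = 0\<close> U by (intro null_setsI) auto
  then have "negligible ?U"
    unfolding negligible_iff_null_sets by (rule null_sets_completionI)
  moreover have "(1/2) *\<^sub>R z \<in> ?U"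
    using assms by auto
  ultimately show False using open_not_negligible[OF U] by blast
qed

section \<open>The resolvent\<close>

text \<open>Multiplying x by a suitable scalar makes the Hermitian product real, and its real part
  is the Euclidean inner product.\<close>

lemma norm_herm: "norm (herm x y) \<le> norm x * norm y"
proof -
  have re: "Re (herm x y) = x \<bullet> y" for x y
    by (simp add: herm_def inner_vec_def inner_complex_def)
  define u where "u = cnj (sgn (herm x y))"
  have u: "norm u \<le> 1" by (simp add: u_def norm_sgn)
  have "norm (herm x y) = Re (u * herm x y)"
    by (cases "herm x y = 0")
      (simp_all add: u_def sgn_div_norm scaleR_conv_of_real mult.assoc mult.commute[of "cnj _"]
        complex_norm_square[symmetric] power2_eq_square)
  also have "\<dots> = (u *s x) \<bullet> y" by (simp only: herm_smult_left[symmetric] re)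
  also have "\<dots> \<le> norm (u *s x) * norm y" by (rule norm_cauchy_schwarz)
  also have "\<dots> \<le> norm x * norm y"
    using u by (intro mult_right_mono) (auto simp: norm_smult mult_left_le_one_le)
  finally show ?thesis .
qed

definition ip :: "(C2 \<Rightarrow> spinor) \<Rightarrow> (C2 \<Rightarrow> spinor) \<Rightarrow> complex" where
  "ip f g = integral\<^sup>L S3_measure (\<lambda>z. herm (f z) (g z))"

lemma continuous_herm:
  "continuous_on S3 f \<Longrightarrow> continuous_on S3 g \<Longrightarrow> continuous_on S3 (\<lambda>z. herm (f z) (g z))"
  by (rule bounded_bilinear.continuous_on[OF bounded_bilinear_herm])

lemmas integrable_herm = integrable_S3[OF continuous_herm]

lemma ip_bound:
  assumes "continuous_on S3 f" "continuous_on S3 g"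
  shows "norm (ip f g) \<le> L2norm f * L2norm g"
proof -
  note L2 = L2_norm_mult[OF L2_continuous[OF assms(1)] L2_continuous[OF assms(2)]]
  have "norm (ip f g) \<le> integral\<^sup>L S3_measure (\<lambda>z. norm (herm (f z) (g z)))"
    unfolding ip_def by (rule integral_norm_bound)
  also have "\<dots> \<le> integral\<^sup>L S3_measure (\<lambda>z. norm (f z) * norm (g z))"
    by (intro integral_mono integrable_norm integrable_herm assms L2 norm_herm)
  also have "\<dots> \<le> L2norm f * L2norm g" by (rule L2)
  finally show ?thesis .
qed

lemma ip_self: "ip f f = of_real ((L2norm f)\<^sup>2)"
  by (simp only: ip_def herm_self L2norm_square integral_complex_of_real)

lemma ip_cong: "(\<And>z. z \<in> S3 \<Longrightarrow> f z = f' z) \<Longrightarrow> (\<And>z. z \<in> S3 \<Longrightarrow> g z = g' z) \<Longrightarrow> ip f g = ip f' g'"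
  unfolding ip_def by (intro Bochner_Integration.integral_cong) auto

lemma ip_smult_left: "ip (\<lambda>z. a *s f z) g = a * ip f g"
  by (simp add: ip_def herm_smult_left)

lemma ip_smult_right: "ip f (\<lambda>z. a *s g z) = cnj a * ip f g"
  by (simp add: ip_def herm_smult_right)

lemma ip_diff_left:
  assumes "continuous_on S3 f" "continuous_on S3 g" "continuous_on S3 h"
  shows "ip (\<lambda>z. f z - g z) h = ip f h - ip g h"
  unfolding ip_def herm_diff_left
  by (intro Bochner_Integration.integral_diff integrable_herm assms)

lemma ip_diff_right:
  assumes "continuous_on S3 f" "continuous_on S3 g" "continuous_on S3 h"
  shows "ip h (\<lambda>z. f z - g z) = ip h f - ip h g"
  unfolding ip_def herm_diff_right
  by (intro Bochner_Integration.integral_diff integrable_herm assms)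

lemma continuous_smult: "continuous_on S3 f \<Longrightarrow> continuous_on S3 (\<lambda>z. a *s (f z :: spinor))"
  by (rule bounded_linear.continuous_on[OF bounded_linear_smult_right])

lemma ip_sum_sum:
  assumes "\<And>i. i \<in> I \<Longrightarrow> continuous_on S3 (f i)"
  shows "ip (\<lambda>z. \<Sum>i\<in>I. x i *s f i z) (\<lambda>z. \<Sum>j\<in>I. x j *s f j z) = (\<Sum>i\<in>I. \<Sum>j\<in>I. x i * cnj (x j) * ip (f i) (f j))"
proof -
  have int: "integrable S3_measure (\<lambda>z. x i * cnj (x j) * herm (f i z) (f j z))" if "i \<in> I" "j \<in> I" for i j
    by (intro integrable_mult_right integrable_herm assms that)
  have "ip (\<lambda>z. \<Sum>i\<in>I. x i *s f i z) (\<lambda>z. \<Sum>j\<in>I. x j *s f j z)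
      = integral\<^sup>L S3_measure (\<lambda>z. \<Sum>i\<in>I. \<Sum>j\<in>I. x i * cnj (x j) * herm (f i z) (f j z))"
  proof -
    have "herm (\<Sum>i\<in>I. x i *s f i z) (\<Sum>j\<in>I. x j *s f j z)
        = (\<Sum>i\<in>I. \<Sum>j\<in>I. x i * cnj (x j) * herm (f i z) (f j z))" for z
      by (simp only: herm_sum_left) (simp only: herm_sum_right herm_smult_left herm_smult_right mult.assoc mult.left_commute)
    then show ?thesis by (simp only: ip_def)
  qed
  also have "\<dots> = (\<Sum>i\<in>I. integral\<^sup>L S3_measure (\<lambda>z. \<Sum>j\<in>I. x i * cnj (x j) * herm (f i z) (f j z)))"
    by (intro Bochner_Integration.integral_sum Bochner_Integration.integrable_sum int)
  also have "\<dots> = (\<Sum>i\<in>I. \<Sum>j\<in>I. integral\<^sup>L S3_measure (\<lambda>z. x i * cnj (x j) * herm (f i z) (f j z)))"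
    by (intro sum.cong refl Bochner_Integration.integral_sum int)
  finally show ?thesis by (simp add: ip_def)
qed

section \<open>Orthogonality and the resolvent bound\<close>

context spinor_mod
begin

lemma T_sum:
  assumes "finite I" "\<And>i. i \<in> I \<Longrightarrow> smooth_on_S3 (f i)"
  shows "smooth_on_S3 (\<lambda>z. \<Sum>i\<in>I. f i z)"
    "z \<in> S3 \<Longrightarrow> T (\<lambda>z. \<Sum>i\<in>I. f i z) z = (\<Sum>i\<in>I. T (f i) z)"
proof -
  have "smooth_on_S3 (\<lambda>z. \<Sum>i\<in>I. f i z) \<and> (\<forall>z\<in>S3. T (\<lambda>z. \<Sum>i\<in>I. f i z) z = (\<Sum>i\<in>I. T (f i) z))"
    using assms
  proof (induction I rule: finite_induct)
    case empty
    then show ?case using eigen_0[of 0] by (simp add: eigen_def)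
  next
    case (insert i I)
    then show ?case by (auto intro!: smooth_on_S3_add simp: T_add)
  qed
  then show "smooth_on_S3 (\<lambda>z. \<Sum>i\<in>I. f i z)"
    "z \<in> S3 \<Longrightarrow> T (\<lambda>z. \<Sum>i\<in>I. f i z) z = (\<Sum>i\<in>I. T (f i) z)" by blast+
qed

lemma T_ip_symmetric: "smooth_on_S3 f \<Longrightarrow> smooth_on_S3 g \<Longrightarrow> ip (T f) g = ip f (T g)"
  unfolding ip_def by (rule T_symmetric)

lemma eigen_orthogonal:
  assumes "eigen l f" "eigen m g" "l \<noteq> m"
  shows "ip f g = 0"
proof -
  have "of_real l * ip f g = ip (T f) g"
    using assms by (subst ip_smult_left[symmetric], intro ip_cong) (auto simp: eigen_def)
  also have "\<dots> = ip f (T g)" using assms by (intro T_ip_symmetric) (auto simp: eigen_def)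
  also have "\<dots> = of_real m * ip f g"
    using assms by (subst complex_cnj_complex_of_real[symmetric], subst ip_smult_right[symmetric], intro ip_cong) (auto simp: eigen_def)
  finally show ?thesis using assms(3) by simp
qed

lemma eigen_continuous: "eigen l f \<Longrightarrow> continuous_on S3 f"
  by (auto simp: eigen_def intro: smooth_continuous)

text \<open>Every l in F occurs once, so all cross terms join different eigenvalues and vanish. The
  \<open>g l\<close> are not normalized, hence the weights.\<close>

lemma parseval:
  assumes "finite F" "\<And>l. l \<in> F \<Longrightarrow> eigen l (g l)"
  shows "(L2norm (\<lambda>z. \<Sum>l\<in>F. x l *s g l z))\<^sup>2 = (\<Sum>l\<in>F. (norm (x l))\<^sup>2 * (L2norm (g l))\<^sup>2)"
proof -
  have "complex_of_real ((L2norm (\<lambda>z. \<Sum>l\<in>F. x l *s g l z))\<^sup>2)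
      = (\<Sum>i\<in>F. \<Sum>j\<in>F. x i * cnj (x j) * ip (g i) (g j))"
    unfolding ip_self[symmetric] by (rule ip_sum_sum[OF eigen_continuous[OF assms(2)]])
  also have "\<dots> = (\<Sum>i\<in>F. \<Sum>j\<in>F. if i = j then x i * cnj (x i) * ip (g i) (g i) else 0)"
    by (intro sum.cong refl) (auto simp: eigen_orthogonal[OF assms(2) assms(2)])
  also have "\<dots> = (\<Sum>i\<in>F. x i * cnj (x i) * ip (g i) (g i))"
    using assms(1) by simp
  also have "\<dots> = complex_of_real (\<Sum>l\<in>F. (norm (x l))\<^sup>2 * (L2norm (g l))\<^sup>2)"
    by (simp only: of_real_sum of_real_mult ip_self complex_norm_square[symmetric])
  finally show ?thesis by (simp only: of_real_eq_iff)
qed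

lemma eigspan_continuous: "v \<in> eigspan \<Longrightarrow> continuous_on S3 v"
proof -
  assume "v \<in> eigspan"
  then obtain F g where F: "finite F" "\<forall>l\<in>F. eigen l (g l)" "\<forall>z\<in>S3. v z = (\<Sum>l\<in>F. g l z)"
    unfolding eigspan_def by blast
  have "continuous_on S3 (\<lambda>z. \<Sum>l\<in>F. g l z)"
    using F(2) by (intro continuous_on_sum eigen_continuous) auto
  then show ?thesis by (rule continuous_on_eq) (simp add: F(3))
qed

text \<open>Each component is divided by its l - \<mu>, and the norm is compared component by
  component through \<open>parseval\<close>.\<close>

lemma eigspan_resolvent:
  assumes "v \<in> eigspan" "d > 0" "\<And>l. l \<in> eigvals t \<Longrightarrow> d \<le> norm (complex_of_real l - \<mu>)"
  obtains u where "smooth_on_S3 u" "\<And>z. z \<in> S3 \<Longrightarrow> T u z - \<mu> *s u z = v z" "d * L2norm u \<le> L2norm v"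
proof -
  obtain F g where F: "finite F" "F \<subseteq> eigvals t" "\<And>l. l \<in> F \<Longrightarrow> eigen l (g l)"
    "\<And>z. z \<in> S3 \<Longrightarrow> v z = (\<Sum>l\<in>F. g l z)"
    using assms(1) unfolding eigspan_def by blast
  define x where "x l = 1 / (complex_of_real l - \<mu>)" for l
  define u where "u z = (\<Sum>l\<in>F. x l *s g l z)" for z
  have ne: "complex_of_real l - \<mu> \<noteq> 0" if "l \<in> F" for l
    using assms(2) assms(3)[of l] F(2) that by auto
  have sm: "smooth_on_S3 (\<lambda>z. x l *s g l z)" if "l \<in> F" for l
    using F(3)[OF that] by (auto simp: eigen_def intro: smooth_smult)
  have "T u z - \<mu> *s u z = v z" if z: "z \<in> S3" for z
  proof -
    have "T u z = (\<Sum>l\<in>F. T (\<lambda>z. x l *s g l z) z)"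
      unfolding u_def by (rule T_sum(2)[OF F(1) sm z])
    also have "\<dots> = (\<Sum>l\<in>F. complex_of_real l *s (x l *s g l z))"
      using F(3) eigen_smult z unfolding eigen_def by (intro sum.cong refl) blast
    finally have "T u z - \<mu> *s u z = (\<Sum>l\<in>F. complex_of_real l *s (x l *s g l z) - \<mu> *s (x l *s g l z))"
      unfolding u_def linear_sum[OF bounded_linear.linear[OF bounded_linear_smult_right]]
      by (simp only: sum_subtractf)
    also have "\<dots> = (\<Sum>l\<in>F. g l z)"
    proof (intro sum.cong refl)
      fix l assume "l \<in> F"
      then have "(complex_of_real l - \<mu>) * x l = 1" using ne by (simp add: x_def)
      then have "((complex_of_real l - \<mu>) * x l) *s g l z = g l z" by simp
      then show "complex_of_real l *s (x l *s g l z) - \<mu> *s (x l *s g l z) = g l z"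
        by (simp add: vec_eq_iff algebra_simps)
    qed
    finally show ?thesis using F(4)[OF z] by simp
  qed
  moreover have "d * L2norm u \<le> L2norm v"
  proof (rule power2_le_imp_le)
    have "(d * L2norm u)\<^sup>2 = (\<Sum>l\<in>F. (d * norm (x l))\<^sup>2 * (L2norm (g l))\<^sup>2)"
      using parseval[OF F(1,3), of x] by (simp add: u_def[abs_def] power_mult_distrib sum_distrib_left mult.assoc)
    \<comment> \<open>The coefficient 1 is kept visible so that \<open>parseval\<close> can be read
      backwards for v.\<close>
    also have "\<dots> \<le> (\<Sum>l\<in>F. (norm (1 :: complex))\<^sup>2 * (L2norm (g l))\<^sup>2)"
    proof (intro sum_mono mult_right_mono power_mono)
      fix l assume l: "l \<in> F"
      then have "d \<le> norm (complex_of_real l - \<mu>)" using assms(3) F(2) by blast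
      then show "d * norm (x l) \<le> norm (1 :: complex)"
        using ne[OF l] by (simp add: x_def norm_divide)
    qed (use assms(2) in auto)
    also have "\<dots> = (L2norm (\<lambda>z. \<Sum>l\<in>F. 1 *s g l z))\<^sup>2"
      by (rule parseval[OF F(1,3), symmetric])
    also have "L2norm (\<lambda>z. \<Sum>l\<in>F. 1 *s g l z) = L2norm v"
      by (rule L2norm_cong) (simp add: F(4))
    finally show "(d * L2norm u)\<^sup>2 \<le> (L2norm v)\<^sup>2" .
  qed (rule L2norm_nonneg)
  moreover have "smooth_on_S3 u" unfolding u_def by (rule T_sum(1)[OF F(1) sm])
  ultimately show thesis using that by blast
qed

lemma eigspan_L2_dense:
  assumes "f \<in> L2_spinors" "r > 0"
  obtains v where "v \<in> eigspan" "L2norm (\<lambda>z. f z - v z) < r"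
proof -
  obtain g where g: "continuous_on S3 g" "L2norm (\<lambda>z. f z - g z) < r / 2"
    by (rule L2_limitsE[OF L2_limits_all[OF assms(1)] half_gt_zero[OF assms(2)]])
  let ?m = "sqrt (measure S3_measure S3)"
  \<comment> \<open>Uniform distance e costs at most e times the root of the total mass in L2; the
    added 1 makes the denominator positive.\<close>
  define e where "e = r / 2 / (?m + 1)"
  have m: "?m \<ge> 0" by simp
  then have mp: "?m + 1 > 0" by linarith
  then have e: "e > 0" using assms(2) unfolding e_def by (intro divide_pos_pos) simp_all
  obtain v where v: "v \<in> eigspan" "\<And>z. z \<in> S3 \<Longrightarrow> norm (g z - v z) < e"
    using eigspan_dense[OF g(1) e] by metis
  have L2: "g \<in> L2_spinors" "v \<in> L2_spinors"
    using g(1) v(1) by (auto intro: L2_continuous eigspan_continuous)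
  have "L2norm (\<lambda>z. g z - v z) \<le> e * ?m"
    using v(2) e by (intro L2norm_bound L2_diff L2) (auto intro: less_imp_le)
  also have "\<dots> \<le> e * (?m + 1)" using e by simp
  also have "\<dots> = r / 2" using nonzero_eq_divide_eq[THEN iffD1, OF _ e_def] mp by simp
  finally have "L2norm (\<lambda>z. f z - v z) < r"
    using L2norm_triangle_diff[OF assms(1) L2] g(2) by simp
  then show thesis using that v(1) by blast
qed

text \<open>A duality argument: choose w in \<open>eigspan\<close> close to f and solve (T - cnj
  \<mu>) u = w. Symmetry turns the product of f and w into that of (T - \<mu>) f and u, and d |u| is
  at most |w|, which is close to |f|. Only L2 closeness of w to f enters, not closeness of their
  images.\<close>

lemma smooth_lower_bound:
  assumes f: "smooth_on_S3 f" and d: "d > 0" "\<And>l. l \<in> eigvals t \<Longrightarrow> d \<le> norm (complex_of_real l - \<mu>)"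
  shows "d * L2norm f \<le> L2norm (\<lambda>z. T f z - \<mu> *s f z)"
proof -
  define B where "B = L2norm (\<lambda>z. T f z - \<mu> *s f z)"
  have B: "B \<ge> 0" by (simp add: B_def L2norm_nonneg)
  have cf: "continuous_on S3 f" by (rule smooth_continuous[OF f])
  have cB: "continuous_on S3 (\<lambda>z. T f z - \<mu> *s f z)"
    by (intro continuous_intros T_continuous f continuous_smult cf)
  \<comment> \<open>The eigenvalues are real, so \<mu> and its conjugate are equally far from
    them.\<close>
  have d': "d \<le> norm (complex_of_real l - cnj \<mu>)" if "l \<in> eigvals t" for l
    using d(2)[OF that] complex_mod_cnj[of "complex_of_real l - \<mu>"] by simp
  have "d * (L2norm f)\<^sup>2 \<le> B * L2norm f + e * (d * L2norm f + B)" if e: "e > 0" for e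
  proof -
    obtain w where w: "w \<in> eigspan" "L2norm (\<lambda>z. f z - w z) < e"
      by (rule eigspan_L2_dense[OF L2_continuous[OF cf] e])
    have cw: "continuous_on S3 w" by (rule eigspan_continuous[OF w(1)])
    obtain u where u: "smooth_on_S3 u" "\<And>z. z \<in> S3 \<Longrightarrow> T u z - cnj \<mu> *s u z = w z" "d * L2norm u \<le> L2norm w"
      using eigspan_resolvent[OF w(1) d(1) d'] by metis
    have cu: "continuous_on S3 u" by (rule smooth_continuous[OF u(1)])
    have "ip f w = ip f (\<lambda>z. T u z - cnj \<mu> *s u z)"
      by (rule ip_cong) (simp_all add: u(2))
    also have "\<dots> = ip f (T u) - \<mu> * ip f u"
      by (simp add: ip_diff_right[OF T_continuous[OF u(1)] continuous_smult[OF cu] cf] ip_smult_right)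
    also have "\<dots> = ip (\<lambda>z. T f z - \<mu> *s f z) u"
      by (simp add: ip_diff_left[OF T_continuous[OF f] continuous_smult[OF cf] cu] ip_smult_left
          T_ip_symmetric[OF f u(1)])
    finally have "norm (ip f w) \<le> B * L2norm u"
      unfolding B_def using ip_bound[OF cB cu] by simp
    moreover have "ip f f = ip f w + ip f (\<lambda>z. f z - w z)"
      by (simp add: ip_diff_right[OF cf cw cf])
    then have "(L2norm f)\<^sup>2 \<le> norm (ip f w) + norm (ip f (\<lambda>z. f z - w z))"
      using norm_triangle_ineq[of "ip f w" "ip f (\<lambda>z. f z - w z)"]
      by (metis ip_self norm_of_real abs_of_nonneg zero_le_power2)
    moreover have "norm (ip f (\<lambda>z. f z - w z)) \<le> L2norm f * e"
      using ip_bound[OF cf continuous_on_diff[OF cf cw]] w(2)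
      by (meson L2norm_nonneg less_imp_le mult_left_mono order_trans)
    ultimately have "(L2norm f)\<^sup>2 \<le> B * L2norm u + L2norm f * e" by linarith
    then have "d * (L2norm f)\<^sup>2 \<le> d * (B * L2norm u + L2norm f * e)"
      using d(1) by (intro mult_left_mono) auto
    also have "\<dots> = B * (d * L2norm u) + d * L2norm f * e" by (simp add: algebra_simps)
    also have "\<dots> \<le> B * (L2norm f + e) + d * L2norm f * e"
    proof -
      have "L2norm w \<le> L2norm f + L2norm (\<lambda>z. w z - f z)"
        by (rule L2norm_le_add[OF L2_continuous[OF cw] L2_continuous[OF cf]])
      then have "d * L2norm u \<le> L2norm f + e"
        using u(3) w(2) L2norm_minus_commute[of w f] by simp
      then show ?thesis using B by (intro add_right_mono mult_left_mono)
    qed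
    finally show ?thesis by (simp add: algebra_simps)
  qed
  note le = this
  have "d * (L2norm f)\<^sup>2 \<le> B * L2norm f"
  proof (rule field_le_epsilon)
    fix e :: real assume e: "e > 0"
    \<comment> \<open>The factor of the error term, increased by 1 to be positive; accuracy e / k
      then leaves an error of at most e.\<close>
    define k where "k = d * L2norm f + B + 1"
    have k: "k > 0" unfolding k_def using d(1) B L2norm_nonneg[of f] by (simp add: add_nonneg_pos)
    have "d * (L2norm f)\<^sup>2 \<le> B * L2norm f + (e / k) * (d * L2norm f + B)"
      using e k by (intro le) simp
    also have "\<dots> \<le> B * L2norm f + (e / k) * k"
      using e k by (intro add_left_mono mult_left_mono) (auto simp: k_def)
    finally show "d * (L2norm f)\<^sup>2 \<le> B * L2norm f + e" using k by simp
  qed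
  then have "(d * L2norm f) * L2norm f \<le> B * L2norm f" by (simp add: power2_eq_square)
  then show ?thesis
    using B L2norm_nonneg[of f] unfolding B_def[symmetric]
    by (cases "L2norm f = 0") (auto simp: mult_le_cancel_right)
qed

text \<open>Both conditions come from the lower bound on smooth spinors. It makes the solutions for
  approximate right-hand sides a Cauchy sequence, which gives surjectivity; by continuity of the
  norm it also holds on the closure.\<close>

lemma not_eigval_in_resolvent:
  assumes "\<mu> \<notin> complex_of_real ` eigvals t"
  shows "\<mu> \<in> resolvent_set T"
proof -
  obtain d where d: "d > 0" "\<And>l. l \<in> eigvals t \<Longrightarrow> d \<le> norm (complex_of_real l - \<mu>)"
    using eigvals_separated[OF assms] by metis
  have "\<exists>\<phi> \<xi>. closure_graph T \<phi> \<xi> \<and> (\<forall>z\<in>S3. \<xi> z - \<mu> *s \<phi> z = \<psi> z)" if \<psi>: "\<psi> \<in> L2_spinors" for \<psi>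
  proof -
    have "\<exists>v. v \<in> eigspan \<and> L2norm (\<lambda>z. \<psi> z - v z) < (1/2) ^ n" for n
      using eigspan_L2_dense[OF \<psi>, of "(1/2) ^ n"] by (metis half_gt_zero zero_less_one zero_less_power)
    then obtain v where v: "\<And>n. v n \<in> eigspan" "\<And>n. L2norm (\<lambda>z. \<psi> z - v n z) < (1/2) ^ n"
      by metis
    have "\<exists>u. smooth_on_S3 u \<and> (\<forall>z\<in>S3. T u z - \<mu> *s u z = v n z)" for n
      using eigspan_resolvent[OF v(1)[of n] d] by metis
    then obtain u where u: "\<And>n. smooth_on_S3 (u n)" "\<And>n z. z \<in> S3 \<Longrightarrow> T (u n) z - \<mu> *s u n z = v n z"
      by metis
    have L2v: "v n \<in> L2_spinors" for n by (intro L2_continuous eigspan_continuous v)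
    have L2u: "u n \<in> L2_spinors" for n by (intro L2_continuous smooth_continuous u)
    have vl: "(\<lambda>n. L2norm (\<lambda>z. v n z - \<psi> z)) \<longlonglongrightarrow> 0"
    proof (rule Lim_null_comparison)
      show "\<forall>\<^sub>F n in sequentially. norm (L2norm (\<lambda>z. v n z - \<psi> z)) \<le> (1/2) ^ n"
        using v(2) by (intro always_eventually allI) (simp add: L2norm_nonneg L2norm_minus_commute[of "v _"] less_imp_le)
      show "(\<lambda>n. (1/2) ^ n :: real) \<longlonglongrightarrow> 0" by (rule LIMSEQ_power_zero) simp
    qed
    have step: "L2norm (\<lambda>z. u (Suc n) z - u n z) \<le> (2 / d) * (1/2) ^ n" for n
    proof -
      have s: "smooth_on_S3 (\<lambda>z. u (Suc n) z + (- 1) *s u n z)"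
        by (intro smooth_on_S3_add smooth_smult u)
      have "d * L2norm (\<lambda>z. u (Suc n) z - u n z) = d * L2norm (\<lambda>z. u (Suc n) z + (- 1) *s u n z)"
        by (intro arg_cong[where f = "(*) d"] L2norm_cong) (simp add: vec_eq_iff)
      \<comment> \<open>The bound for all smooth spinors applies directly to a difference of two
        solutions, whereas \<open>eigspan_resolvent\<close> controls each of its solutions
        separately.\<close>
      also have "\<dots> \<le> L2norm (\<lambda>z. T (\<lambda>z. u (Suc n) z + (- 1) *s u n z) z - \<mu> *s (u (Suc n) z + (- 1) *s u n z))"
        by (rule smooth_lower_bound[OF s d])
      also have "\<dots> = L2norm (\<lambda>z. v (Suc n) z - v n z)"
      proof (rule L2norm_cong)
        fix z assume z: "z \<in> S3"
        show "T (\<lambda>z. u (Suc n) z + (- 1) *s u n z) z - \<mu> *s (u (Suc n) z + (- 1) *s u n z) = v (Suc n) z - v n z"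
          unfolding T_add[OF u(1) smooth_smult[OF u(1)] z] T_smult[OF u(1) z] u(2)[OF z, symmetric]
          by (simp add: vec_eq_iff algebra_simps)
      qed
      also have "\<dots> \<le> L2norm (\<lambda>z. v (Suc n) z - \<psi> z) + L2norm (\<lambda>z. \<psi> z - v n z)"
        by (rule L2norm_triangle_diff[OF L2v \<psi> L2v])
      also have "\<dots> \<le> (1/2) ^ Suc n + (1/2) ^ n"
        using v(2)[of n] v(2)[of "Suc n"] L2norm_minus_commute[of \<psi> "v (Suc n)"] by simp
      also have "\<dots> \<le> 2 * (1/2) ^ n" by simp
      finally show ?thesis using d(1) by (simp add: field_simps)
    qed
    obtain \<phi> where \<phi>: "\<phi> \<in> L2_spinors" "(\<lambda>n. L2norm (\<lambda>z. u n z - \<phi> z)) \<longlonglongrightarrow> 0"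
      by (rule L2_complete[OF L2u _ step]) (use d(1) in simp_all)
    \<comment> \<open>Defining \<xi> by the resolvent equation makes it hold at every point, as
      required, although \<phi> is determined only up to null sets.\<close>
    define \<xi> where "\<xi> z = \<psi> z + \<mu> *s \<phi> z" for z
    have \<xi>: "\<xi> \<in> L2_spinors" unfolding \<xi>_def by (intro L2_add L2_smult \<psi> \<phi>)
    have "(\<lambda>n. L2norm (\<lambda>z. T (u n) z - \<xi> z)) \<longlonglongrightarrow> 0"
    proof (rule Lim_null_comparison)
      show "\<forall>\<^sub>F n in sequentially. norm (L2norm (\<lambda>z. T (u n) z - \<xi> z))
          \<le> L2norm (\<lambda>z. v n z - \<psi> z) + norm \<mu> * L2norm (\<lambda>z. u n z - \<phi> z)"
      proof (intro always_eventually allI)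
        fix n
        have "L2norm (\<lambda>z. T (u n) z - \<xi> z) = L2norm (\<lambda>z. (v n z - \<psi> z) + \<mu> *s (u n z - \<phi> z))"
          by (rule L2norm_cong) (simp add: u(2)[symmetric] \<xi>_def vec_eq_iff algebra_simps)
        also have "\<dots> \<le> L2norm (\<lambda>z. v n z - \<psi> z) + L2norm (\<lambda>z. \<mu> *s (u n z - \<phi> z))"
          by (intro L2norm_triangle L2_diff L2_smult L2v L2u \<psi> \<phi>)
        finally show "norm (L2norm (\<lambda>z. T (u n) z - \<xi> z))
          \<le> L2norm (\<lambda>z. v n z - \<psi> z) + norm \<mu> * L2norm (\<lambda>z. u n z - \<phi> z)"
          by (simp only: L2norm_smult real_norm_def abs_of_nonneg[OF L2norm_nonneg])
      qed
      show "(\<lambda>n. L2norm (\<lambda>z. v n z - \<psi> z) + norm \<mu> * L2norm (\<lambda>z. u n z - \<phi> z)) \<longlonglongrightarrow> 0"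
        using tendsto_add[OF vl tendsto_mult_right_zero[OF \<phi>(2), of "norm \<mu>"]] by simp
    qed
    then have "closure_graph T \<phi> \<xi>"
      unfolding closure_graph_def using \<phi> \<xi> u(1) by blast
    moreover have "\<xi> z - \<mu> *s \<phi> z = \<psi> z" for z by (simp add: \<xi>_def)
    ultimately show ?thesis by blast
  qed
  \<comment> \<open>The lower bound for the smooth approximants passes to the limit, since both
    sides converge.\<close>
  moreover have "L2norm \<phi> \<le> (1 / d) * L2norm (\<lambda>z. \<xi> z - \<mu> *s \<phi> z)" if cl: "closure_graph T \<phi> \<xi>" for \<phi> \<xi>
  proof -
    obtain f where f: "\<And>n. smooth_on_S3 (f n)" "(\<lambda>n. L2norm (\<lambda>z. f n z - \<phi> z)) \<longlonglongrightarrow> 0"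
      "(\<lambda>n. L2norm (\<lambda>z. T (f n) z - \<xi> z)) \<longlonglongrightarrow> 0" and \<phi>: "\<phi> \<in> L2_spinors" and \<xi>: "\<xi> \<in> L2_spinors"
      using cl unfolding closure_graph_def by blast
    have L2f: "f n \<in> L2_spinors" and L2T: "T (f n) \<in> L2_spinors" for n
      by (intro L2_continuous smooth_continuous T_continuous f)+
    have "(\<lambda>n. L2norm (\<lambda>z. (T (f n) z - \<mu> *s f n z) - (\<xi> z - \<mu> *s \<phi> z))) \<longlonglongrightarrow> 0"
    proof (rule Lim_null_comparison)
      show "\<forall>\<^sub>F n in sequentially. norm (L2norm (\<lambda>z. (T (f n) z - \<mu> *s f n z) - (\<xi> z - \<mu> *s \<phi> z)))
          \<le> L2norm (\<lambda>z. T (f n) z - \<xi> z) + norm (- \<mu>) * L2norm (\<lambda>z. f n z - \<phi> z)"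
      proof (intro always_eventually allI)
        fix n
        have "L2norm (\<lambda>z. (T (f n) z - \<mu> *s f n z) - (\<xi> z - \<mu> *s \<phi> z))
            = L2norm (\<lambda>z. (T (f n) z - \<xi> z) + (- \<mu>) *s (f n z - \<phi> z))"
          by (rule L2norm_cong) (simp add: vec_eq_iff algebra_simps)
        also have "\<dots> \<le> L2norm (\<lambda>z. T (f n) z - \<xi> z) + L2norm (\<lambda>z. (- \<mu>) *s (f n z - \<phi> z))"
          by (intro L2norm_triangle L2_diff L2_smult L2T L2f \<xi> \<phi>)
        finally show "norm (L2norm (\<lambda>z. (T (f n) z - \<mu> *s f n z) - (\<xi> z - \<mu> *s \<phi> z)))
          \<le> L2norm (\<lambda>z. T (f n) z - \<xi> z) + norm (- \<mu>) * L2norm (\<lambda>z. f n z - \<phi> z)"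
          by (simp only: L2norm_smult real_norm_def abs_of_nonneg[OF L2norm_nonneg])
      qed
      show "(\<lambda>n. L2norm (\<lambda>z. T (f n) z - \<xi> z) + norm (- \<mu>) * L2norm (\<lambda>z. f n z - \<phi> z)) \<longlonglongrightarrow> 0"
        using tendsto_add[OF f(3) tendsto_mult_right_zero[OF f(2), of "norm (- \<mu>)"]] by simp
    qed
    then have "(\<lambda>n. L2norm (\<lambda>z. T (f n) z - \<mu> *s f n z)) \<longlonglongrightarrow> L2norm (\<lambda>z. \<xi> z - \<mu> *s \<phi> z)"
      by (intro L2norm_tendsto L2_diff L2_smult L2T L2f \<xi> \<phi>)
    moreover have "(\<lambda>n. d * L2norm (f n)) \<longlonglongrightarrow> d * L2norm \<phi>"
      by (intro tendsto_mult_left L2norm_tendsto L2f \<phi> f)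
    moreover have "d * L2norm (f n) \<le> L2norm (\<lambda>z. T (f n) z - \<mu> *s f n z)" for n
      by (rule smooth_lower_bound[OF f(1) d])
    ultimately have "d * L2norm \<phi> \<le> L2norm (\<lambda>z. \<xi> z - \<mu> *s \<phi> z)"
      by (intro LIMSEQ_le) auto
    then show ?thesis using d(1) by (simp add: field_simps)
  qed
  ultimately show ?thesis unfolding resolvent_set_def by blast
qed

text \<open>A nonzero eigenspinor, with the constant sequence as approximants, lies in the graph of
  the closure and is annihilated by the shifted operator; this contradicts the bounded
  inverse.\<close>

lemma eigval_in_spectrum:
  assumes "l \<in> eigvals t"
  shows "complex_of_real l \<notin> resolvent_set T"
proof
  assume "complex_of_real l \<in> resolvent_set T"
  then obtain C where C: "\<And>\<phi> \<xi>. closure_graph T \<phi> \<xi> \<Longrightarrow> L2norm \<phi> \<le> C * L2norm (\<lambda>z. \<xi> z - complex_of_real l *s \<phi> z)"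
    unfolding resolvent_set_def by blast
  obtain f z where f: "eigen l f" "z \<in> S3" "f z \<noteq> 0"
    by (rule eigenvalue_attained[OF assms])
  have sf: "smooth_on_S3 f" using f(1) by (simp add: eigen_def)
  have "closure_graph T f (T f)"
    unfolding closure_graph_def
    using sf by (auto simp: L2norm_0 intro!: exI[of _ "\<lambda>n. f"] L2_continuous smooth_continuous T_continuous)
  from C[OF this] have "L2norm f \<le> C * L2norm (\<lambda>z. T f z - complex_of_real l *s f z)" .
  also have "L2norm (\<lambda>z. T f z - complex_of_real l *s f z) = L2norm (\<lambda>z. 0)"
    using f(1) by (intro L2norm_cong) (simp add: eigen_def)
  finally show False
    using L2norm_pos[OF eigen_continuous[OF f(1)] f(2,3)] by (simp add: L2norm_0)
qed

lemma spectrum_T: "spectrum T = complex_of_real ` eigvals t"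
  unfolding spectrum_def using not_eigval_in_resolvent eigval_in_spectrum by blast

end

theorem theorem5p1:
  fixes t :: real and c :: "nat \<Rightarrow> complex ^ 2 ^ 2"
  assumes "spinor_module c"
  shows "spectrum (magnetic_dirac c t) = complex_of_real `
    ({3/2 + t + real k | k :: nat. True} \<union>
     {3/2 - t + real k | k :: nat. True} \<union>
     {1/2 + sqrt ((1 + t + 2 * real p - real k)\<^sup>2 + 4 * (real k - real p) * (real p + 1))
        | p k :: nat. p < k} \<union>
     {1/2 - sqrt ((1 + t + 2 * real p - real k)\<^sup>2 + 4 * (real k - real p) * (real p + 1))
        | p k :: nat. p < k})"
proof -
  interpret spinor_mod c t by (rule spinor_mod.intro[OF assms])
  show ?thesis using spectrum_T unfolding eigvals_def .
qed

end
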